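(* Let $K$ be an arbitrary field and let $G=D_n$ be the dihedral group of order $2n$. (1) If $\operatorname{char}K=0$, then $\operatorname{ed}_K(G)=1$ if and only if $n$ is odd and $\zeta_n+\zeta_n^{-1}\in K$. (2) If $\operatorname{char}K=p>0$ and $p\neq 2$, then $\operatorname{ed}_K(G)=1$ if and only if $n$ is odd and, moreover, $\zeta_n+\zeta_n^{-1}\in K$ when $p\nmid n$, or $n=p$ when $p\mid n$. (3) If $\operatorname{char}K=2$, then $\operatorname{ed}_K(G)=1$ if and only if $\zeta_n+\zeta_n^{-1}\in K$ when $n$ is odd, or $|K|\ge 4$ and $n=2$ when $n$ is even.
   Context: Essential dimension: for a finite group $G$ and a field $K$, choose a faithful finite-dimensional representation $G\to GL(V)$ over $K$ and let $K(V)$ be the field of rational functions on $V$ with the induced $G$-action. A faithful $G$-subfield is a subfield $E$ with $K\subseteq E\subseteq K(V)$, stable under $G$, on which $G$ acts faithfully. Then $\operatorname{ed}_K(G)$ is the minimum of $\operatorname{trdeg}_K E$ over all faithful $G$-subfields $E$; it is independent of $V$. $\zeta_n$ denotes a primitive $n$-th root of unity in an algebraic closure of $K$ (used only when $\operatorname{char}K\nmid n$). *)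

theory Defs
  imports "HOL-Library.Poly_Mapping" "HOL-Library.Extended_Nat"
    "HOL-Computational_Algebra.Fraction_Field"
    "HOL-Algebra.Algebraic_Closure_Type"
begin

definition pvars :: "(('v \<Rightarrow>\<^sub>0 nat) \<Rightarrow>\<^sub>0 'k::zero) \<Rightarrow> 'v set" where
  "pvars p = (\<Union>m\<in>Poly_Mapping.keys p. Poly_Mapping.keys m)"

definition mpeval :: "('k::zero \<Rightarrow> 'a::comm_ring_1) \<Rightarrow> ('v \<Rightarrow> 'a) \<Rightarrow> (('v \<Rightarrow>\<^sub>0 nat) \<Rightarrow>\<^sub>0 'k) \<Rightarrow> 'a" where
  "mpeval c x p = (\<Sum>m\<in>Poly_Mapping.keys p.
      c (Poly_Mapping.lookup p m) * (\<Prod>v\<in>Poly_Mapping.keys m. x v ^ Poly_Mapping.lookup m v))"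

text \<open>Fraction field of the polynomial ring over 'k in the variables x_0, x_1, ... .
  The field K(V) of a representation with basis indexed by a finite set N of naturals
  is the subfield of fractions whose numerator and denominator only involve x_v, v in N.\<close>
type_synonym 'k ratfun = "((nat \<Rightarrow>\<^sub>0 nat) \<Rightarrow>\<^sub>0 'k) fract"

definition constK :: "'k::field \<Rightarrow> 'k ratfun" where
  "constK c = Fract (Poly_Mapping.single 0 c) 1"

definition Xvar :: "nat \<Rightarrow> 'k::field ratfun" where
  "Xvar v = Fract (Poly_Mapping.single (Poly_Mapping.single v 1) 1) 1"

definition KV :: "nat set \<Rightarrow> 'k::field ratfun set" where
  "KV N = {Fract a b | a b. b \<noteq> 0 \<and> pvars a \<subseteq> N \<and> pvars b \<subseteq> N}"

text \<open>A finite group G is given as a HOL-Algebra monoid with carrier a finite set of naturals.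
  We use the (faithful) regular representation V = K[G] with coordinate functions x_h
  (h in carrier G); g acts on K(V) by the K-automorphism with g . x_h = x_(g h).\<close>

definition gact :: "nat monoid \<Rightarrow> nat \<Rightarrow> 'k::field ratfun \<Rightarrow> 'k ratfun" where
  "gact G g q = (THE y. \<exists>a b. b \<noteq> 0 \<and> pvars a \<subseteq> carrier G \<and> pvars b \<subseteq> carrier G \<and>
      q = Fract a b \<and>
      y = mpeval constK (\<lambda>v. Xvar (monoid.mult G g v)) a / mpeval constK (\<lambda>v. Xvar (monoid.mult G g v)) b)"

definition is_K_subfield :: "'k::field ratfun set \<Rightarrow> bool" where
  "is_K_subfield E \<longleftrightarrow> range constK \<subseteq> E \<and>
     (\<forall>x\<in>E. \<forall>y\<in>E. x + y \<in> E \<and> x * y \<in> E \<and> - x \<in> E) \<and>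
     (\<forall>x\<in>E. x \<noteq> 0 \<longrightarrow> inverse x \<in> E)"

definition alg_indep_K :: "'k::field ratfun set \<Rightarrow> bool" where
  "alg_indep_K S \<longleftrightarrow> (\<forall>p :: ('k ratfun \<Rightarrow>\<^sub>0 nat) \<Rightarrow>\<^sub>0 'k.
      pvars p \<subseteq> S \<longrightarrow> mpeval constK id p = 0 \<longrightarrow> p = 0)"

definition trdeg_K :: "'k::field ratfun set \<Rightarrow> enat" where
  "trdeg_K E = Sup {enat (card S) | S. finite S \<and> S \<subseteq> E \<and> alg_indep_K S}"

definition faithful_G_subfield :: "nat monoid \<Rightarrow> 'k::field ratfun set \<Rightarrow> bool" where
  "faithful_G_subfield G E \<longleftrightarrow> E \<subseteq> KV (carrier G) \<and> is_K_subfield E \<and>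
     (\<forall>g\<in>carrier G. \<forall>x\<in>E. gact G g x \<in> E) \<and>
     (\<forall>g\<in>carrier G. (\<forall>x\<in>E. gact G g x = x) \<longrightarrow> g = monoid.one G)"

text \<open>Essential dimension ed_K(G), computed with the regular representation.\<close>
definition ess_dim :: "'k::field itself \<Rightarrow> nat monoid \<Rightarrow> enat" where
  "ess_dim _ G = (INF E \<in> {E :: 'k ratfun set. faithful_G_subfield G E}. trdeg_K E)"

text \<open>The element r^i s^b (0 \<le> i < n, b \<in> {0,1}) is encoded as i + n*b, where r is the rotation
  of order n, s a reflection with s r s = r^(-1).\<close>
definition dih_mult :: "nat \<Rightarrow> nat \<Rightarrow> nat \<Rightarrow> nat" where
  "dih_mult n c d = (let i = c mod n; a = c div n; j = d mod n; b = d div n in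
      ((i + (if a = 0 then j else n - j)) mod n) + n * ((a + b) mod 2))"

definition dihedral :: "nat \<Rightarrow> nat monoid" where
  "dihedral n = \<lparr>carrier = {0..<2*n}, monoid.mult = dih_mult n, one = 0\<rparr>"

definition primitive_root_of_unity :: "nat \<Rightarrow> 'a::field \<Rightarrow> bool" where
  "primitive_root_of_unity n z \<longleftrightarrow> z ^ n = 1 \<and> (\<forall>k. 0 < k \<and> k < n \<longrightarrow> z ^ k \<noteq> 1)"

definition zeta_sum_in :: "'k::field itself \<Rightarrow> nat \<Rightarrow> bool" where
  "zeta_sum_in _ n \<longleftrightarrow> (\<exists>z :: 'k alg_closure. primitive_root_of_unity n z \<and>
      z + inverse z \<in> range (to_ac :: 'k \<Rightarrow> 'k alg_closure))"

end

theory Submission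
  imports Defs "HOL-Computational_Algebra.Polynomial_Factorial"
begin

text \<open>
  A faithful \<open>G\<close>-subfield of transcendence degree 1 is a rational function field \<open>K(t)\<close>: a place of \<open>K(V)\<close>
  with residue field \<open>K(X)\<close>, centred at a point whose coordinates are high powers of \<open>X\<close>, embeds it into \<open>K(X)\<close>,
  where Lueroth's theorem applies. Hence \<open>D n\<close> acts on \<open>t\<close> by Moebius transformations. The powers of the
  rotation are governed by the Lucas sequence of its trace and determinant, whose first zero yields either
  \<open>\<zeta> + 1/\<zeta> \<in> K\<close> or \<open>n = p\<close>. If \<open>n\<close> is even, \<open>D n\<close> contains a Klein four-group; outside characteristic 2 it is
  diagonalisable on \<open>V\<close>, so it fixes a place of \<open>K(V)\<close> with residue field \<open>K\<close> and acts on leading terms by signs,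
  and then one of its involutions acts trivially on \<open>t\<close>. In characteristic 2 only \<open>n = 2\<close> remains, and the
  field with two elements is excluded by a trace computation. Conversely, the Lucas sequence gives two linear forms
  spanning a representation in which the quotient of the two forms generates a faithful subfield.
\<close>

section \<open>Evaluation of polynomials and extension to fractions\<close>

text \<open>Outside characteristic 2, PGL_2(K) does contain Klein four-groups, such as the one
  generated by t -> -t and t -> 1/t. So Moebius arithmetic alone cannot exclude even n; the linear
  action on V has to enter, and it enters through the fixed place. For the rotation arithmetic
  suffices: its matrix is known only up to a scalar, and the invariant quantity is the quotient x/y
  of the eigenvalues, with x/y + y/x = T^2/D - 2 in K. Lueroth's theorem concerns one variable,
  while the subfield E lies in a field of many. A residue field K(X) leaves room for one element f
  of E to have a transcendental residue; since E is algebraic over K(f), all its nonzero elements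
  are then units and E embeds. The point is chosen with coordinates in K(X) because a finite K has
  too few points. For sufficiency the determinant is normalised to 1. The condition
  \<open>lucas T 1 (n - 1) = - 1\<close> says that the n-th power of the rotation matrix is the
  identity and not merely a scalar, so the matrix really occurs in a linear representation of the
  dihedral group.\<close>

abbreviation (input) "lookup \<equiv> Poly_Mapping.lookup"
abbreviation (input) "keys \<equiv> Poly_Mapping.keys"
abbreviation (input) "single \<equiv> Poly_Mapping.single"

locale rhom =
  fixes \<phi> :: "'a::comm_ring_1 \<Rightarrow> 'b::comm_ring_1"
  assumes hom_one [simp]: "\<phi> 1 = 1"
    and hom_add [simp]: "\<phi> (x + y) = \<phi> x + \<phi> y"
    and hom_mult [simp]: "\<phi> (x * y) = \<phi> x * \<phi> y"
begin

lemma hom_zero [simp]: "\<phi> 0 = 0"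
  using hom_add[of 0 0] by simp

lemma hom_uminus [simp]: "\<phi> (- x) = - \<phi> x"
  using hom_add[of x "- x"] by (simp add: eq_neg_iff_add_eq_0 add.commute)

lemma hom_diff [simp]: "\<phi> (x - y) = \<phi> x - \<phi> y"
  using hom_add[of x "- y"] by simp

lemma hom_power [simp]: "\<phi> (x ^ k) = \<phi> x ^ k"
  by (induction k) auto

lemma hom_sum: "\<phi> (sum f A) = (\<Sum>i\<in>A. \<phi> (f i))"
  by (induction A rule: infinite_finite_induct) auto

lemma hom_prod: "\<phi> (prod f A) = (\<Prod>i\<in>A. \<phi> (f i))"
  by (induction A rule: infinite_finite_induct) auto

end

lemma rhom_comp: "rhom f \<Longrightarrow> rhom g \<Longrightarrow> rhom (\<lambda>x. g (f x))"
  by (simp add: rhom_def)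

locale field_hom = rhom \<phi> for \<phi> :: "'a::field \<Rightarrow> 'b::field"
begin

lemma hom_eq_0_iff [simp]: "\<phi> x = 0 \<longleftrightarrow> x = 0"
proof
  assume "\<phi> x = 0"
  show "x = 0"
  proof (rule ccontr)
    assume "x \<noteq> 0"
    then have "\<phi> (x * inverse x) = 1" by simp
    with \<open>\<phi> x = 0\<close> show False by (simp del: right_inverse)
  qed
qed simp

lemma hom_inverse [simp]: "\<phi> (inverse x) = inverse (\<phi> x)"
proof (cases "x = 0")
  case False
  then have "\<phi> x * \<phi> (inverse x) = 1" by (simp flip: hom_mult)
  then show ?thesis by (metis inverse_unique)
qed simp

lemma hom_divide [simp]: "\<phi> (x / y) = \<phi> x / \<phi> y"
  by (simp add: field_class.field_divide_inverse)

end

text \<open>Exponent vectors are finitely supported maps as well, so the rule is kept generic and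
  serves induction on polynomials and on monomials alike.\<close>

lemma mpoly_induct [case_names single add]:
  fixes p :: "'a \<Rightarrow>\<^sub>0 'b::monoid_add"
  assumes "\<And>m a. P (single m a)" and "\<And>p q. P p \<Longrightarrow> P q \<Longrightarrow> P (p + q)"
  shows "P p"
proof (induction p rule: Poly_Mapping.update_induct)
  case const
  show ?case using assms(1)[of undefined 0] by simp
next
  case (update f a b)
  have "Poly_Mapping.update a b f = f + single a b"
    using update(1) by (intro poly_mapping_eqI)
      (auto simp: lookup_update lookup_add lookup_single when_def in_keys_iff)
  then show ?case using update(3) assms by simp
qed

section \<open>Evaluation homomorphisms of polynomial rings\<close>

definition monom_eval :: "('v \<Rightarrow> 'a::comm_ring_1) \<Rightarrow> ('v \<Rightarrow>\<^sub>0 nat) \<Rightarrow> 'a" where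
  "monom_eval x m = (\<Prod>v\<in>keys m. x v ^ lookup m v)"

lemma monom_eval_superset:
  "finite A \<Longrightarrow> keys m \<subseteq> A \<Longrightarrow> monom_eval x m = (\<Prod>v\<in>A. x v ^ lookup m v)"
  unfolding monom_eval_def by (intro prod.mono_neutral_left) (auto simp: in_keys_iff)

lemma monom_eval_zero [simp]: "monom_eval x 0 = 1"
  by (simp add: monom_eval_def)

lemma monom_eval_single [simp]: "monom_eval x (single v k) = x v ^ k"
  by (simp add: monom_eval_def)

lemma monom_eval_add: "monom_eval x (m + m') = monom_eval x m * monom_eval x m'"
proof -
  let ?A = "keys m \<union> keys m'"
  show ?thesis
    using Poly_Mapping.keys_add[of m m']
    by (simp add: monom_eval_superset[of ?A] lookup_add power_add prod.distrib)
qed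

lemma monom_eval_cong: "(\<And>v. v \<in> keys m \<Longrightarrow> x v = y v) \<Longrightarrow> monom_eval x m = monom_eval y m"
  by (simp add: monom_eval_def)

lemma mpeval_conv: "mpeval c x p = (\<Sum>m\<in>keys p. c (lookup p m) * monom_eval x m)"
  by (simp add: mpeval_def monom_eval_def)

lemma mpeval_cong:
  "(\<And>v. v \<in> pvars p \<Longrightarrow> x v = y v) \<Longrightarrow> mpeval c x p = mpeval c y p"
  unfolding mpeval_conv pvars_def
  by (intro sum.cong refl arg_cong2[where f = "(*)"] monom_eval_cong) auto

context rhom
begin

lemma mpeval_superset:
  "finite A \<Longrightarrow> keys p \<subseteq> A \<Longrightarrow>
    mpeval \<phi> x p = (\<Sum>m\<in>A. \<phi> (lookup p m) * monom_eval x m)"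
  unfolding mpeval_conv by (intro sum.mono_neutral_left) (auto simp: in_keys_iff)

lemma mpeval_single [simp]: "mpeval \<phi> x (single m a) = \<phi> a * monom_eval x m"
  by (simp add: mpeval_conv)

lemma mpeval_add [simp]: "mpeval \<phi> x (p + q) = mpeval \<phi> x p + mpeval \<phi> x q"
proof -
  let ?A = "keys p \<union> keys q"
  show ?thesis
    using Poly_Mapping.keys_add[of p q]
    by (simp add: mpeval_superset[of ?A] lookup_add sum.distrib algebra_simps)
qed

lemma mpeval_mult [simp]: "mpeval \<phi> x (p * q) = mpeval \<phi> x p * mpeval \<phi> x q"
proof (induction p rule: mpoly_induct)
  case (single m a)
  show ?case
    by (induction q rule: mpoly_induct) (auto simp: mult_single monom_eval_add algebra_simps)
qed (simp add: algebra_simps)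

lemma rhom_mpeval: "rhom (mpeval \<phi> x)"
proof
  have "mpeval \<phi> x (single 0 1) = 1" by (subst mpeval_single) simp
  then show "mpeval \<phi> x 1 = 1" by simp
qed simp_all

end

lemma rhom_single: "rhom (single 0 :: 'a::comm_ring_1 \<Rightarrow> ('v::type \<Rightarrow>\<^sub>0 nat) \<Rightarrow>\<^sub>0 'a)"
  by unfold_locales (auto simp: single_add mult_single)

lemma (in rhom) hom_mpeval:
  assumes "rhom c"
  shows "\<phi> (mpeval c x p) = mpeval (\<lambda>a. \<phi> (c a)) (\<lambda>v. \<phi> (x v)) p"
  by (simp add: mpeval_conv hom_sum monom_eval_def hom_prod)

lemma single_monom_conv: "single m (1::'a::comm_ring_1) = monom_eval (\<lambda>v. single (single v 1) 1) m"
proof -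
  have pow: "single (single v 1) (1::'a) ^ k = single (single v k) 1" for v :: 'b and k
    by (induction k) (auto simp: mult_single simp flip: single_add)
  show ?thesis
  proof (induction m rule: mpoly_induct)
    case (single v k)
    then show ?case by (simp add: pow del: One_nat_def)
  next
    case (add p q)
    have "single (p + q) (1::'a) = single p 1 * single q 1"
      by (simp add: mult_single)
    with add show ?case by (simp add: monom_eval_add del: One_nat_def)
  qed
qed

lemma mpeval_id: "mpeval (single 0) (\<lambda>v. single (single v 1) 1) p = (p :: ('v \<Rightarrow>\<^sub>0 nat) \<Rightarrow>\<^sub>0 'a::comm_ring_1)"
proof -
  interpret rhom "single 0 :: 'a \<Rightarrow> ('v \<Rightarrow>\<^sub>0 nat) \<Rightarrow>\<^sub>0 'a" by (rule rhom_single)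
  show ?thesis
    by (induction p rule: mpoly_induct) (auto simp flip: single_monom_conv simp: mult_single simp del: One_nat_def)
qed

section \<open>Extension of injective homomorphisms to fraction fields\<close>

lemma Fract_inj: "Fract a 1 = Fract b 1 \<longleftrightarrow> a = b"
  by (simp add: eq_fract)

lemma rhom_Fract: "rhom (\<lambda>a. Fract a 1)"
  by unfold_locales (auto simp: One_fract_def)

lemma Fract_div: "Fract a b = Fract a 1 / Fract b 1"
  by simp

text \<open>The choice below is only meaningful for injective homs into a field.\<close>
definition fext :: "('a::idom \<Rightarrow> 'b::field) \<Rightarrow> 'a fract \<Rightarrow> 'b" where
  "fext \<theta> q = (let ab = (SOME ab. snd ab \<noteq> 0 \<and> q = Fract (fst ab) (snd ab)) in \<theta> (fst ab) / \<theta> (snd ab))"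

locale inj_rhom = rhom \<theta> for \<theta> :: "'a::idom \<Rightarrow> 'b::field" +
  assumes ker: "\<theta> x = 0 \<Longrightarrow> x = 0"
begin

lemma hom_eq_0 [simp]: "\<theta> x = 0 \<longleftrightarrow> x = 0"
  using ker by auto

lemma fext_Fract [simp]:
  assumes "b \<noteq> 0"
  shows "fext \<theta> (Fract a b) = \<theta> a / \<theta> b"
proof -
  define ab where "ab = (SOME ab. snd ab \<noteq> 0 \<and> Fract a b = Fract (fst ab) (snd ab))"
  have "\<exists>ab. snd ab \<noteq> 0 \<and> Fract a b = Fract (fst ab) (snd ab)"
    using assms by (intro exI[of _ "(a, b)"]) auto
  then have ab: "snd ab \<noteq> 0" "Fract a b = Fract (fst ab) (snd ab)"
    unfolding ab_def by (metis (mono_tags, lifting) someI_ex)+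
  then have "a * snd ab = fst ab * b" using assms by (simp add: eq_fract)
  then have "\<theta> a * \<theta> (snd ab) = \<theta> (fst ab) * \<theta> b" by (simp flip: hom_mult)
  moreover have "fext \<theta> (Fract a b) = \<theta> (fst ab) / \<theta> (snd ab)"
    by (simp add: fext_def ab_def Let_def)
  ultimately show ?thesis using ab(1) assms by (simp add: frac_eq_eq)
qed

sublocale fext: field_hom "fext \<theta>"
proof
  show "fext \<theta> 1 = 1" by (simp add: One_fract_def)
  fix x y :: "'a fract"
  obtain a b where x: "x = Fract a b" "b \<noteq> 0" by (cases x) auto
  obtain c d where y: "y = Fract c d" "d \<noteq> 0" by (cases y) auto
  show "fext \<theta> (x + y) = fext \<theta> x + fext \<theta> y" "fext \<theta> (x * y) = fext \<theta> x * fext \<theta> y"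
    using x y by (auto simp: field_simps)
qed

end

lemma rhom_constK: "rhom constK"
  unfolding constK_def by (rule rhom_comp[OF rhom_single rhom_Fract])

lemma field_hom_constK: "field_hom constK"
  by (simp add: field_hom_def rhom_constK)

interpretation constK: field_hom constK by (rule field_hom_constK)

lemma Fract_one_conv_mpeval: "Fract p 1 = mpeval constK Xvar p"
proof -
  interpret F: rhom "\<lambda>a. Fract a (1 :: (nat \<Rightarrow>\<^sub>0 nat) \<Rightarrow>\<^sub>0 'a)" by (rule rhom_Fract)
  have "Fract p 1 = Fract (mpeval (single 0) (\<lambda>v. single (single v 1) 1) p) 1"
    by (simp add: mpeval_id del: One_nat_def)
  also have "\<dots> = mpeval constK Xvar p"
    by (simp add: F.hom_mpeval[OF rhom_single] constK_def[abs_def] Xvar_def[abs_def])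
  finally show ?thesis .
qed

lemma ratfun_hom_eqI:
  assumes "field_hom f" "field_hom g" "\<And>c. f (constK c) = g (constK c)" "\<And>v. f (Xvar v) = g (Xvar v)"
  shows "f q = g q"
proof -
  interpret f: field_hom f by fact
  interpret g: field_hom g by fact
  have *: "f (Fract p 1) = g (Fract p 1)" for p
    using assms(3,4) by (simp add: Fract_one_conv_mpeval f.hom_mpeval g.hom_mpeval rhom_constK)
  show ?thesis
    by (cases q) (metis * Fract_div f.hom_divide g.hom_divide)
qed

section \<open>Places\<close>

definition pev :: "('k::field \<Rightarrow> 'a::comm_ring_1) \<Rightarrow> 'a \<Rightarrow> 'k poly \<Rightarrow> 'a" where
  "pev \<kappa> t A = poly (map_poly \<kappa> A) t"

context rhom
begin

lemma map_poly_pCons_hom [simp]: "map_poly \<phi> (pCons a A) = pCons (\<phi> a) (map_poly \<phi> A)"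
  by (simp add: map_poly_pCons)

lemma map_poly_add_hom [simp]: "map_poly \<phi> (A + B) = map_poly \<phi> A + map_poly \<phi> B"
  by (intro poly_eqI) (simp add: coeff_map_poly)

lemma map_poly_smult_hom [simp]: "map_poly \<phi> (smult a A) = smult (\<phi> a) (map_poly \<phi> A)"
  by (intro poly_eqI) (simp add: coeff_map_poly)

lemma map_poly_mult_hom [simp]: "map_poly \<phi> (A * B) = map_poly \<phi> A * map_poly \<phi> B"
  by (induction A) auto

lemma rhom_map_poly: "rhom (map_poly \<phi>)"
  by unfold_locales (simp_all add: one_pCons)

end

lemma rhom_poly: "rhom (\<lambda>A. poly A t)"
  by unfold_locales auto

lemma rhom_const_poly: "rhom (\<lambda>c. [:c:])"
  by unfold_locales (auto simp: one_pCons)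

lemma rhom_pev: 
  assumes "rhom \<kappa>" shows "rhom (pev \<kappa> t)"
proof -
  interpret rhom \<kappa> by fact
  show ?thesis unfolding pev_def by (rule rhom_comp[OF rhom_map_poly rhom_poly])
qed

lemma pev_pCons [simp]: "rhom \<kappa> \<Longrightarrow> pev \<kappa> t (pCons a A) = \<kappa> a + t * pev \<kappa> t A"
  by (simp add: pev_def map_poly_pCons rhom.hom_zero)

lemma pev_0 [simp]: "pev \<kappa> t 0 = 0"
  by (simp add: pev_def)

lemma pev_pcompose: "rhom \<kappa> \<Longrightarrow> pev \<kappa> t (pcompose A B) = pev \<kappa> (pev \<kappa> t B) A"
  using rhom_pev[of \<kappa> t, THEN rhom.hom_mult] rhom_pev[of \<kappa> t, THEN rhom.hom_add]
  by (induction A) (auto simp: pcompose_pCons)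

lemma (in rhom) hom_pev: "rhom \<kappa> \<Longrightarrow> \<phi> (pev \<kappa> t A) = pev (\<lambda>a. \<phi> (\<kappa> a)) (\<phi> t) A"
  by (induction A) (auto simp: rhom_comp rhom_axioms)

definition transc :: "('k::field \<Rightarrow> 'a::comm_ring_1) \<Rightarrow> 'a \<Rightarrow> bool" where
  "transc \<kappa> t \<longleftrightarrow> (\<forall>A. pev \<kappa> t A = 0 \<longrightarrow> A = 0)"

text \<open>A place of a field, given as the graph of its partial residue map.\<close>
locale place =
  fixes R :: "'l::field \<Rightarrow> 'f::field \<Rightarrow> bool"
  assumes unique: "R x a \<Longrightarrow> R x b \<Longrightarrow> a = b"
    and one: "R 1 1"
    and add: "R x a \<Longrightarrow> R y b \<Longrightarrow> R (x + y) (a + b)"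
    and mult: "R x a \<Longrightarrow> R y b \<Longrightarrow> R (x * y) (a * b)"
    and inverse: "R x a \<Longrightarrow> a \<noteq> 0 \<Longrightarrow> R (inverse x) (inverse a)"
    and total: "\<nexists>a. R x a \<Longrightarrow> R (inverse x) 0"
    and zero: "R 0 0"
begin

lemma nonzero: "R x a \<Longrightarrow> a \<noteq> 0 \<Longrightarrow> x \<noteq> 0"
  using unique zero by blast

lemma power: "R x a \<Longrightarrow> R (x ^ k) (a ^ k)"
  by (induction k) (auto intro: one mult)

lemma sum: "(\<And>i. i \<in> A \<Longrightarrow> R (f i) (g i)) \<Longrightarrow> R (\<Sum>i\<in>A. f i) (\<Sum>i\<in>A. g i)"
  by (induction A rule: infinite_finite_induct) (auto intro: zero add)

lemma prod: "(\<And>i. i \<in> A \<Longrightarrow> R (f i) (g i)) \<Longrightarrow> R (\<Prod>i\<in>A. f i) (\<Prod>i\<in>A. g i)"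
  by (induction A rule: infinite_finite_induct) (auto intro: one mult)

lemma mpeval:
  "(\<And>c. R (\<kappa> c) (\<iota> c)) \<Longrightarrow> (\<And>v. R (x v) (y v)) \<Longrightarrow> R (mpeval \<kappa> x p) (mpeval \<iota> y p)"
  unfolding mpeval_def by (intro sum mult prod power) auto

lemma pev:
  "rhom \<kappa> \<Longrightarrow> rhom \<iota> \<Longrightarrow> (\<And>c. R (\<kappa> c) (\<iota> c)) \<Longrightarrow> R t a \<Longrightarrow> R (pev \<kappa> t A) (pev \<iota> a A)"
  by (induction A) (auto intro: zero add mult)

text \<open>\<open>u\<close> lies in the maximal ideal and the nonzero coefficients are units. Once
  the power of \<open>u\<close> belonging to the lowest nonzero coefficient is split off, the other
  factor has that coefficient's nonzero residue.\<close>

lemma poly_nonzero: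
  assumes "Q \<noteq> 0" "\<And>i. coeff Q i = 0 \<or> (\<exists>d. d \<noteq> 0 \<and> R (coeff Q i) d)" "R u 0" "u \<noteq> 0"
  shows "(\<exists>d. R (poly Q u) d) \<and> poly Q u \<noteq> 0"
  using assms(1,2)
proof (induction Q)
  case (pCons a Q)
  have Q: "coeff Q i = 0 \<or> (\<exists>d. d \<noteq> 0 \<and> R (coeff Q i) d)" for i
    using pCons.prems(2)[of "Suc i"] by simp
  have ex: "\<exists>d. R (poly Q u) d"
    using pCons.IH[OF _ Q] zero by (cases "Q = 0") auto
  have a: "a = 0 \<or> (\<exists>d. d \<noteq> 0 \<and> R a d)"
    using pCons.prems(2)[of 0] by simp
  show ?case
  proof (cases "a = 0")
    case True
    with pCons.hyps have "Q \<noteq> 0" by simp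
    with pCons.IH[OF _ Q] True assms(4) ex mult[OF assms(3)] show ?thesis by auto
  next
    case False
    with a obtain d where d: "d \<noteq> 0" "R a d" by blast
    from ex obtain d' where "R (poly Q u) d'" by blast
    from add[OF d(2) mult[OF assms(3) this]] have "R (poly (pCons a Q) u) d" by simp
    with d nonzero show ?thesis by blast
  qed
qed simp

text \<open>If a root is not a unit, it or its inverse lies in the maximal ideal. The inverse is a
  root of the reflected polynomial, whose coefficients are again units or zero.\<close>

lemma poly_root_unit:
  assumes "Q \<noteq> 0" "\<And>i. coeff Q i = 0 \<or> (\<exists>d. d \<noteq> 0 \<and> R (coeff Q i) d)" "poly Q e = 0" "e \<noteq> 0"
  shows "\<exists>a. a \<noteq> 0 \<and> R e a"
proof (rule ccontr)
  assume neg: "\<not> ?thesis"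
  show False
  proof (cases "\<exists>a. R e a")
    case True
    with neg have "R e 0" by metis
    with poly_nonzero[OF assms(1,2)] assms(3,4) show False by blast
  next
    case False
    then have inv: "R (inverse e) 0" using total by blast
    have "coeff (reflect_poly Q) i = 0 \<or> (\<exists>d. d \<noteq> 0 \<and> R (coeff (reflect_poly Q) i) d)" for i
      using assms(2) by (simp add: coeff_reflect_poly)
    from poly_nonzero[OF _ this inv] assms(1,4) have "poly (reflect_poly Q) (inverse e) \<noteq> 0" by auto
    then show False using assms(3,4) by (simp add: poly_reflect_poly_nz)
  qed
qed

text \<open>Nonzero polynomials in \<open>f\<close> are units because their residues are nonzero
  polynomials in the transcendental \<open>c\<close>. This later makes the residue map injective on
  a subfield algebraic over K(f).\<close>

lemma root_unit_over_transc:
  assumes "rhom \<kappa>" "rhom \<iota>" "\<And>c. R (\<kappa> c) (\<iota> c)" "R f c" "transc \<iota> c"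
    and "P \<noteq> 0" "poly (map_poly (pev \<kappa> f) P) e = 0" "e \<noteq> 0"
  shows "\<exists>a. a \<noteq> 0 \<and> R e a"
proof (rule poly_root_unit[of "map_poly (pev \<kappa> f) P"])
  have R: "R (pev \<kappa> f A) (pev \<iota> c A)" for A by (intro pev assms)
  have nz: "pev \<iota> c A \<noteq> 0" if "A \<noteq> 0" for A using assms(5) that by (auto simp: transc_def)
  show "coeff (map_poly (pev \<kappa> f) P) i = 0 \<or> (\<exists>d. d \<noteq> 0 \<and> R (coeff (map_poly (pev \<kappa> f) P) i) d)" for i
    using R nz by (cases "coeff P i = 0") (auto simp: coeff_map_poly)
  have "pev \<kappa> f (lead_coeff P) \<noteq> 0" using R nz nonzero assms(6) by (metis leading_coeff_0_iff)
  then show "map_poly (pev \<kappa> f) P \<noteq> 0"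
    by (metis coeff_map_poly coeff_0 pev_0)
qed (use assms in auto)

text \<open>When the residue field is K itself, \<open>e\<close> minus its residue is again
  algebraic over K but lies in the maximal ideal, whereas a nonzero algebraic element is a
  unit.\<close>

lemma algebraic_imp_const:
  assumes "rhom \<kappa>" "\<And>c. R (\<kappa> c) c" "A \<noteq> 0" "pev \<kappa> e A = 0"
  shows "e \<in> range \<kappa>"
proof (rule ccontr)
  interpret rhom \<kappa> by fact
  assume e: "e \<notin> range \<kappa>"
  have *: "\<exists>a. a \<noteq> 0 \<and> R u a" if "B \<noteq> 0" "pev \<kappa> u B = 0" "u \<noteq> 0" for u B
  proof (rule poly_root_unit[of "map_poly \<kappa> B"])
    show "coeff (map_poly \<kappa> B) i = 0 \<or> (\<exists>d. d \<noteq> 0 \<and> R (coeff (map_poly \<kappa> B) i) d)" for i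
      using assms(2) by (cases "coeff B i = 0") (auto simp: coeff_map_poly)
    show "map_poly \<kappa> B \<noteq> 0"
      using nonzero[OF assms(2)[of "lead_coeff B"]] that(1)
      by (metis coeff_map_poly coeff_0 hom_zero leading_coeff_0_iff)
  qed (use that in \<open>auto simp: pev_def\<close>)
  have "e \<noteq> 0" using e hom_zero by (metis rangeI)
  from *[OF assms(3,4) this] obtain a where a: "R e a" by blast
  define u where "u = e - \<kappa> a"
  have "R (\<kappa> (-1)) (-1)" by (rule assms(2))
  from add[OF a mult[OF this assms(2)[of a]]] have "R u 0" by (simp add: u_def)
  moreover have "u \<noteq> 0" using e by (auto simp: u_def)
  moreover have "pev \<kappa> u (pcompose A [:a, 1:]) = 0"
    using assms(4) by (simp add: pev_pcompose assms(1) u_def)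
  moreover have "pcompose A [:a, 1:] \<noteq> 0"
    using assms(3) by (simp add: pcompose_eq_0_iff)
  ultimately show False using *[of "pcompose A [:a, 1:]" u] unique by blast
qed

end

lemma place_comp:
  assumes "place R" "field_hom \<phi>"
  shows "place (\<lambda>x. R (\<phi> x))"
proof -
  interpret place R by fact
  interpret field_hom \<phi> by fact
  show ?thesis
    by unfold_locales (auto intro: unique one add mult inverse total zero)
qed

lemma mpoly_sum_single: "(\<Sum>m\<in>keys p. single m (lookup p m)) = p"
  by (intro poly_mapping_eqI) (auto simp: lookup_sum lookup_single when_def in_keys_iff)

section \<open>The lowest-monomial place\<close>

text \<open>\<open>m\<close> and \<open>n\<close> are only lower bounds and may fail to be attained.
  Strict monotonicity of addition leaves (m, n) as the only pair of monomials with sum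
  \<open>m + n\<close>.\<close>

lemma lookup_mult_least:
  fixes p q :: "'a::{linorder, ordered_cancel_comm_monoid_add} \<Rightarrow>\<^sub>0 'b::comm_ring_1"
  assumes "\<forall>k\<in>keys p. m \<le> k" "\<forall>k\<in>keys q. n \<le> k"
  shows "lookup (p * q) (m + n) = lookup p m * lookup q n"
proof -
  let ?l = "lookup" and ?K = "keys"
  have eq: "k = m \<and> l = n" if "k \<in> ?K p" "l \<in> ?K q" "k + l = m + n" for k l
  proof -
    from that assms have *: "m \<le> k" "n \<le> l" by auto
    show ?thesis
    proof (cases "k = m")
      case True
      with that(3) show ?thesis by simp
    next
      case False
      with * have "m + n < k + l" by (intro add_less_le_mono) auto
      with that(3) show ?thesis by simp
    qed
  qed
  have "p * q = (\<Sum>k\<in>?K p. \<Sum>l\<in>?K q. single (k + l) (?l p k * ?l q l))"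
    by (subst (1 2) mpoly_sum_single[symmetric]) (simp add: sum_product mult_single)
  then have "?l (p * q) (m + n) = (\<Sum>k\<in>?K p. \<Sum>l\<in>?K q. if k = m \<and> l = n then ?l p m * ?l q n else 0)"
    by (auto simp: lookup_sum lookup_single when_def intro!: sum.cong dest: eq)
  also have "\<dots> = (\<Sum>k\<in>?K p. if k = m then \<Sum>l\<in>?K q. if l = n then ?l p m * ?l q n else 0 else 0)"
    by (intro sum.cong) auto
  also have "\<dots> = ?l p m * ?l q n"
    by (simp add: in_keys_iff)
  finally show ?thesis .
qed

lemma keys_mult_least:
  fixes p q :: "'a::{linorder, ordered_cancel_comm_monoid_add} \<Rightarrow>\<^sub>0 'b::comm_ring_1"
  assumes "\<forall>k\<in>keys p. m \<le> k" "\<forall>k\<in>keys q. n \<le> k"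
  shows "\<forall>k\<in>keys (p * q). m + n \<le> k"
  using assms Poly_Mapping.keys_mult[of p q] by (fastforce intro: add_mono)

lemma monom_ge_0: "0 \<le> (m :: nat \<Rightarrow>\<^sub>0 nat)"
proof (cases "m = 0")
  case False
  define k where "k = (LEAST k. lookup m k \<noteq> 0)"
  have "\<exists>k. lookup m k \<noteq> 0"
    using False by (metis lookup_zero poly_mapping_eqI)
  then have "lookup m k \<noteq> 0" "\<And>i. i < k \<Longrightarrow> lookup m i = 0"
    unfolding k_def by (metis (mono_tags, lifting) LeastI_ex, metis (mono_tags, lifting) not_less_Least)
  then have "0 < m" by (auto simp: less_poly_mapping.rep_eq less_fun_def)
  then show ?thesis by simp
qed simp

text \<open>Monomials are ordered lexicographically, so coefficients at least monomials are multiplicative.\<close>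
definition low_place :: "'f::field ratfun \<Rightarrow> 'f \<Rightarrow> bool" where
  "low_place q c \<longleftrightarrow> (\<exists>a b m. q = Fract a b \<and> lookup b m \<noteq> 0 \<and>
     (\<forall>k\<in>keys a. m \<le> k) \<and> (\<forall>k\<in>keys b. m \<le> k) \<and>
     c = lookup a m / lookup b m)"

lemma least_key:
  assumes "a \<noteq> 0"
  obtains m where "lookup a m \<noteq> 0" "\<forall>k\<in>keys a. (m::nat \<Rightarrow>\<^sub>0 nat) \<le> k"
proof
  show "lookup a (Min (keys a)) \<noteq> 0"
    using Min_in[of "keys a"] assms by (simp flip: in_keys_iff)
  show "\<forall>k\<in>keys a. Min (keys a) \<le> k" by simp
qed

lemma place_low_place: "place low_place"
proof
  let ?l = "lookup" and ?K = "keys"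
  show "c = d" if xc: "low_place x c" and xd: "low_place x d" for x :: "'a ratfun" and c d
  proof -
    from xc obtain a b m where 1: "x = Fract a b" "?l b m \<noteq> 0" "\<forall>k\<in>?K a. m \<le> k" "\<forall>k\<in>?K b. m \<le> k" "c = ?l a m / ?l b m"
      by (auto simp: low_place_def)
    from xd obtain a' b' m' where 2: "x = Fract a' b'" "?l b' m' \<noteq> 0" "\<forall>k\<in>?K a'. m' \<le> k" "\<forall>k\<in>?K b'. m' \<le> k" "d = ?l a' m' / ?l b' m'"
      by (auto simp: low_place_def)
    have "b \<noteq> 0" "b' \<noteq> 0" using 1 2 by auto
    with 1(1) 2(1) have "a * b' = a' * b" by (simp add: eq_fract)
    then have "?l (a * b') (m + m') = ?l (a' * b) (m' + m)" by (simp add: add.commute)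
    with 1 2 show ?thesis by (simp add: lookup_mult_least frac_eq_eq)
  qed
  show "low_place 1 (1::'a)"
    unfolding low_place_def One_fract_def by (intro exI[of _ 1] exI[of _ 0]) auto
  show "low_place 0 (0::'a)"
    unfolding low_place_def Zero_fract_def by (intro exI[of _ 1] exI[of _ 0]) auto
  fix x y :: "'a ratfun" and c d
  assume xc: "low_place x c"
  from xc obtain a b m where 1: "x = Fract a b" "?l b m \<noteq> 0" "\<forall>k\<in>?K a. m \<le> k" "\<forall>k\<in>?K b. m \<le> k" "c = ?l a m / ?l b m"
    by (auto simp: low_place_def)
  have b: "b \<noteq> 0" using 1 by auto
  show "low_place (inverse x) (inverse c)" if "c \<noteq> 0"
    unfolding low_place_def
    by (rule exI[of _ b], rule exI[of _ a], rule exI[of _ m]) (use 1 that in auto)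
  assume yd: "low_place y d"
  then obtain a' b' m' where 2: "y = Fract a' b'" "?l b' m' \<noteq> 0" "\<forall>k\<in>?K a'. m' \<le> k" "\<forall>k\<in>?K b'. m' \<le> k" "d = ?l a' m' / ?l b' m'"
    by (auto simp: low_place_def)
  have b': "b' \<noteq> 0" using 2 by auto
  have l: "?l (a * b') (m + m') = ?l a m * ?l b' m'" "?l (b * b') (m + m') = ?l b m * ?l b' m'"
    "?l (a * a') (m + m') = ?l a m * ?l a' m'" "?l (a' * b) (m + m') = ?l a' m' * ?l b m"
    using lookup_mult_least[OF 1(3) 2(4)] lookup_mult_least[OF 1(4) 2(4)]
      lookup_mult_least[OF 1(3) 2(3)] lookup_mult_least[OF 2(3) 1(4)] by (simp_all add: add.commute)
  have k: "\<forall>k\<in>?K (b * b'). m + m' \<le> k" "\<forall>k\<in>?K (a * a'). m + m' \<le> k"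
    "\<forall>k\<in>?K (a * b'). m + m' \<le> k" "\<forall>k\<in>?K (a' * b). m + m' \<le> k"
    using keys_mult_least[of b m b' m'] keys_mult_least[of a m a' m'] keys_mult_least[of a m b' m'] keys_mult_least[of a' m' b m] 1 2
    by (auto simp: add.commute)
  show "low_place (x * y) (c * d)"
    unfolding low_place_def
    by (rule exI[of _ "a * a'"], rule exI[of _ "b * b'"], rule exI[of _ "m + m'"])
      (use 1 2 l k in auto)
  have k': "\<forall>k\<in>?K (a * b' + a' * b). m + m' \<le> k"
    using k Poly_Mapping.keys_add[of "a * b'" "a' * b"] by blast
  show "low_place (x + y) (c + d)"
    unfolding low_place_def
    by (rule exI[of _ "a * b' + a' * b"], rule exI[of _ "b * b'"], rule exI[of _ "m + m'"])
      (use k k' b b' in \<open>simp add: 1(1,2,5) 2(1,2,5) l lookup_add add_frac_eq\<close>)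
next
  let ?l = "lookup" and ?K = "keys"
  fix x :: "'a ratfun"
  assume neg: "\<nexists>a. low_place x a"
  obtain a b where x: "x = Fract a b" "b \<noteq> 0" by (cases x) auto
  from x(2) obtain m where m: "?l b m \<noteq> 0" "\<forall>k\<in>?K b. m \<le> k" by (rule least_key)
  \<comment> \<open>Without a residue the numerator reaches strictly below the denominator;
    exchanging the two puts a zero coefficient at the common bound.\<close>
  have "\<exists>k\<in>?K a. \<not> m \<le> k"
    using neg x m unfolding low_place_def by metis
  then obtain k where k: "k \<in> ?K a" "k < m" by auto
  then have "a \<noteq> 0" by auto
  then obtain m' where m': "?l a m' \<noteq> 0" "\<forall>k\<in>?K a. m' \<le> k" by (rule least_key)
  with k have "m' < m" by auto
  with m(2) have "?l b m' = 0" "\<forall>k\<in>?K b. m' \<le> k" by (force simp: in_keys_iff)+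
  then show "low_place (inverse x) 0"
    unfolding low_place_def
    by (intro exI[of _ b] exI[of _ a] exI[of _ m']) (use x m' in auto)
qed

interpretation low: place low_place by (rule place_low_place)

lemma low_place_constK: "low_place (constK c) c"
  unfolding low_place_def constK_def
  by (rule exI[of _ "single 0 c"], rule exI[of _ 1], rule exI[of _ 0]) auto

lemma low_place_Xvar: "low_place (Xvar v) 0"
proof -
  have "single v (Suc 0) \<noteq> 0"
    by (metis lookup_single_eq lookup_zero nat.distinct(1))
  then show ?thesis
    unfolding low_place_def Xvar_def
    by (intro exI[of _ "single (single v 1) 1"] exI[of _ 1] exI[of _ 0])
      (auto simp: lookup_single when_def monom_ge_0)
qed

lemma constK_algebraically_closed:
  "A \<noteq> 0 \<Longrightarrow> pev constK e A = 0 \<Longrightarrow> e \<in> range constK"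
  by (rule low.algebraic_imp_const[OF rhom_constK low_place_constK])

lemma transc_constK: "e \<notin> range constK \<Longrightarrow> transc constK e"
  using constK_algebraically_closed by (auto simp: transc_def)

text \<open>Expanding around the point c makes the value at c the residue.\<close>
locale translation = \<iota>: field_hom \<iota> for \<iota> :: "'k::field \<Rightarrow> 'f::field" +
  fixes c :: "nat \<Rightarrow> 'f"
begin

definition \<theta> :: "((nat \<Rightarrow>\<^sub>0 nat) \<Rightarrow>\<^sub>0 'k) \<Rightarrow> 'f ratfun" where
  "\<theta> = mpeval (\<lambda>a. constK (\<iota> a)) (\<lambda>v. Xvar v + constK (c v))"

text \<open>The opposite translation \<tau> undoes the shift and leaves the coefficientwise
  application of the injective \<iota>.\<close>

lemma inj_rhom_\<theta>: "inj_rhom \<theta>"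
proof -
  let ?s = "single 0 :: 'f \<Rightarrow> (nat \<Rightarrow>\<^sub>0 nat) \<Rightarrow>\<^sub>0 'f"
  let ?X = "\<lambda>v. single (single v 1) 1 :: (nat \<Rightarrow>\<^sub>0 nat) \<Rightarrow>\<^sub>0 'f"
  interpret s: rhom ?s by (rule rhom_single)
  have s\<iota>: "rhom (\<lambda>a. ?s (\<iota> a))" by (rule rhom_comp[OF \<iota>.rhom_axioms rhom_single])
  then interpret s\<iota>: rhom "\<lambda>a. ?s (\<iota> a)" .
  define \<theta>' where "\<theta>' = mpeval (\<lambda>a. ?s (\<iota> a)) (\<lambda>v. ?X v + ?s (c v))"
  have eq: "\<theta> p = Fract (\<theta>' p) 1" for p
    unfolding \<theta>_def \<theta>'_def
    by (simp add: rhom.hom_mpeval[OF rhom_Fract s\<iota>] constK_def Xvar_def)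
  define \<tau> where "\<tau> = mpeval ?s (\<lambda>v. ?X v - ?s (c v))"
  interpret \<tau>: rhom \<tau> unfolding \<tau>_def by (rule s.rhom_mpeval)
  have \<tau>: "\<tau> (\<theta>' p) = mpeval (\<lambda>a. ?s (\<iota> a)) ?X p" for p
  proof -
    have "\<tau> (?X v + ?s (c v)) = ?X v" for v
      by (simp add: \<tau>_def)
    moreover have "\<tau> (?s a) = ?s a" for a by (simp add: \<tau>_def)
    ultimately show ?thesis unfolding \<theta>'_def by (simp add: \<tau>.hom_mpeval[OF s\<iota>])
  qed
  have lookup: "lookup (mpeval (\<lambda>a. ?s (\<iota> a)) ?X p) m = \<iota> (lookup p m)" for p m
    by (induction p rule: mpoly_induct)
      (simp_all add: lookup_add lookup_single when_def mult_single del: One_nat_def flip: single_monom_conv)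
  show ?thesis
  proof (intro inj_rhom.intro inj_rhom_axioms.intro)
    show "rhom \<theta>" unfolding \<theta>_def
      by (intro rhom.rhom_mpeval rhom_comp[OF \<iota>.rhom_axioms rhom_constK])
    fix p assume "\<theta> p = 0"
    then have "\<theta>' p = 0" by (simp add: eq Zero_fract_def Fract_inj)
    then have "\<iota> (lookup p m) = 0" for m using lookup[of p m] \<tau>[of p] by simp
    then show "p = 0" by (intro poly_mapping_eqI) simp
  qed
qed

sublocale \<theta>: inj_rhom \<theta> by (rule inj_rhom_\<theta>)

definition residue :: "'k ratfun \<Rightarrow> 'f \<Rightarrow> bool" where
  "residue q = low_place (fext \<theta> q)"

lemma place_residue: "place residue"
  unfolding residue_def by (rule place_comp[OF place_low_place \<theta>.fext.field_hom_axioms])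

sublocale residue: place residue by (rule place_residue)

lemma residue_Fract_one: "residue (Fract p 1) (mpeval \<iota> c p)"
proof -
  have "low_place (\<theta> p) (mpeval \<iota> c p)"
    unfolding \<theta>_def using low.add[OF low_place_Xvar low_place_constK]
    by (intro low.mpeval low_place_constK) simp
  then show ?thesis by (simp add: residue_def)
qed

lemma residue_constK: "residue (constK a) (\<iota> a)"
  using residue_Fract_one[of "single 0 a"] by (simp add: constK_def)

lemma residue_Fract:
  assumes "mpeval \<iota> c b \<noteq> 0"
  shows "residue (Fract a b) (mpeval \<iota> c a / mpeval \<iota> c b)"
  unfolding Fract_div[of a b] field_class.field_divide_inverse
  by (intro residue.mult residue.inverse residue_Fract_one assms)

end

section \<open>Simple transcendental extensions\<close>

definition subfield_over :: "('k::field \<Rightarrow> 'l::field) \<Rightarrow> 'l set \<Rightarrow> bool" where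
  "subfield_over \<kappa> E \<longleftrightarrow> range \<kappa> \<subseteq> E \<and> (\<forall>x\<in>E. \<forall>y\<in>E. x + y \<in> E \<and> x * y \<in> E \<and> - x \<in> E) \<and>
     (\<forall>x\<in>E. x \<noteq> 0 \<longrightarrow> inverse x \<in> E)"

lemma is_K_subfield_conv: "is_K_subfield = subfield_over constK"
  by (simp add: is_K_subfield_def subfield_over_def fun_eq_iff)

locale subfld = \<kappa>: field_hom \<kappa> for \<kappa> :: "'k::field \<Rightarrow> 'l::field" +
  fixes E assumes subfield: "subfield_over \<kappa> E"
begin

lemma const_in [simp, intro]: "\<kappa> c \<in> E"
  using subfield by (auto simp: subfield_over_def)

lemma zero_in [simp, intro]: "0 \<in> E"
  using const_in[of 0] by simp

lemma one_in [simp, intro]: "1 \<in> E"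
  using const_in[of 1] by (simp del: const_in)

lemma add_in [intro]: "x \<in> E \<Longrightarrow> y \<in> E \<Longrightarrow> x + y \<in> E"
  and mult_in [intro]: "x \<in> E \<Longrightarrow> y \<in> E \<Longrightarrow> x * y \<in> E"
  and uminus_in [intro]: "x \<in> E \<Longrightarrow> - x \<in> E"
  using subfield by (auto simp: subfield_over_def)

lemma diff_in [intro]: "x \<in> E \<Longrightarrow> y \<in> E \<Longrightarrow> x - y \<in> E"
  using add_in[of x "- y"] by auto

lemma inverse_in [intro]: "x \<in> E \<Longrightarrow> inverse x \<in> E"
  using subfield by (cases "x = 0") (auto simp: subfield_over_def)

lemma divide_in [intro]: "x \<in> E \<Longrightarrow> y \<in> E \<Longrightarrow> x / y \<in> E"
  by (auto simp: field_class.field_divide_inverse)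

lemma pev_in [intro]: "t \<in> E \<Longrightarrow> pev \<kappa> t A \<in> E"
  by (induction A) (auto simp: \<kappa>.rhom_axioms)

end

text \<open>The simple extension K(t). As \<open>t\<close> may be algebraic, the condition is on the
  value of the denominator and not on the polynomial.\<close>

definition gen :: "('k::field \<Rightarrow> 'l::field) \<Rightarrow> 'l \<Rightarrow> 'l set" where
  "gen \<kappa> t = {pev \<kappa> t A / pev \<kappa> t B | A B. pev \<kappa> t B \<noteq> 0}"

lemma genI: "x = pev \<kappa> t A / pev \<kappa> t B \<Longrightarrow> pev \<kappa> t B \<noteq> 0 \<Longrightarrow> x \<in> gen \<kappa> t"
  by (auto simp: gen_def)

lemma (in subfld) gen_subset: "t \<in> E \<Longrightarrow> gen \<kappa> t \<subseteq> E"
  by (auto simp: gen_def)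

lemma subfield_over_gen:
  assumes "field_hom \<kappa>"
  shows "subfield_over \<kappa> (gen \<kappa> t)"
proof -
  interpret \<kappa>: field_hom \<kappa> by fact
  interpret ev: rhom "pev \<kappa> t" by (rule rhom_pev[OF \<kappa>.rhom_axioms])
  have c: "\<kappa> c \<in> gen \<kappa> t" for c
    unfolding gen_def by (intro CollectI exI[of _ "[:c:]"] exI[of _ 1]) (simp add: \<kappa>.rhom_axioms)
  have "x + y \<in> gen \<kappa> t \<and> x * y \<in> gen \<kappa> t \<and> - x \<in> gen \<kappa> t \<and> inverse x \<in> gen \<kappa> t"
    if x: "x \<in> gen \<kappa> t" and y: "y \<in> gen \<kappa> t" for x y
  proof -
    from x obtain A B where 1: "x = pev \<kappa> t A / pev \<kappa> t B" "pev \<kappa> t B \<noteq> 0" by (auto simp: gen_def)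
    from y obtain C D where 2: "y = pev \<kappa> t C / pev \<kappa> t D" "pev \<kappa> t D \<noteq> 0" by (auto simp: gen_def)
    have "x + y = pev \<kappa> t (A * D + C * B) / pev \<kappa> t (B * D)" using 1 2 by (simp add: add_frac_eq)
    moreover have "x * y = pev \<kappa> t (A * C) / pev \<kappa> t (B * D)" using 1 2 by simp
    moreover have "- x = pev \<kappa> t (- A) / pev \<kappa> t B" using 1 by simp
    moreover have "inverse x \<in> gen \<kappa> t"
    proof (cases "pev \<kappa> t A = 0")
      case True
      then show ?thesis using 1 c[of 0] by simp
    next
      case False
      then show ?thesis using 1 unfolding gen_def by (intro CollectI exI[of _ B] exI[of _ A]) simp
    qed
    moreover have "pev \<kappa> t (B * D) \<noteq> 0" using 1 2 by simp
    ultimately show ?thesis using 1(2) by (blast intro: genI)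
  qed
  then show ?thesis using c by (auto simp: subfield_over_def)
qed

lemma gen_self: "rhom \<kappa> \<Longrightarrow> t \<in> gen \<kappa> t"
  unfolding gen_def by (intro CollectI exI[of _ "[:0, 1:]"] exI[of _ "[:1:]"]) (simp add: rhom.hom_one rhom.hom_zero)

section \<open>Lowest terms, Bezout's identity and the rational root theorem\<close>

lemma nonunit_poly_degree:
  "c \<noteq> 0 \<Longrightarrow> \<not> is_unit c \<Longrightarrow> degree (c :: 'k::field poly) > 0"
  by (auto simp: is_unit_iff_degree)

text \<open>Any nonunit common factor can be cancelled, which lowers the degree of the
  denominator.\<close>

lemma coprime_reduction:
  fixes A B :: "'k::field poly"
  assumes "B \<noteq> 0"
  shows "\<exists>p q g. coprime p q \<and> A = g * p \<and> B = g * q \<and> g \<noteq> 0"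
  using assms
proof (induction "degree B" arbitrary: A B rule: less_induct)
  case less
  show ?case
  proof (cases "coprime A B")
    case True
    then show ?thesis by (intro exI[of _ A] exI[of _ B] exI[of _ 1]) auto
  next
    case False
    then obtain c where c: "c dvd A" "c dvd B" "\<not> is_unit c" by (auto simp: coprime_def)
    then obtain A' B' where AB: "A = c * A'" "B = c * B'" by (auto elim!: dvdE)
    have nz: "c \<noteq> 0" "B' \<noteq> 0" using AB less.prems by auto
    with c AB have "degree B' < degree B" by (simp add: degree_mult_eq nonunit_poly_degree)
    from less.hyps[OF this nz(2), of A'] obtain p q g where "coprime p q" "A' = g * p" "B' = g * q" "g \<noteq> 0" by blast
    then show ?thesis using AB nz by (intro exI[of _ p] exI[of _ q] exI[of _ "c * g"]) auto
  qed
qed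

text \<open>A nonzero combination of least degree divides every combination, since a nonzero
  remainder would be a smaller one. Dividing both \<open>p\<close> and \<open>q\<close>, it is a
  unit.\<close>

lemma coprime_bezout:
  fixes p q :: "'k::field poly"
  assumes "coprime p q"
  shows "\<exists>a b. a * p + b * q = 1"
proof -
  let ?I = "{r. r \<noteq> 0 \<and> (\<exists>a b. r = a * p + b * q)}"
  have "p \<noteq> 0 \<or> q \<noteq> 0" using assms by auto
  moreover have "p = 1 * p + 0 * q" "q = 0 * p + 1 * q" by simp_all
  ultimately have "\<exists>r. r \<in> ?I" by blast
  then obtain r where r: "r \<in> ?I" "\<And>s. s \<in> ?I \<Longrightarrow> degree r \<le> degree s"
    using ex_has_least_nat[of "\<lambda>r. r \<in> ?I" _ degree] by blast
  then obtain a b where ab: "r = a * p + b * q" and "r \<noteq> 0" by auto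
  have "r dvd s" if "s = c * p + d * q" for s c d
  proof (rule ccontr)
    assume "\<not> r dvd s"
    then have "s mod r \<noteq> 0" by (simp add: dvd_eq_mod_eq_0)
    moreover have "s mod r = (c - (s div r) * a) * p + (d - (s div r) * b) * q"
      unfolding minus_div_mult_eq_mod[symmetric] by (simp add: ab that algebra_simps)
    ultimately have "degree r \<le> degree (s mod r)" by (intro r(2)) blast
    with \<open>s mod r \<noteq> 0\<close> \<open>r \<noteq> 0\<close> show False using degree_mod_less'[of r s] by simp
  qed
  from this[of p 1 0] this[of q 0 1] have "r dvd p" "r dvd q" by auto
  with assms have "is_unit r" by (simp add: coprime_def)
  then obtain u where "1 = r * u" by (auto elim: dvdE)
  then show ?thesis by (intro exI[of _ "u * a"] exI[of _ "u * b"]) (simp add: ab algebra_simps)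
qed

lemma coprime_dvd_mult_power:
  fixes p q :: "'k::field poly"
  assumes "coprime p q" "q dvd b * p ^ k"
  shows "q dvd b"
proof -
  obtain u v where uv: "u * p + v * q = 1" using coprime_bezout[OF assms(1)] by blast
  have step: "q dvd c" if "q dvd c * p" for c
  proof -
    have "c = c * (u * p + v * q)" by (simp add: uv)
    also have "\<dots> = u * (c * p) + (c * v) * q" by (simp add: algebra_simps)
    also have "q dvd \<dots>" by (rule dvd_add[OF dvd_mult[OF that] dvd_triv_right])
    finally show ?thesis .
  qed
  show ?thesis using assms(2)
  proof (induction k)
    case (Suc k)
    have "b * p ^ Suc k = (b * p ^ k) * p" by (simp add: mult_ac)
    with step[of "b * p ^ k"] Suc show ?case by metis
  qed simp
qed

text \<open>The rational root theorem over K[t]: after multiplication by a power of the denominator,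
  every term but the leading one contains \<open>q\<close>. Transcendence of \<open>t\<close> lifts
  the identity from values to polynomials.\<close>

lemma dvd_lead_coeff_of_root:
  fixes P :: "'k::field poly poly"
  assumes "rhom \<kappa>" "transc \<kappa> (t :: 'l::field)" "coprime p q" "q \<noteq> 0"
    and "poly (map_poly (pev \<kappa> t) P) (pev \<kappa> t p / pev \<kappa> t q) = 0"
  shows "q dvd lead_coeff P"
proof -
  interpret ev: rhom "pev \<kappa> t" by (rule rhom_pev) fact
  define k where "k = degree P"
  have q0: "pev \<kappa> t q \<noteq> 0" using assms by (auto simp: transc_def)
  let ?Q = "map_poly (pev \<kappa> t) P"
  have "0 = pev \<kappa> t q ^ k * (\<Sum>j\<le>degree ?Q. coeff ?Q j * (pev \<kappa> t p / pev \<kappa> t q) ^ j)"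
    using assms(5) by (simp add: poly_altdef)
  also have "(\<Sum>j\<le>degree ?Q. coeff ?Q j * (pev \<kappa> t p / pev \<kappa> t q) ^ j) =
      (\<Sum>j\<le>k. coeff ?Q j * (pev \<kappa> t p / pev \<kappa> t q) ^ j)"
    by (intro sum.mono_neutral_left) (auto simp: k_def map_poly_degree_leq coeff_eq_0)
  also have "\<dots> = (\<Sum>j\<le>k. pev \<kappa> t (coeff P j) * (pev \<kappa> t p / pev \<kappa> t q) ^ j)"
    by (simp add: coeff_map_poly)
  also have "pev \<kappa> t q ^ k * \<dots> = (\<Sum>j\<le>k. pev \<kappa> t (coeff P j * p ^ j * q ^ (k - j)))"
    unfolding sum_distrib_left
  proof (intro sum.cong refl)
    fix j assume "j \<in> {..k}"
    then have "pev \<kappa> t q ^ k = pev \<kappa> t q ^ (k - j) * pev \<kappa> t q ^ j"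
      using power_add[of "pev \<kappa> t q" "k - j" j] by simp
    then show "pev \<kappa> t q ^ k * (pev \<kappa> t (coeff P j) * (pev \<kappa> t p / pev \<kappa> t q) ^ j) =
        pev \<kappa> t (coeff P j * p ^ j * q ^ (k - j))"
      using q0 by (simp only: ev.hom_mult ev.hom_power power_divide) (simp add: field_simps)
  qed
  also have "\<dots> = pev \<kappa> t (\<Sum>j\<le>k. coeff P j * p ^ j * q ^ (k - j))"
    by (simp add: ev.hom_sum)
  finally have "(\<Sum>j\<le>k. coeff P j * p ^ j * q ^ (k - j)) = 0"
    using assms(2) by (simp add: transc_def)
  then have "coeff P k * p ^ k = - (\<Sum>j<k. coeff P j * p ^ j * q ^ (k - j))"
    by (simp add: lessThan_Suc_atMost[symmetric] eq_neg_iff_add_eq_0 add.commute)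
  also have "q dvd \<dots>"
    by (subst dvd_minus_iff, rule dvd_sum) (auto intro!: dvd_mult dvd_power)
  finally show ?thesis unfolding k_def by (rule coprime_dvd_mult_power[OF assms(3)])
qed

text \<open>The denominator divides the leading coefficient; by passing to the reflected polynomial,
  the numerator divides the lowest nonzero one.\<close>

lemma degree_le_of_root:
  fixes P :: "'k::field poly poly"
  assumes "rhom \<kappa>" "transc \<kappa> (t :: 'l::field)" "coprime p q" "q \<noteq> 0" "P \<noteq> 0"
    and "poly (map_poly (pev \<kappa> t) P) (pev \<kappa> t p / pev \<kappa> t q) = 0"
    and "\<And>i. degree (coeff P i) \<le> n"
  shows "degree p \<le> n \<and> degree q \<le> n"
proof
  have "q dvd lead_coeff P" by (rule dvd_lead_coeff_of_root[OF assms(1-4,6)])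
  then show "degree q \<le> n"
    using assms(5) by (meson assms(7) dvd_imp_degree_le leading_coeff_0_iff order_trans)
  show "degree p \<le> n"
  proof (cases "p = 0")
    case False
    let ?Q = "map_poly (pev \<kappa> t) P"
    have inj: "pev \<kappa> t A = 0 \<longleftrightarrow> A = 0" for A using assms(2) by (auto simp: transc_def)
    have refl: "map_poly (pev \<kappa> t) (reflect_poly P) = reflect_poly ?Q"
    proof (rule poly_eqI)
      have deg: "degree ?Q = degree P" by (rule map_poly_degree_eq) (use assms(5) in \<open>simp add: inj\<close>)
      show "coeff (map_poly (pev \<kappa> t) (reflect_poly P)) i = coeff (reflect_poly ?Q) i" for i
        by (simp add: coeff_map_poly coeff_reflect_poly deg)
    qed
    have "poly (reflect_poly ?Q) (inverse (pev \<kappa> t p / pev \<kappa> t q)) = 0"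
      using assms(4,6) False by (subst poly_reflect_poly_nz) (auto simp: inj)
    then have "poly (map_poly (pev \<kappa> t) (reflect_poly P)) (pev \<kappa> t q / pev \<kappa> t p) = 0"
      by (simp add: refl)
    from dvd_lead_coeff_of_root[OF assms(1,2) _ False this] assms(3)
    have "p dvd lead_coeff (reflect_poly P)" by (simp add: coprime_commute)
    moreover have "lead_coeff (reflect_poly P) \<noteq> 0" using assms(5) by simp
    moreover have "degree (lead_coeff (reflect_poly P)) \<le> n"
      by (subst coeff_reflect_poly) (simp add: assms(7))
    ultimately show ?thesis by (meson dvd_imp_degree_le order_trans)
  qed simp
qed

text \<open>If t = C(h)/D(h), then \<open>h\<close> is a root of t D(Y) - C(Y), whose coefficients
  have degree at most 1 in \<open>t\<close>. The root bound then makes numerator and denominator of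
  \<open>h\<close> at most linear.\<close>

lemma moebius_of_generator:
  assumes "field_hom \<kappa>" "transc \<kappa> (t :: 'l::field)" "h \<in> gen \<kappa> t" "t \<in> gen \<kappa> h"
  obtains a b c d where "\<kappa> c * t + \<kappa> d \<noteq> 0" "h * (\<kappa> c * t + \<kappa> d) = \<kappa> a * t + \<kappa> b"
proof -
  interpret \<kappa>: field_hom \<kappa> by fact
  interpret ev: rhom "pev \<kappa> t" by (rule rhom_pev) (rule \<kappa>.rhom_axioms)
  from assms(3) obtain A B where h: "h = pev \<kappa> t A / pev \<kappa> t B" and B: "pev \<kappa> t B \<noteq> 0"
    by (auto simp: gen_def)
  from B have "B \<noteq> 0" by auto
  from coprime_reduction[OF this, of A] obtain p q g where
    pq: "coprime p q" "A = g * p" "B = g * q" "g \<noteq> 0" by blast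
  have q: "q \<noteq> 0" "pev \<kappa> t q \<noteq> 0" using pq B by auto
  have hpq: "h = pev \<kappa> t p / pev \<kappa> t q" using h B pq by simp
  from assms(4) obtain C D where t: "t = pev \<kappa> h C / pev \<kappa> h D" and D: "pev \<kappa> h D \<noteq> 0"
    by (auto simp: gen_def)
  define P where "P = map_poly (\<lambda>a. [:0, a:]) D - map_poly (\<lambda>a. [:a:]) C"
  have coeffP: "coeff P i = [:- coeff C i, coeff D i:]" for i
    by (simp add: P_def coeff_map_poly)
  have "P \<noteq> 0"
  proof
    assume "P = 0"
    then have "D = 0" using coeffP by (auto intro!: poly_eqI)
    then show False using D by simp
  qed
  have "map_poly (pev \<kappa> t) P = smult t (map_poly \<kappa> D) - map_poly \<kappa> C"
    by (intro poly_eqI) (simp add: coeff_map_poly coeffP \<kappa>.rhom_axioms algebra_simps)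
  then have "poly (map_poly (pev \<kappa> t) P) h = t * pev \<kappa> h D - pev \<kappa> h C"
    by (simp add: pev_def)
  also have "\<dots> = 0" using D by (subst t) simp
  finally have "degree p \<le> 1 \<and> degree q \<le> 1"
    by (intro degree_le_of_root[OF \<kappa>.rhom_axioms assms(2) pq(1) q(1) \<open>P \<noteq> 0\<close>])
      (auto simp: hpq coeffP)
  moreover have lin: "pev \<kappa> t r = \<kappa> (coeff r 1) * t + \<kappa> (coeff r 0)" if "degree r \<le> 1" for r
  proof -
    have "r = [:coeff r 0, coeff r 1:]"
      using that by (intro poly_eqI) (auto simp: coeff_pCons coeff_eq_0 split: nat.splits)
    then have "pev \<kappa> t r = pev \<kappa> t [:coeff r 0, coeff r 1:]" by (rule arg_cong)
    also have "\<dots> = \<kappa> (coeff r 1) * t + \<kappa> (coeff r 0)" by (simp add: \<kappa>.rhom_axioms)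
    finally show ?thesis .
  qed
  ultimately have "pev \<kappa> t p = \<kappa> (coeff p 1) * t + \<kappa> (coeff p 0)"
    "pev \<kappa> t q = \<kappa> (coeff q 1) * t + \<kappa> (coeff q 0)" by blast+
  with q(2) hpq show thesis by (intro that[of "coeff q 1" "coeff q 0" "coeff p 1" "coeff p 0"]) simp_all
qed

section \<open>Factorisation and Gauss's lemma in K[x][y]\<close>

lemma prime_divisor_poly:
  fixes C :: "'k::field poly"
  assumes "C \<noteq> 0" "degree C > 0"
  obtains \<pi> where "prime_elem \<pi>" "\<pi> dvd C"
proof -
  have "C dvd C \<and> degree C > 0" using assms by simp
  then obtain D where D: "D dvd C" "degree D > 0"
    and least: "\<And>D'. D' dvd C \<Longrightarrow> degree D' > 0 \<Longrightarrow> degree D \<le> degree D'"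
    using ex_has_least_nat[of "\<lambda>D. D dvd C \<and> degree D > 0" C degree] by blast
  have "irreducible D"
  proof (rule irreducibleI)
    show "D \<noteq> 0" using D(2) by auto
    then show "\<not> is_unit D" using D(2) by (simp add: is_unit_iff_degree)
    fix a b assume ab: "D = a * b"
    have "a \<noteq> 0" "b \<noteq> 0" using ab D(2) by force+
    show "is_unit a \<or> is_unit b"
    proof (rule ccontr)
      assume "\<not> (is_unit a \<or> is_unit b)"
      with \<open>a \<noteq> 0\<close> \<open>b \<noteq> 0\<close> have "degree a > 0" "degree b > 0" by (auto simp: nonunit_poly_degree)
      moreover have "a dvd C" using D(1) unfolding ab by (rule dvd_mult_left)
      ultimately have "degree D \<le> degree a" using least by blast
      with ab \<open>a \<noteq> 0\<close> \<open>b \<noteq> 0\<close> \<open>degree b > 0\<close> show False by (simp add: degree_mult_eq)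
    qed
  qed
  then have "prime_elem D" by (rule field_poly_irreducible_imp_prime)
  then show thesis using D(1) by (rule that)
qed

lemma common_denominator:
  fixes A :: "'a::idom fract poly"
  shows "\<exists>c M. c \<noteq> 0 \<and> fract_poly M = smult (to_fract c) A"
proof (induction A)
  case 0
  show ?case by (intro exI[of _ 1] exI[of _ 0]) simp
next
  case (pCons a A)
  then obtain c M where cM: "c \<noteq> 0" "fract_poly M = smult (to_fract c) A" by blast
  obtain x y where a: "a = Fract x y" "y \<noteq> 0" by (cases a)
  have "fract_poly (pCons (c * x) (smult y M)) = smult (to_fract (c * y)) (pCons a A)"
    using a cM by (simp add: map_poly_pCons Fract_conv_to_fract mult.commute)
  with a cM show ?case by (intro exI[of _ "c * y"] exI[of _ "pCons (c * x) (smult y M)"]) auto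
qed

text \<open>Gauss's lemma\<close>
lemma primitive_factor:
  fixes M N \<Psi> :: "'k::field poly poly"
  assumes prim: "\<And>\<pi>. prime_elem \<pi> \<Longrightarrow> \<not> [:\<pi>:] dvd M"
    and "C \<noteq> 0" "smult C \<Psi> = M * N"
  shows "\<exists>N'. \<Psi> = M * N'"
  using assms(2,3)
proof (induction "degree C" arbitrary: C N rule: less_induct)
  case less
  show ?case
  proof (cases "degree C = 0")
    case True
    then obtain c where c: "C = [:c:]" by (rule degree_eq_zeroE)
    with less.prems have "c \<noteq> 0" by auto
    then have "[:inverse c:] * C = 1" by (simp add: c one_pCons)
    then have "\<Psi> = smult [:inverse c:] (smult C \<Psi>)" by (simp only: smult_smult smult_1_left)
    also have "\<dots> = M * smult [:inverse c:] N" by (simp only: less.prems(2) mult_smult_right)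
    finally show ?thesis by (rule exI)
  next
    case False
    with less.prems(1) obtain \<pi> where \<pi>: "prime_elem \<pi>" "\<pi> dvd C" using prime_divisor_poly by blast
    then obtain C' where C: "C = \<pi> * C'" by (auto elim: dvdE)
    \<comment> \<open>A prime of K[x] stays prime in K[x][y], so a prime factor of \<open>C\<close>
      that does not divide \<open>M\<close> divides \<open>N\<close> and can be cancelled.\<close>
    have "[:\<pi>:] dvd M * N" unfolding less.prems(2)[symmetric]
      by (simp add: C const_poly_dvd_iff)
    then have "[:\<pi>:] dvd N"
      using prime_elem_dvd_multD[OF lift_prime_elem_poly[OF \<pi>(1)]] prim[OF \<pi>(1)] by blast
    then obtain N1 where N: "N = smult \<pi> N1" by (auto elim!: dvdE)
    have nz: "\<pi> \<noteq> 0" "C' \<noteq> 0" using C less.prems(1) by auto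
    have "smult \<pi> (smult C' \<Psi>) = smult \<pi> (M * N1)" using less.prems(2) by (simp add: C N)
    then have "smult \<pi> (smult C' \<Psi> - M * N1) = 0" by (simp only: smult_diff_right diff_self)
    then have "smult C' \<Psi> = M * N1" using nz by simp
    moreover have "degree C' < degree C"
      using nz \<pi>(1) by (simp add: C degree_mult_eq nonunit_poly_degree prime_elem_not_unit)
    ultimately show ?thesis using less.hyps[of C' N1] nz(2) by simp
  qed
qed

text \<open>The degree in the inner variable is additive: at the last indices where \<open>M\<close>
  and \<open>N\<close> attain their maximal inner degrees, the product of the two leading
  coefficients is the only contribution. As \<open>M\<close> already uses up the bound
  \<open>d\<close>, nothing is left for \<open>N\<close>.\<close>

lemma coeff_degrees_zero_of_mult:
  fixes M N :: "'k::field poly poly"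
  assumes "\<And>i. degree (coeff (M * N) i) \<le> d" "d \<le> degree (coeff M i0)" "d > 0"
  shows "degree (coeff N j) = 0"
proof (rule ccontr)
  have ex: "\<exists>i. degree (coeff Q i) > 0 \<and> (\<forall>k. degree (coeff Q k) \<le> degree (coeff Q i)) \<and>
      (\<forall>k>i. degree (coeff Q k) < degree (coeff Q i))" 
    if Q: "degree (coeff Q j) > 0" for Q :: "'k poly poly" and j
  proof -
    define S where "S = (\<lambda>i. degree (coeff Q i)) ` {..degree Q}"
    have le: "degree (coeff Q k) \<le> Max S" for k
    proof (cases "k \<le> degree Q")
      case True
      then show ?thesis unfolding S_def by (intro Max_ge) auto
    qed (simp add: coeff_eq_0)
    have "Max S \<in> S" unfolding S_def by (intro Max_in) auto
    define I where "I = {i. i \<le> degree Q \<and> degree (coeff Q i) = Max S}"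
    from \<open>Max S \<in> S\<close> obtain i where "Max S = degree (coeff Q i)" "i \<in> {..degree Q}"
      unfolding S_def by (rule imageE)
    then have "i \<in> I" by (simp add: I_def)
    then have "I \<noteq> {}" "finite I" by (auto simp: I_def)
    then have mem: "Max I \<in> I" and max: "\<And>k. k \<in> I \<Longrightarrow> k \<le> Max I" by auto
    have pos: "Max S > 0" using Q le[of j] by linarith
    have "degree (coeff Q k) < Max S" if "k > Max I" for k
    proof (cases "k \<le> degree Q")
      case True
      have "k \<notin> I" using max[of k] that by auto
      with True have "degree (coeff Q k) \<noteq> Max S" by (simp add: I_def)
      with le[of k] show ?thesis by simp
    qed (use pos in \<open>simp add: coeff_eq_0\<close>)
    moreover have "degree (coeff Q (Max I)) = Max S" using mem by (simp add: I_def)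
    ultimately show ?thesis using le pos by (intro exI[of _ "Max I"]) simp
  qed
  assume "degree (coeff N j) \<noteq> 0"
  then have "degree (coeff N j) > 0" by simp
  from ex[OF this] obtain j where j: "degree (coeff N j) > 0" "\<And>k. degree (coeff N k) \<le> degree (coeff N j)"
    "\<And>k. k > j \<Longrightarrow> degree (coeff N k) < degree (coeff N j)" by blast
  from assms(2,3) have "degree (coeff M i0) > 0" by simp
  from ex[OF this] obtain i where i: "degree (coeff M i) > 0" "\<And>k. degree (coeff M k) \<le> degree (coeff M i)"
    "\<And>k. k > i \<Longrightarrow> degree (coeff M k) < degree (coeff M i)" by blast
  define a b where "a = degree (coeff M i)" and "b = degree (coeff N j)"
  have "coeff (coeff (M * N) (i + j)) (a + b) = (\<Sum>k\<le>i + j. coeff (coeff M k * coeff N (i + j - k)) (a + b))"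
    by (simp add: coeff_mult[of M] coeff_sum)
  also have "\<dots> = (\<Sum>k\<le>i + j. if k = i then lead_coeff (coeff M i) * lead_coeff (coeff N j) else 0)"
  proof (intro sum.cong refl)
    fix k assume "k \<in> {..i + j}"
    show "coeff (coeff M k * coeff N (i + j - k)) (a + b) = (if k = i then lead_coeff (coeff M i) * lead_coeff (coeff N j) else 0)"
    proof (cases "k = i")
      case True
      then show ?thesis by (simp add: a_def b_def coeff_mult_degree_sum)
    next
      case False
      have "degree (coeff M k) + degree (coeff N (i + j - k)) < a + b"
      proof (cases "k > i")
        case True
        then show ?thesis using i(3)[of k] j(2)[of "i + j - k"] by (simp add: a_def b_def)
      next
        case False
        with \<open>k \<noteq> i\<close> have "j < i + j - k" by simp
        from j(3)[OF this] show ?thesis using i(2)[of k] by (simp add: a_def b_def)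
      qed
      then have "coeff (coeff M k * coeff N (i + j - k)) (a + b) = 0"
        by (intro coeff_eq_0) (meson degree_mult_le le_less_trans)
      with False show ?thesis by simp
    qed
  qed
  also have "\<dots> = lead_coeff (coeff M i) * lead_coeff (coeff N j)" by simp
  also have "\<dots> \<noteq> 0" using i(1) j(1) by auto
  finally have "a + b \<le> degree (coeff (M * N) (i + j))" by (rule le_degree)
  with assms(1)[of "i + j"] assms(2) i(2)[of i0] j(1) show False by (simp add: a_def b_def)
qed

definition coeffs_in :: "'a::zero set \<Rightarrow> 'a poly \<Rightarrow> bool" where
  "coeffs_in E A \<longleftrightarrow> (\<forall>i. coeff A i \<in> E)"

text \<open>\<open>E\<close> is a set and not a type, so long division is done one coefficient at a
  time to keep the remainder over \<open>E\<close>: prepending a coefficient raises its degree by at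
  most 1, and one multiple of the monic \<open>A\<close> removes the new top term.\<close>

lemma (in subfld) coeffs_in_divide:
  assumes "coeffs_in E A" "lead_coeff A = 1" "degree A > 0" "coeffs_in E P"
  shows "\<exists>B r. P = A * B + r \<and> degree r < degree A \<and> coeffs_in E r"
  using assms(4)
proof (induction P)
  case 0
  show ?case by (intro exI[of _ 0]) (use assms(3) in \<open>auto simp: coeffs_in_def\<close>)
next
  case (pCons a P)
  have "coeff (pCons a P) i \<in> E" for i
    using pCons.prems by (simp add: coeffs_in_def)
  from this[of 0] this[of "Suc _"] have "coeffs_in E P" "a \<in> E"
    by (simp_all add: coeffs_in_def)
  with pCons.IH obtain B r where IH: "P = A * B + r" "degree r < degree A" "coeffs_in E r" by blast
  define n where "n = degree A"
  define s where "s = pCons a r - smult (coeff r (n - 1)) A"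
  have n: "n > 0" using assms(3) by (simp add: n_def)
  have "degree s < n"
  proof -
    have "coeff s i = 0" if "i \<ge> n" for i
    proof (cases "i = n")
      case True
      then show ?thesis using n assms(2) by (cases n) (auto simp: s_def n_def[symmetric])
    next
      case False
      with that n have "i > degree A" "i - 1 > degree r" "i > 0" using IH(2) by (auto simp: n_def)
      then show ?thesis by (cases i) (auto simp: s_def coeff_eq_0)
    qed
    then show ?thesis using n by (metis leading_coeff_0_iff degree_0 not_le)
  qed
  moreover have "coeffs_in E s"
    using IH(3) assms(1) \<open>a \<in> E\<close> by (auto simp: s_def coeffs_in_def coeff_pCons split: nat.splits)
  moreover have "pCons a P = A * (pCons (coeff r (n - 1)) B) + s"
    by (simp add: s_def IH(1) mult_pCons_right)
  ultimately show ?case unfolding n_def by blast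
qed

section \<open>The rational function field K(X)\<close>

definition constX :: "'k::field \<Rightarrow> 'k poly fract" where
  "constX a = to_fract [:a:]"

lemma field_hom_constX: "field_hom constX"
  by unfold_locales (simp_all add: constX_def one_pCons[symmetric] flip: to_fract_add to_fract_mult)

interpretation constX: field_hom constX by (rule field_hom_constX)

lemma pev_constX: "pev constX (to_fract [:0, 1:]) A = to_fract A"
proof (induction A)
  case (pCons a A)
  have "pev constX (to_fract [:0, 1:]) (pCons a A) = to_fract ([:a:] + [:0, 1:] * A)"
    unfolding pev_pCons[OF constX.rhom_axioms] pCons.IH by (simp only: constX_def to_fract_add to_fract_mult)
  then show ?case by simp
qed simp

lemma transc_constX: "transc constX (to_fract [:0, 1:])"
  by (simp add: transc_def pev_constX)

text \<open>An element algebraic over K is a root of a polynomial whose coefficients have degree 0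
  in X, so the root bound makes its numerator and denominator constant.\<close>

lemma constX_algebraically_closed:
  assumes "h \<notin> range (constX :: 'k::field \<Rightarrow> _)"
  shows "transc constX h"
  unfolding transc_def
proof (intro allI impI)
  fix A :: "'k poly" assume A: "pev constX h A = 0"
  show "A = 0"
  proof (rule ccontr)
    assume "A \<noteq> 0"
    let ?T = "to_fract [:0, 1:] :: 'k poly fract"
    let ?P = "map_poly (\<lambda>a. [:a:]) A"
    obtain u w where h: "h = Fract u w" "w \<noteq> 0" by (cases h)
    obtain p q g where pq: "coprime p q" "u = g * p" "w = g * q" "g \<noteq> 0"
      using coprime_reduction[OF h(2)] by blast
    have q: "q \<noteq> 0" using pq h by auto
    have hpq: "h = pev constX ?T p / pev constX ?T q"
      using pq h q by (simp add: pev_constX Fract_conv_to_fract)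
    have "map_poly (pev constX ?T) ?P = map_poly constX A"
      by (intro poly_eqI) (simp add: coeff_map_poly pev_constX constX_def)
    then have "poly (map_poly (pev constX ?T) ?P) (pev constX ?T p / pev constX ?T q) = 0"
      using A unfolding hpq[symmetric] by (simp only: pev_def[of constX h])
    moreover have "?P \<noteq> 0" using \<open>A \<noteq> 0\<close>
      by (metis coeff_map_poly coeff_0 leading_coeff_0_iff pCons_eq_0_iff)
    ultimately have "degree p \<le> 0 \<and> degree q \<le> 0"
      by (intro degree_le_of_root[OF constX.rhom_axioms transc_constX pq(1) q]) (auto simp: coeff_map_poly)
    then obtain a b where "p = [:a:]" "q = [:b:]" by (metis degree_eq_zeroE le_zero_eq)
    then have "h = constX (a / b)"
      unfolding hpq by (simp add: pev_constX) (simp add: constX_def)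
    with assms show False by blast
  qed
qed

section \<open>Lueroth's theorem\<close>

abbreviation (input) ratX :: "'k::field poly fract" where
  "ratX \<equiv> to_fract [:0, 1:]"

locale luroth = subfld constX E for E :: "'k::field poly fract set" +
  assumes nontrivial: "\<not> E \<subseteq> range constX"
begin

lemma poly_constX: "poly (map_poly constX p) ratX = to_fract p"
  using pev_constX[of p] by (simp add: pev_def)

text \<open>The minimal polynomial of X over \<open>E\<close>. It exists because any nonconstant f =
  p/q in \<open>E\<close> makes X a root of p(Y) - f q(Y).\<close>

lemma minimal_polynomial:
  obtains A where "coeffs_in E A" "lead_coeff A = 1" "poly A ratX = 0" "degree A > 0"
    "\<And>B. coeffs_in E B \<Longrightarrow> poly B ratX = 0 \<Longrightarrow> B \<noteq> 0 \<Longrightarrow> degree A \<le> degree B"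
proof -
  let ?P = "\<lambda>A. coeffs_in E A \<and> poly A ratX = 0 \<and> A \<noteq> 0"
  from nontrivial obtain f where f: "f \<in> E" "f \<notin> range constX" by blast
  obtain p q where pq: "f = Fract p q" "q \<noteq> 0" by (cases f)
  define A0 where "A0 = map_poly constX p - smult f (map_poly constX q)"
  have "coeffs_in E A0" using f by (auto simp: A0_def coeffs_in_def coeff_map_poly)
  moreover have "poly A0 ratX = 0"
    using pq by (simp add: A0_def poly_constX Fract_conv_to_fract)
  moreover have "A0 \<noteq> 0"
  proof
    assume "A0 = 0"
    then have "coeff A0 (degree q) = 0" by simp
    then have "f = constX (coeff p (degree q) / lead_coeff q)"
      using pq by (simp add: A0_def coeff_map_poly field_simps)
    with f show False by blast
  qed
  ultimately have "?P A0" by blast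
  then obtain B where B: "?P B" and least: "\<And>C. ?P C \<Longrightarrow> degree B \<le> degree C"
    using ex_has_least_nat[of ?P A0 degree] by blast
  define A where "A = smult (inverse (lead_coeff B)) B"
  have "lead_coeff B \<in> E" using B by (simp add: coeffs_in_def)
  then have A: "coeffs_in E A" "lead_coeff A = 1" "poly A ratX = 0" "degree A = degree B"
    using B by (auto simp: A_def coeffs_in_def)
  moreover have "degree A > 0"
  proof (rule ccontr)
    assume "\<not> degree A > 0"
    then obtain a where "A = [:a:]" by (metis degree_eq_zeroE not_gr_zero)
    with A show False by simp
  qed
  ultimately show thesis using that[of A] least by metis
qed

text \<open>Any nonconstant coefficient f = p/q of the minimal polynomial \<open>A\<close> of X over
  \<open>E\<close> generates \<open>E\<close>: p(Y) - f q(Y) is a multiple of \<open>A\<close>, and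
  comparing degrees shows that it has the same degree \<open>n\<close>. Hence X has the same degree
  over K(f) as over \<open>E\<close>.\<close>

lemma generator:
  obtains f where "f \<in> E" "f \<notin> range constX" "E = gen constX f"
proof -
  obtain A where A: "coeffs_in E A" "lead_coeff A = 1" "poly A ratX = 0" "degree A > 0"
    and least: "\<And>B. coeffs_in E B \<Longrightarrow> poly B ratX = 0 \<Longrightarrow> B \<noteq> 0 \<Longrightarrow> degree A \<le> degree B"
    by (rule minimal_polynomial) (rule that; assumption)
  define n where "n = degree A"
  \<comment> \<open>With constant coefficients only, X would be algebraic over K.\<close>
  have "\<exists>i. coeff A i \<notin> range constX"
  proof (rule ccontr)
    assume "\<not> ?thesis"
    then have "\<forall>i. \<exists>c. coeff A i = constX c" by blast
    then obtain c where c: "coeff A i = constX (c i)" for i by metis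
    define B where "B = (\<Sum>i\<le>n. monom (c i) i)"
    have "map_poly constX B = A"
    proof (rule poly_eqI)
      fix i
      have "coeff B i = c i"
      proof (cases "i \<le> n")
        case False
        then have "constX (c i) = 0" using c[of i] by (simp add: n_def coeff_eq_0)
        then show ?thesis using False by (simp add: B_def coeff_sum)
      qed (simp add: B_def coeff_sum)
      then show "coeff (map_poly constX B) i = coeff A i" by (simp add: coeff_map_poly c)
    qed
    with A(3) poly_constX[of B] have "B = 0" by simp
    with \<open>map_poly constX B = A\<close> A(2) show False by simp
  qed
  then obtain i0 where i0: "coeff A i0 \<notin> range constX" by blast
  define f where "f = coeff A i0"
  have f: "f \<in> E" "f \<notin> range constX" using A(1) i0 by (auto simp: f_def coeffs_in_def)

  \<comment> \<open>A common denominator of least degree makes \<open>M\<close> primitive in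
    K[X][Y], as Gauss's lemma requires.\<close>
  define Q where "Q c \<longleftrightarrow> c \<noteq> 0 \<and> (\<exists>M. fract_poly M = smult (to_fract c) A)" for c
  obtain c1 where "Q c1" using common_denominator[of A] unfolding Q_def by blast
  then obtain c where "Q c" and least_c: "\<And>c'. Q c' \<Longrightarrow> degree c \<le> degree c'"
    using ex_has_least_nat[of Q c1 degree] by blast
  then obtain M where M: "c \<noteq> 0" "fract_poly M = smult (to_fract c) A" by (auto simp: Q_def)
  have coeffM: "to_fract (coeff M i) = to_fract c * coeff A i" for i
    using arg_cong[OF M(2), of "\<lambda>P. coeff P i"] by (simp add: coeff_map_poly)
  have Mn: "coeff M n = c" using coeffM[of n] A(2) by (simp add: n_def)
  have degM: "degree M = n"
  proof -
    have "coeff M i = 0" if "i > n" for i using coeffM[of i] that by (simp add: n_def coeff_eq_0)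
    then show ?thesis using Mn M(1) by (intro antisym degree_le le_degree) auto
  qed
  have prim: "\<not> [:\<pi>:] dvd M" if \<pi>: "prime_elem \<pi>" for \<pi>
  proof
    assume "[:\<pi>:] dvd M"
    then obtain M' where M': "M = smult \<pi> M'" by (auto elim!: dvdE)
    define c' where "c' = coeff M' n"
    have cc: "c = \<pi> * c'" using Mn by (simp add: M' c'_def)
    with M(1) have nz: "\<pi> \<noteq> 0" "c' \<noteq> 0" by auto
    have "smult (to_fract \<pi>) (fract_poly M') = smult (to_fract \<pi>) (smult (to_fract c') A)"
      using M(2) by (simp add: M' cc)
    then have "smult (to_fract \<pi>) (fract_poly M' - smult (to_fract c') A) = 0"
      by (simp only: smult_diff_right diff_self)
    then have "Q c'" using nz unfolding Q_def by (auto intro!: exI[of _ M'])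
    moreover have "degree c' < degree c"
      using nz \<pi> by (simp add: cc degree_mult_eq nonunit_poly_degree prime_elem_not_unit)
    ultimately show False using least_c[of c'] by simp
  qed

  obtain p q g where pq: "coprime p q" "coeff M i0 = g * p" "c = g * q" "g \<noteq> 0"
    using coprime_reduction[OF M(1)] by blast
  have q: "q \<noteq> 0" using pq M(1) by auto
  have fpq: "to_fract q * f = to_fract p"
  proof -
    have "to_fract g * to_fract p = to_fract g * (to_fract q * f)"
      using coeffM[of i0] pq by (simp add: f_def)
    then show ?thesis using pq(4) by simp
  qed
  have indep: False if "\<And>i. coeff p i = a * coeff q i" for a
  proof -
    have "p = smult a q" using that by (intro poly_eqI) simp
    then have "to_fract q * f = to_fract q * constX a"
      unfolding fpq by (simp add: constX_def flip: to_fract_mult)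
    then have "f = constX a" using q by simp
    with f(2) show False by blast
  qed
  define d where "d = max (degree p) (degree q)"
  have "d > 0"
  proof (rule ccontr)
    assume "\<not> d > 0"
    then obtain a b where ab: "p = [:a:]" "q = [:b:]"
      unfolding d_def by (metis degree_eq_zeroE gr_zeroI max_less_iff_conj max.cobounded1 max.cobounded2 le_zero_eq)
    show False
      by (rule indep[of "a / b"]) (use q in \<open>simp add: ab coeff_pCons split: nat.splits\<close>)
  qed
  \<comment> \<open>The coefficients of \<open>M\<close> at \<open>n\<close> and \<open>i0\<close>
    are \<open>g * q\<close> and \<open>g * p\<close>, so the X-degree of \<open>M\<close> is at
    least \<open>d\<close>.\<close>
  have dM: "\<exists>i. d \<le> degree (coeff M i)"
  proof (cases "degree p \<le> degree q")
    case True
    then have "d \<le> degree (coeff M n)" using pq q by (simp add: d_def Mn degree_mult_eq)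
    then show ?thesis by blast
  next
    case False
    then have "p \<noteq> 0" by auto
    with False have "d \<le> degree (coeff M i0)" using pq by (simp add: d_def degree_mult_eq)
    then show ?thesis by blast
  qed

  define \<Phi> where "\<Phi> = map_poly constX p - smult f (map_poly constX q)"
  \<comment> \<open>This is p(Y) q(X) - q(Y) p(X), with X the inner and Y the outer variable. Its
    X-degree is at most \<open>d\<close>, and it is antisymmetric in X and Y.\<close>
  define \<Psi> where "\<Psi> = map_poly (\<lambda>a. smult a q) p - map_poly (\<lambda>a. smult a p) q"
  have coeff\<Psi>: "coeff \<Psi> i = smult (coeff p i) q - smult (coeff q i) p" for i
    by (simp add: \<Psi>_def coeff_map_poly)
  have to_fract_smult: "to_fract (smult a r) = constX a * to_fract r" for a :: 'k and r
    by (simp add: constX_def flip: to_fract_mult)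
  have \<Psi>\<Phi>: "fract_poly \<Psi> = smult (to_fract q) \<Phi>"
    by (intro poly_eqI)
      (simp add: coeff_map_poly coeff\<Psi> \<Phi>_def to_fract_smult fpq[symmetric] algebra_simps)
  have \<Phi>: "coeffs_in E \<Phi>" "poly \<Phi> ratX = 0"
  proof -
    show "coeffs_in E \<Phi>" using f by (auto simp: \<Phi>_def coeffs_in_def coeff_map_poly)
    show "poly \<Phi> ratX = 0" using fpq by (simp add: \<Phi>_def poly_constX mult.commute)
  qed
  obtain B r where Br: "\<Phi> = A * B + r" "degree r < degree A" "coeffs_in E r"
    using coeffs_in_divide[OF A(1,2,4) \<Phi>(1)] by blast
  have "r = 0"
  proof (rule ccontr)
    assume "r \<noteq> 0"
    moreover have "poly r ratX = 0" using \<Phi>(2) A(3) by (simp add: Br(1))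
    ultimately show False using least[OF Br(3)] Br(2) by simp
  qed
  with Br have AB: "\<Phi> = A * B" by simp
  obtain e N0 where eN: "e \<noteq> 0" "fract_poly N0 = smult (to_fract e) B"
    using common_denominator[of B] by blast
  have "fract_poly (smult (c * e) \<Psi>) = fract_poly (M * smult q N0)"
    by (simp add: \<Psi>\<Phi> AB M(2) eN(2) mult_ac)
  then have "smult (c * e) \<Psi> = M * smult q N0" by (simp only: fract_poly_eq_iff)
  moreover have "c * e \<noteq> 0" using M(1) eN(1) by simp
  ultimately obtain N where N: "\<Psi> = M * N" using primitive_factor[OF prim] by blast
  have deg\<Psi>: "degree (coeff (M * N) i) \<le> d" for i
    unfolding N[symmetric] coeff\<Psi>
    by (intro degree_diff_le) (auto simp: d_def intro: order_trans[OF degree_smult_le])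
  have degN: "degree (coeff N j) = 0" for j
    using coeff_degrees_zero_of_mult[OF deg\<Psi> _ \<open>d > 0\<close>] dM by blast
  define \<nu> where "\<nu> = map_poly (\<lambda>a. coeff a 0) N"
  have coeffN: "coeff N j = [:coeff \<nu> j:]" for j
  proof -
    obtain a where "coeff N j = [:a:]" using degN[of j] by (rule degree_eq_zeroE)
    then show ?thesis by (simp add: \<nu>_def coeff_map_poly)
  qed
  \<comment> \<open>The cofactor is free of X, so it divides the coefficient of every power of X in
    \<Psi>; these coefficients are combinations of p(Y) and q(Y).\<close>
  have slice: "\<nu> dvd smult (coeff q k) p - smult (coeff p k) q" for k
  proof -
    have "map_poly (\<lambda>a. coeff a k) (M * N) = map_poly (\<lambda>a. coeff a k) M * \<nu>"
      by (intro poly_eqI) (simp add: coeff_map_poly coeff_mult coeff_sum coeffN, simp add: mult.commute)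
    moreover have "map_poly (\<lambda>a. coeff a k) \<Psi> = smult (coeff q k) p - smult (coeff p k) q"
      by (intro poly_eqI) (simp add: coeff_map_poly coeff\<Psi> mult.commute)
    ultimately have "smult (coeff q k) p - smult (coeff p k) q = map_poly (\<lambda>a. coeff a k) M * \<nu>"
      using N by simp
    then show ?thesis by (rule dvdI[OF trans[OF _ mult.commute]])
  qed
  \<comment> \<open>Two slices with nonzero determinant recover \<open>p\<close> and
    \<open>q\<close>, so \<nu> divides both and is a unit by coprimality.\<close>
  have "\<exists>k l. coeff p l * coeff q k - coeff p k * coeff q l \<noteq> 0"
  proof (rule ccontr)
    assume *: "\<not> ?thesis"
    have "coeff p l = (coeff p (degree q) / lead_coeff q) * coeff q l" for l
      using *[simplified, rule_format, of l "degree q"] q by (simp add: field_simps)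
    then show False by (rule indep)
  qed
  then obtain k l where kl: "coeff p l * coeff q k - coeff p k * coeff q l \<noteq> 0" (is "?D \<noteq> 0") by blast
  have "smult ?D p = smult (coeff p l) (smult (coeff q k) p - smult (coeff p k) q) -
      smult (coeff p k) (smult (coeff q l) p - smult (coeff p l) q)"
    by (intro poly_eqI) (simp add: algebra_simps)
  also have "\<nu> dvd \<dots>" by (intro dvd_diff dvd_smult slice)
  finally have 1: "\<nu> dvd p" using kl by (simp add: dvd_smult_iff)
  have "smult ?D q = smult (coeff q l) (smult (coeff q k) p - smult (coeff p k) q) -
      smult (coeff q k) (smult (coeff q l) p - smult (coeff p l) q)"
    by (intro poly_eqI) (simp add: algebra_simps)
  also have "\<nu> dvd \<dots>" by (intro dvd_diff dvd_smult slice)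
  finally have 2: "\<nu> dvd q" using kl by (simp add: dvd_smult_iff)
  from 1 2 pq(1) have "is_unit \<nu>" by (simp add: coprime_def)
  then obtain b where b: "\<nu> = [:b:]" "b \<noteq> 0" by (auto elim!: is_unit_polyE simp: dvd_field_iff)
  have "N = [:[:b:]:]"
    by (intro poly_eqI) (simp add: coeffN b coeff_pCons split: nat.splits)
  with b have "degree \<Psi> = n" unfolding N by (simp add: degM)
  \<comment> \<open>The coefficient of Y^d is a nontrivial combination of the linearly independent
    \<open>p\<close> and \<open>q\<close>. It follows that \<open>d \<le> n\<close>.\<close>
  have "coeff \<Psi> d \<noteq> 0"
  proof
    assume "coeff \<Psi> d = 0"
    then have "coeff (coeff \<Psi> d) i = 0" for i by simp
    then have eq: "coeff p d * coeff q i = coeff q d * coeff p i" for i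
      by (simp only: coeff\<Psi> coeff_diff coeff_smult right_minus_eq)
    show False
    proof (cases "coeff q d = 0")
      case False
      then have "coeff p i = (coeff p d / coeff q d) * coeff q i" for i using eq[of i] by (simp add: field_simps)
      then show False by (rule indep)
    next
      case True
      then have "degree q \<noteq> d" using q by auto
      then have "degree p = d" by (auto simp: d_def max_def split: if_splits)
      moreover have "coeff p d = 0" using eq[of "degree q"] q True by simp
      ultimately have "p = 0" by auto
      with indep[of 0] show False by simp
    qed
  qed
  then have "d \<le> n" using \<open>degree \<Psi> = n\<close> by (metis le_degree)
  have "\<Phi> \<noteq> 0"
  proof
    assume "\<Phi> = 0"
    then have "fract_poly \<Psi> = 0" using \<Psi>\<Phi> by simp
    with \<open>coeff \<Psi> d \<noteq> 0\<close> show False by simp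
  qed
  have "degree \<Phi> \<le> d"
    unfolding \<Phi>_def d_def
    by (intro degree_diff_le order_trans[OF degree_smult_le]) (auto intro: order_trans[OF map_poly_degree_leq])
  with \<open>d \<le> n\<close> least[OF \<Phi> \<open>\<Phi> \<noteq> 0\<close>] have deg\<Phi>: "degree \<Phi> = n" by (simp add: n_def)

  interpret F: subfld constX "gen constX f"
    by unfold_locales (rule subfield_over_gen[OF field_hom_constX])
  have fF: "f \<in> gen constX f" by (rule gen_self) (rule constX.rhom_axioms)
  have FE: "gen constX f \<subseteq> E" by (rule gen_subset) (rule f)
  define \<Phi>1 where "\<Phi>1 = smult (inverse (lead_coeff \<Phi>)) \<Phi>"
  have \<Phi>F: "coeffs_in (gen constX f) \<Phi>" using fF by (auto simp: \<Phi>_def coeffs_in_def coeff_map_poly)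
  then have "coeffs_in (gen constX f) \<Phi>1" by (auto simp: \<Phi>1_def coeffs_in_def)
  moreover have "lead_coeff \<Phi>1 = 1" "degree \<Phi>1 = n" using \<open>\<Phi> \<noteq> 0\<close> deg\<Phi> by (auto simp: \<Phi>1_def)
  moreover have "n > 0" using A(4) by (simp add: n_def)
  ultimately have divF: "\<exists>B r. P = \<Phi>1 * B + r \<and> degree r < n \<and> coeffs_in (gen constX f) r"
    if "coeffs_in (gen constX f) P" for P
    using F.coeffs_in_divide[OF _ _ _ that, of \<Phi>1] by simp
  \<comment> \<open>Reduction modulo the monic multiple of \<Phi> writes every polynomial in X with
    degree below \<open>n\<close> and coefficients in K(f).\<close>
  have rem: "\<exists>r. poly r ratX = to_fract u \<and> degree r < n \<and> coeffs_in (gen constX f) r" for u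
  proof -
    have "coeffs_in (gen constX f) (map_poly constX u)" by (auto simp: coeffs_in_def coeff_map_poly)
    from divF[OF this] obtain B r where Br: "map_poly constX u = \<Phi>1 * B + r" "degree r < n" "coeffs_in (gen constX f) r"
      by blast
    have "to_fract u = poly r ratX"
      unfolding poly_constX[of u, symmetric] Br(1) by (simp add: \<Phi>1_def \<Phi>(2))
    with Br show ?thesis by auto
  qed
  have "E \<subseteq> gen constX f"
  proof
    fix h assume h: "h \<in> E"
    obtain u w where uw: "h = Fract u w" "w \<noteq> 0" by (cases h)
    obtain s where s: "poly s ratX = to_fract u" "degree s < n" "coeffs_in (gen constX f) s" using rem by blast
    obtain v where v: "poly v ratX = to_fract w" "degree v < n" "coeffs_in (gen constX f) v" using rem by blast
    have "v \<noteq> 0" using v(1) uw(2) by auto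
    \<comment> \<open>This polynomial over \<open>E\<close> vanishes at X and has degree below the
      minimal one, so it is zero and \<open>h\<close> is a quotient of two coefficients in
      K(f).\<close>
    have "coeffs_in E (s - smult h v)"
      using s(3) v(3) FE h unfolding coeffs_in_def by (auto intro!: diff_in mult_in)
    moreover have "poly (s - smult h v) ratX = 0"
      using uw by (simp add: s(1) v(1) Fract_conv_to_fract)
    moreover have "degree (s - smult h v) < n"
      using s(2) v(2) by (intro degree_diff_less le_less_trans[OF degree_smult_le])
    ultimately have "s - smult h v = 0" using least by (metis n_def not_le)
    then have "coeff s i = h * coeff v i" for i by simp
    from this[of "degree v"] \<open>v \<noteq> 0\<close> have "h = coeff s (degree v) / coeff v (degree v)" by simp
    with s(3) v(3) show "h \<in> gen constX f" by (auto simp: coeffs_in_def)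
  qed
  with that f FE show thesis by blast
qed

end

section \<open>Subfields of transcendence degree 1\<close>

lemma digits_unique:
  fixes f g :: "nat \<Rightarrow> nat"
  assumes "(\<Sum>u<B. f u * N ^ u) = (\<Sum>u<B. g u * N ^ u)" "\<And>u. f u < N" "\<And>u. g u < N" "u < B"
  shows "f u = g u"
  using assms
proof (induction B arbitrary: f g u)
  case (Suc B)
  have split: "(\<Sum>u<Suc B. h u * N ^ u) = h 0 + N * (\<Sum>u<B. h (Suc u) * N ^ u)" for h :: "nat \<Rightarrow> nat"
    by (simp only: sum.lessThan_Suc_shift sum_distrib_left) (simp add: mult_ac)
  have eq: "f 0 + N * (\<Sum>u<B. f (Suc u) * N ^ u) = g 0 + N * (\<Sum>u<B. g (Suc u) * N ^ u)"
    using Suc.prems(1) by (simp only: split)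
  from arg_cong[OF eq, of "\<lambda>x. x mod N"] have 0: "f 0 = g 0"
    using Suc.prems(2)[of 0] Suc.prems(3)[of 0] by simp
  have "N > 0" using Suc.prems(2)[of 0] by simp
  with eq 0 have "(\<Sum>u<B. f (Suc u) * N ^ u) = (\<Sum>u<B. g (Suc u) * N ^ u)" by simp
  from Suc.IH[OF this] Suc.prems(2,3,4) 0 show ?case by (cases u) auto
qed simp

text \<open>The power of X to which the monomial is sent when X^(N^v) is put for the variable
  v.\<close>

definition weight :: "nat \<Rightarrow> (nat \<Rightarrow>\<^sub>0 nat) \<Rightarrow> nat" where
  "weight N m = (\<Sum>v\<in>keys m. lookup m v * N ^ v)"

lemma weight_inj:
  assumes "weight N m = weight N m'" "\<And>v. lookup m v < N" "\<And>v. lookup m' v < N"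
  shows "m = m'"
proof (rule poly_mapping_eqI)
  fix u
  have "finite (insert u (keys m \<union> keys m'))" by simp
  then obtain B where B: "insert u (keys m \<union> keys m') \<subseteq> {..<B}"
    using finite_nat_iff_bounded by blast
  have w: "weight N k = (\<Sum>v<B. lookup k v * N ^ v)" if "keys k \<subseteq> {..<B}" for k
    unfolding weight_def using that by (intro sum.mono_neutral_left) (auto simp: in_keys_iff)
  show "lookup m u = lookup m' u"
    using digits_unique[of "lookup m" N B "lookup m'" u] assms B w[of m] w[of m'] by auto
qed

definition kronecker :: "nat \<Rightarrow> ((nat \<Rightarrow>\<^sub>0 nat) \<Rightarrow>\<^sub>0 'k::field) \<Rightarrow> 'k poly" where
  "kronecker N = mpeval (\<lambda>a. [:a:]) (\<lambda>v. monom 1 (N ^ v))"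

lemma kronecker_conv:
  "kronecker N p = (\<Sum>m\<in>keys p. monom (lookup p m) (weight N m))"
proof -
  have "monom_eval (\<lambda>v. monom (1::'a) (N ^ v)) m = monom 1 (weight N m)" for m
  proof -
    have "(\<Prod>v\<in>A. monom (1::'a) (N ^ v) ^ lookup m v) = monom 1 (\<Sum>v\<in>A. lookup m v * N ^ v)" for A
      by (induction A rule: infinite_finite_induct) (auto simp: monom_power mult_monom mult.commute)
    then show ?thesis by (simp add: monom_eval_def weight_def)
  qed
  then show ?thesis unfolding kronecker_def mpeval_conv by (simp add: smult_monom)
qed

text \<open>Exponents below \<open>N\<close> are the base-N digits of the weight, so distinct
  monomials go to distinct powers of X and nothing cancels.\<close>

lemma kronecker_nonzero:
  assumes "p \<noteq> 0" "\<And>m v. m \<in> keys p \<Longrightarrow> lookup m v < N"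
  shows "kronecker N p \<noteq> 0"
proof -
  obtain m where m: "m \<in> keys p" using assms(1) by (metis all_not_in_conv keys_eq_empty)
  have "coeff (kronecker N p) (weight N m) = (\<Sum>k\<in>keys p. if k = m then lookup p m else 0)"
    unfolding kronecker_conv coeff_sum
    using assms(2) m by (intro sum.cong refl) (auto dest: weight_inj)
  also have "\<dots> = lookup p m" using m by simp
  also have "\<dots> \<noteq> 0" using m by (simp add: in_keys_iff)
  finally show ?thesis by auto
qed

lemma exponent_bound:
  fixes p :: "(nat \<Rightarrow>\<^sub>0 nat) \<Rightarrow>\<^sub>0 'k::zero"
  obtains N where "\<And>m v. m \<in> keys p \<Longrightarrow> lookup m v < N"
proof -
  let ?S = "(\<Union>m\<in>keys p. lookup m ` keys m)"
  have "finite ?S" by simp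
  then obtain N where N: "\<forall>x\<in>?S. x < N" using finite_nat_set_iff_bounded by blast
  have "lookup m v < Suc N" if "m \<in> keys p" for m v
  proof (cases "v \<in> keys m")
    case True
    with N that have "lookup m v < N" by blast
    then show ?thesis by simp
  qed (simp add: in_keys_iff)
  then show thesis by (rule that)
qed

text \<open>Kronecker's substitution \<open>x\<^sub>v \<mapsto> X^(N^v)\<close> keeps a nonconstant fraction nonconstant, also over finite fields.\<close>
lemma exists_place:
  fixes f :: "'k::field ratfun"
  assumes "f \<notin> range constK"
  obtains R :: "'k ratfun \<Rightarrow> 'k poly fract \<Rightarrow> bool" and c where "place R" "\<And>a. R (constK a) (constX a)" "R f c" "c \<notin> range constX"
proof -
  obtain a b where ab: "f = Fract a b" "b \<noteq> 0" by (cases f)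
  obtain N1 where N1: "\<And>m v. m \<in> keys a \<Longrightarrow> lookup m v < N1" by (rule exponent_bound[of a]) blast
  obtain N2 where N2: "\<And>m v. m \<in> keys b \<Longrightarrow> lookup m v < N2" by (rule exponent_bound[of b]) blast
  define N where "N = max N1 N2"
  define x :: "nat \<Rightarrow> 'k poly fract" where "x v = to_fract (monom 1 (N ^ v))" for v
  interpret translation constX x by unfold_locales
  interpret tf: rhom "to_fract :: 'k poly \<Rightarrow> _" by unfold_locales auto
  have ev: "mpeval constX x p = to_fract (kronecker N p)" for p
    unfolding kronecker_def by (simp add: tf.hom_mpeval[OF rhom_const_poly] constX_def[abs_def] x_def[abs_def])
  have "kronecker N b \<noteq> 0" using ab(2) N2 by (intro kronecker_nonzero) (auto simp: N_def less_max_iff_disj)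
  then have b: "mpeval constX x b \<noteq> 0" by (simp add: ev)
  have "mpeval constX x a / mpeval constX x b \<noteq> constX k" for k
  proof
    assume "mpeval constX x a / mpeval constX x b = constX k"
    then have "to_fract (kronecker N a) = to_fract ([:k:] * kronecker N b)"
      using b by (simp add: ev constX_def[symmetric] nonzero_divide_eq_eq del: mult_pCons_left)
    then have "kronecker N a = [:k:] * kronecker N b" by (simp only: to_fract_eq_iff)
    interpret c: rhom "\<lambda>a::'k. [:a:]" by (rule rhom_const_poly)
    interpret kr: rhom "kronecker N :: _ \<Rightarrow> 'k poly" unfolding kronecker_def by (rule c.rhom_mpeval)
    \<comment> \<open>If the quotient became a constant k, the substitution would kill a - k b. The
      exponents of this difference are still below \<open>N\<close>, so it would itself be
      zero.\<close>
    define d where "d = a - single 0 k * b"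
    have "kronecker N (single 0 k) = [:k:]"
      unfolding kronecker_def by (subst c.mpeval_single) simp
    with \<open>kronecker N a = _\<close> have "kronecker N d = 0" by (simp add: d_def)
    moreover have "keys d \<subseteq> keys a \<union> keys b"
    proof -
      have "keys (single 0 k * b) \<subseteq> keys b"
        using Poly_Mapping.keys_mult[of "single 0 k" b] by (auto split: if_splits)
      then show ?thesis
        unfolding d_def subset_iff Un_iff in_keys_iff lookup_minus by auto
    qed
    ultimately have "d = 0"
      using kronecker_nonzero[of d N] N1 N2 unfolding N_def less_max_iff_disj by blast
    then have "f = constK k" using ab by (simp add: d_def constK_def eq_fract)
    with assms show False by blast
  qed
  then have "mpeval constX x a / mpeval constX x b \<notin> range constX" by blast
  then show thesis by (rule that[OF place_residue residue_constK residue_Fract[OF b, of a, folded ab(1)]])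
qed

section \<open>Transcendence degree and algebraic dependence\<close>

lemma X_power: "[:0, 1:] ^ k = monom (1::'a::comm_ring_1) k"
  by (induction k) (auto simp: monom_Suc one_pCons)

lemma alg_indep_K_singleton:
  assumes "f \<notin> range constK"
  shows "alg_indep_K {f}"
  unfolding alg_indep_K_def
proof (intro allI impI)
  fix p :: "('a ratfun \<Rightarrow>\<^sub>0 nat) \<Rightarrow>\<^sub>0 'a"
  assume p: "pvars p \<subseteq> {f}" "mpeval constK id p = 0"
  \<comment> \<open>\<open>p\<close> rewritten in one variable: only \<open>f\<close> occurs in
    \<open>p\<close>, so its monomials are told apart by their exponents at
    \<open>f\<close>.\<close>
  define A where "A = mpeval (\<lambda>c. [:c:]) (\<lambda>_. [:0, 1:]) p"
  interpret ev: rhom "pev constK f" by (rule rhom_pev[OF rhom_constK])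
  have "pev constK f A = mpeval constK (\<lambda>_. f) p"
    unfolding A_def by (simp add: ev.hom_mpeval[OF rhom_const_poly] rhom_constK)
  also have "\<dots> = mpeval constK id p" using p(1) by (intro mpeval_cong) auto
  finally have "A = 0" using p(2) transc_constK[OF assms] by (simp add: transc_def)
  have keys: "keys m \<subseteq> {f}" if "m \<in> keys p" for m
    using p(1) that by (auto simp: pvars_def)
  have A: "A = (\<Sum>m\<in>keys p. monom (lookup p m) (lookup m f))"
    unfolding A_def mpeval_conv
  proof (intro sum.cong refl)
    fix m assume "m \<in> keys p"
    from monom_eval_superset[OF _ keys[OF this], of "\<lambda>_. [:0, 1:]"]
    have "monom_eval (\<lambda>_. [:0, 1:]) m = monom (1::'a) (lookup m f)"
      by (simp add: X_power)
    then show "[:lookup p m:] * monom_eval (\<lambda>_. [:0, 1:]) m = monom (lookup p m) (lookup m f)"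
      by (simp add: smult_monom)
  qed
  have "m \<notin> keys p" for m
  proof
    assume m: "m \<in> keys p"
    have inj: "k = m" if "k \<in> keys p" "lookup k f = lookup m f" for k
    proof (rule poly_mapping_eqI)
      fix v
      show "lookup k v = lookup m v"
      proof (cases "v = f")
        case False
        with keys[OF that(1)] keys[OF m] have "v \<notin> keys k" "v \<notin> keys m" by blast+
        then show ?thesis by (simp add: in_keys_iff)
      qed (use that(2) in auto)
    qed
    have "0 = coeff A (lookup m f)" using \<open>A = 0\<close> by simp
    also have "\<dots> = (\<Sum>k\<in>keys p. if k = m then lookup p m else 0)"
      unfolding A coeff_sum by (intro sum.cong refl) (auto dest: inj)
    finally show False using m by (simp add: in_keys_iff)
  qed
  then show "p = 0" by (metis all_not_in_conv keys_eq_empty)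
qed

lemma trdeg_K_ge_1:
  assumes "\<not> E \<subseteq> range constK"
  shows "trdeg_K E \<ge> 1"
proof -
  from assms obtain f where f: "f \<in> E" "f \<notin> range constK" by blast
  then have "enat (card {f}) \<in> {enat (card S) | S. finite S \<and> S \<subseteq> E \<and> alg_indep_K S}"
    using alg_indep_K_singleton by blast
  then have "enat (card {f}) \<le> trdeg_K E" unfolding trdeg_K_def by (rule Sup_upper)
  then show ?thesis by (simp add: one_enat_def)
qed

lemma algebraic_dependence:
  assumes "trdeg_K E \<le> 1" "f \<in> E" "e \<in> E"
  obtains P where "P \<noteq> 0" "poly (map_poly (pev constK f) P) e = 0"
proof (cases "e = f")
  case True
  interpret ev: rhom "pev constK f" by (rule rhom_pev[OF rhom_constK])
  \<comment> \<open>For \<open>e = f\<close> the set {f, e} has a single element and its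
    independence is no contradiction; the relation X - Y serves instead.\<close>
  show thesis
    by (rule that[of "[:[:0, 1:], - 1:]"]) (auto simp: True rhom_constK)
next
  case False
  have "\<not> alg_indep_K {f, e}"
  proof
    assume "alg_indep_K {f, e}"
    then have "enat (card {f, e}) \<in> {enat (card S) | S. finite S \<and> S \<subseteq> E \<and> alg_indep_K S}"
      using assms by blast
    then have "enat (card {f, e}) \<le> trdeg_K E" unfolding trdeg_K_def by (rule Sup_upper)
    with assms(1) have "enat (card {f, e}) \<le> 1" by (rule order_trans[rotated])
    with False show False by (simp add: one_enat_def)
  qed
  then obtain p :: "('a ratfun \<Rightarrow>\<^sub>0 nat) \<Rightarrow>\<^sub>0 'a" where p: "pvars p \<subseteq> {f, e}" "mpeval constK id p = 0" "p \<noteq> 0"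
    by (auto simp: alg_indep_K_def)
  interpret ev: rhom "pev constK f" by (rule rhom_pev[OF rhom_constK])
  interpret Ev: rhom "\<lambda>Q. poly (map_poly (pev constK f) Q) e"
    by (rule rhom_comp[OF ev.rhom_map_poly rhom_poly])
  have cc: "rhom (\<lambda>c::'a. [:[:c:]:])" by (rule rhom_comp[OF rhom_const_poly rhom_const_poly])
  let ?x = "\<lambda>v. if v = f then [:[:0, 1:]:] else [:0, 1:] :: 'a poly poly"
  define P where "P = mpeval (\<lambda>c. [:[:c:]:]) ?x p"
  have "poly (map_poly (pev constK f) P) e = mpeval constK (\<lambda>v. if v = f then f else e) p"
  proof -
    have "(\<lambda>v. poly (map_poly (pev constK f) (?x v)) e) = (\<lambda>v. if v = f then f else e)"
      by (auto simp: rhom_constK)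
    moreover have "poly (map_poly (pev constK f) [:[:a:]:]) e = constK a" for a
      by (simp add: rhom_constK)
    ultimately show ?thesis unfolding P_def by (simp only: Ev.hom_mpeval[OF cc])
  qed
  also have "\<dots> = mpeval constK id p" using p(1) by (intro mpeval_cong) auto
  finally have "poly (map_poly (pev constK f) P) e = 0" using p(2) by simp
  moreover have "P \<noteq> 0"
  proof
    assume "P = 0"
    have keys: "keys m \<subseteq> {f, e}" if "m \<in> keys p" for m
      using p(1) that by (auto simp: pvars_def)
    have P: "P = (\<Sum>m\<in>keys p. monom (monom (lookup p m) (lookup m f)) (lookup m e))"
      unfolding P_def mpeval_conv
    proof (intro sum.cong refl)
      fix m assume "m \<in> keys p"
      from monom_eval_superset[OF _ keys[OF this], of ?x] False
      have "monom_eval ?x m = [:[:0, 1:]:] ^ lookup m f * [:0, 1:] ^ lookup m e"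
        by simp
      also have "\<dots> = monom (monom 1 (lookup m f)) (lookup m e)"
        by (simp add: X_power poly_const_pow smult_monom)
      finally show "[:[:lookup p m:]:] * monom_eval ?x m = 
          monom (monom (lookup p m) (lookup m f)) (lookup m e)"
        by (simp add: smult_monom)
    qed
    have "m \<notin> keys p" for m
    proof
      assume m: "m \<in> keys p"
      have inj: "k = m" if "k \<in> keys p" "lookup k f = lookup m f"
          "lookup k e = lookup m e" for k
      proof (rule poly_mapping_eqI)
        fix v
        show "lookup k v = lookup m v"
        proof (cases "v \<in> {f, e}")
          case False
          with keys[OF that(1)] keys[OF m] have "v \<notin> keys k" "v \<notin> keys m" by blast+
          then show ?thesis by (simp add: in_keys_iff)
        qed (use that(2,3) in auto)
      qed
      have "0 = coeff (coeff P (lookup m e)) (lookup m f)" using \<open>P = 0\<close> by simp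
      also have "\<dots> = (\<Sum>k\<in>keys p. if k = m then lookup p m else 0)"
        unfolding P coeff_sum by (intro sum.cong refl) (auto dest: inj)
      finally show False using m by (simp add: in_keys_iff)
    qed
    with p(3) show False by (metis all_not_in_conv keys_eq_empty)
  qed
  ultimately show thesis using that by blast
qed

lemma trdeg_1_imp_generator:
  fixes E :: "'k::field ratfun set"
  assumes E: "is_K_subfield E" and "\<not> E \<subseteq> range constK" "trdeg_K E \<le> 1"
  obtains t where "t \<in> E" "t \<notin> range constK" "E = gen constK t"
proof -
  interpret E: subfld constK E
    by unfold_locales (use E in \<open>simp add: is_K_subfield_conv\<close>)
  from assms(2) obtain f where f: "f \<in> E" "f \<notin> range constK" by blast
  from exists_place[OF f(2)] obtain R :: "'k ratfun \<Rightarrow> 'k poly fract \<Rightarrow> bool" and c where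
    R: "place R" "\<And>a. R (constK a) (constX a)" "R f c" "c \<notin> range constX" by blast
  interpret place R by (rule R(1))
  \<comment> \<open>By the bound on the transcendence degree, \<open>E\<close> is algebraic over
    K(f); so the residue map is defined and injective on all of \<open>E\<close>.\<close>
  have unit: "\<exists>a. a \<noteq> 0 \<and> R e a" if e: "e \<in> E" "e \<noteq> 0" for e
  proof -
    obtain P where "P \<noteq> 0" "poly (map_poly (pev constK f) P) e = 0"
      using algebraic_dependence[OF assms(3) f(1) e(1)] by blast
    from root_unit_over_transc[OF rhom_constK constX.rhom_axioms R(2,3) constX_algebraically_closed[OF R(4)] this e(2)]
    show ?thesis .
  qed
  \<comment> \<open>A total function whose good behaviour is known only on \<open>E\<close>, hence
    the homomorphism laws relative to membership in \<open>E\<close>.\<close>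
  define \<phi> where "\<phi> e = (THE a. R e a)" for e
  have \<phi>I: "\<phi> e = a" if "R e a" for e a
    unfolding \<phi>_def using that by (intro the_equality) (auto intro: unique)
  have \<phi>: "R e (\<phi> e)" if "e \<in> E" for e
    using unit[OF that] zero \<phi>I by (cases "e = 0") metis+
  have \<phi>0: "e = 0" if "e \<in> E" "\<phi> e = 0" for e
    using unit[OF that(1)] \<phi>I that(2) by metis
  have add: "\<phi> (x + y) = \<phi> x + \<phi> y" and mult: "\<phi> (x * y) = \<phi> x * \<phi> y" if "x \<in> E" "y \<in> E" for x y
    using that by (auto intro!: \<phi>I add mult \<phi>)
  have const: "\<phi> (constK a) = constX a" for a by (rule \<phi>I[OF R(2)])
  have uminus: "\<phi> (- x) = - \<phi> x" if "x \<in> E" for x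
  proof -
    have "\<phi> (- 1) = - 1" using const[of "- 1"] by simp
    then show ?thesis using mult[OF E.uminus_in[OF E.one_in] that] by simp
  qed
  have diff: "\<phi> (x - y) = \<phi> x - \<phi> y" if "x \<in> E" "y \<in> E" for x y
    using add[OF that(1) E.uminus_in[OF that(2)]] uminus[OF that(2)] by simp
  have inv: "\<phi> (inverse x) = inverse (\<phi> x)" if "x \<in> E" for x
  proof (cases "x = 0")
    case True
    then show ?thesis using \<phi>I[OF zero] by simp
  next
    case False
    then have "\<phi> x \<noteq> 0" using \<phi>0 that by blast
    then show ?thesis using inverse[OF \<phi>[OF that]] by (intro \<phi>I) 
  qed
  have pev: "\<phi> (pev constK x A) = pev constX (\<phi> x) A" if "x \<in> E" for x A
    using that by (induction A) (auto simp: rhom_constK constX.rhom_axioms add mult const E.mult_in E.pev_in \<phi>I[OF zero])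
  interpret L: luroth "\<phi> ` E"
  proof unfold_locales
    show "subfield_over constX (\<phi> ` E)"
      unfolding subfield_over_def
    proof (intro conjI ballI impI)
      show "range constX \<subseteq> \<phi> ` E" using const by (metis E.const_in image_eqI image_subsetI)
    qed (auto simp: add[symmetric] mult[symmetric] uminus[symmetric] inv[symmetric])
    show "\<not> \<phi> ` E \<subseteq> range constX" using f(1) R(4) \<phi>I[OF R(3)] by blast
  qed
  obtain t' where t': "t' \<in> \<phi> ` E" "t' \<notin> range constX" "\<phi> ` E = gen constX t'" by (rule L.generator)
  then obtain t where t: "t \<in> E" "t' = \<phi> t" by blast
  have "E \<subseteq> gen constK t"
  proof
    fix e assume e: "e \<in> E"
    then have "\<phi> e \<in> gen constX (\<phi> t)" using t'(3) t(2) by blast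
    then obtain A B where AB: "\<phi> e = pev constX (\<phi> t) A / pev constX (\<phi> t) B" "pev constX (\<phi> t) B \<noteq> 0"
      by (auto simp: gen_def)
    have nz: "pev constK t B \<noteq> 0" using AB(2) pev[OF t(1), of B] \<phi>I[OF zero] by auto
    have "\<phi> (e * pev constK t B - pev constK t A) = 0"
    proof -
      have "\<phi> (e * pev constK t B - pev constK t A) = \<phi> e * pev constX (\<phi> t) B - pev constX (\<phi> t) A"
        using e t(1) by (simp add: diff mult pev E.mult_in E.pev_in)
      also have "\<dots> = 0" using AB by simp
      finally show ?thesis by simp
    qed
    then have "e * pev constK t B - pev constK t A = 0"
      using e t(1) by (intro \<phi>0) (auto intro: E.diff_in E.mult_in E.pev_in)
    with nz have "e = pev constK t A / pev constK t B" by (simp add: field_simps)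
    then show "e \<in> gen constK t" using nz by (rule genI)
  qed
  moreover have "gen constK t \<subseteq> E" by (rule E.gen_subset) (rule t)
  moreover have "t \<notin> range constK" using t'(2) t const by auto
  ultimately show thesis using that t(1) by blast
qed

text \<open>Gaussian elimination on the top coefficient with a pivot \<open>j\<close>. An indexed
  family is used so that repeated polynomials count as dependent.\<close>

lemma poly_linear_dependence:
  fixes g :: "'i \<Rightarrow> 'k::field poly"
  assumes "finite I" "\<And>i k. i \<in> I \<Longrightarrow> k \<ge> L \<Longrightarrow> coeff (g i) k = 0" "L < card I"
  shows "\<exists>c. (\<exists>i\<in>I. c i \<noteq> 0) \<and> (\<Sum>i\<in>I. smult (c i) (g i)) = 0"
  using assms
proof (induction L arbitrary: I g)
  case 0
  then have "g i = 0" if "i \<in> I" for i using that by (intro poly_eqI) simp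
  moreover have "I \<noteq> {}" using 0 by auto
  ultimately show ?case by (intro exI[of _ "\<lambda>_. 1"]) auto
next
  case (Suc L)
  show ?case
  proof (cases "\<forall>i\<in>I. coeff (g i) L = 0")
    case True
    have "coeff (g i) k = 0" if "i \<in> I" "k \<ge> L" for i k
      using Suc.prems(2)[of i k] True that by (cases "k = L") auto
    then show ?thesis using Suc.IH[of I g] Suc.prems by simp
  next
    case False
    then obtain j where j: "j \<in> I" "coeff (g j) L \<noteq> 0" by blast
    define q where "q i = coeff (g i) L / coeff (g j) L" for i
    define g' where "g' i = g i - smult (q i) (g j)" for i
    have "coeff (g' i) k = 0" if "i \<in> I - {j}" "k \<ge> L" for i k
      using Suc.prems(2)[of i k] Suc.prems(2)[of j k] that j by (cases "k = L") (auto simp: g'_def q_def)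
    moreover have "L < card (I - {j})" using Suc.prems j by simp
    ultimately obtain c where c: "\<exists>i\<in>I - {j}. c i \<noteq> 0" "(\<Sum>i\<in>I - {j}. smult (c i) (g' i)) = 0"
      using Suc.IH[of "I - {j}" g'] Suc.prems(1) by blast
    define c' where "c' i = (if i = j then - (\<Sum>i\<in>I - {j}. c i * q i) else c i)" for i
    have "(\<Sum>i\<in>I. smult (c' i) (g i)) = smult (c' j) (g j) + (\<Sum>i\<in>I - {j}. smult (c' i) (g i))"
      using Suc.prems(1) j by (simp add: sum.remove)
    also have "(\<Sum>i\<in>I - {j}. smult (c' i) (g i)) = (\<Sum>i\<in>I - {j}. smult (c i) (g' i) + smult (c i * q i) (g j))"
      by (intro sum.cong) (auto simp: c'_def g'_def smult_diff_right)
    also have "\<dots> = smult (\<Sum>i\<in>I - {j}. c i * q i) (g j)"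
      by (simp add: sum.distrib c(2) smult_sum)
    finally have "(\<Sum>i\<in>I. smult (c' i) (g i)) = 0" by (simp add: c'_def)
    moreover have "\<exists>i\<in>I. c' i \<noteq> 0" using c(1) by (auto simp: c'_def)
    ultimately show ?thesis by blast
  qed
qed

text \<open>Counting dimensions: the \<open>(N + 1)^2\<close> monomials \<open>a^i b^j\<close> have a common denominator and numerators of degree linear in N.\<close>
lemma gen_dependent:
  fixes t :: "'k::field ratfun"
  assumes "a \<in> gen constK t" "b \<in> gen constK t"
  obtains N c where "\<exists>i\<le>N. \<exists>j\<le>N. c i j \<noteq> 0" "(\<Sum>i\<le>N. \<Sum>j\<le>N. constK (c i j) * a ^ i * b ^ j) = 0"
proof -
  interpret ev: rhom "pev constK t" by (rule rhom_pev[OF rhom_constK])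
  obtain A1 B1 where 1: "a = pev constK t A1 / pev constK t B1" "pev constK t B1 \<noteq> 0"
    using assms(1) by (auto simp: gen_def)
  obtain A2 B2 where 2: "b = pev constK t A2 / pev constK t B2" "pev constK t B2 \<noteq> 0"
    using assms(2) by (auto simp: gen_def)
  define A B D where "A = A1 * B2" and "B = A2 * B1" and "D = B1 * B2"
  have D: "pev constK t D \<noteq> 0" using 1 2 by (simp add: D_def)
  have A: "pev constK t A = a * pev constK t D" and B: "pev constK t B = b * pev constK t D"
    using 1 2 by (simp_all add: A_def B_def D_def)
  define M where "M = max (degree A) (max (degree B) (degree D))"
  have M: "degree A \<le> M" "degree B \<le> M" "degree D \<le> M" by (auto simp: M_def)
  \<comment> \<open>Over the common denominator \<open>D ^ (2 * N)\<close> the numerators have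
    degree at most 2NM, and N = 2M + 1 makes (N + 1)^2 exceed 2NM + 1.\<close>
  define N where "N = 2 * M + 1"
  define I where "I = {..N} \<times> {..N}"
  define F where "F = (\<lambda>(i, j). A ^ i * B ^ j * D ^ (2 * N - i - j))"
  have deg: "degree (F x) \<le> 2 * N * M" if "x \<in> I" for x
  proof -
    obtain i j where x: "x = (i, j)" "i \<le> N" "j \<le> N" using \<open>x \<in> I\<close> by (auto simp: I_def)
    have pow: "degree (P ^ k) \<le> k * M" if "degree P \<le> M" for P :: "'k poly" and k
    proof -
      have "degree P * k \<le> k * M" using that by (simp add: mult.commute)
      with degree_power_le[of P k] show ?thesis by (rule order_trans)
    qed
    have "degree (F x) \<le> degree (A ^ i) + degree (B ^ j) + degree (D ^ (2 * N - i - j))"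
      unfolding F_def x by (simp add: degree_mult_le[THEN order_trans] degree_mult_le)
    also have "\<dots> \<le> i * M + j * M + (2 * N - i - j) * M"
      using pow M by (intro add_mono) auto
    also have "\<dots> = 2 * N * M" using x by (simp flip: add_mult_distrib)
    finally show ?thesis .
  qed
  have "card I = (N + 1) * (N + 1)" by (simp add: I_def)
  also have "\<dots> > 2 * N * M + 1" by (simp add: N_def algebra_simps)
  finally have "2 * N * M + 1 < card I" .
  moreover have "finite I" by (simp add: I_def)
  moreover have "coeff (F x) k = 0" if "x \<in> I" "k \<ge> 2 * N * M + 1" for x k
    using deg[OF that(1)] that(2) by (intro coeff_eq_0) simp
  ultimately obtain c where c: "\<exists>x\<in>I. c x \<noteq> 0" "(\<Sum>x\<in>I. smult (c x) (F x)) = 0"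
    using poly_linear_dependence[of I "2 * N * M + 1" F] by blast
  have summand: "pev constK t (smult (c x) (F x)) = pev constK t D ^ (2 * N) * (case x of (i, j) \<Rightarrow> constK (c (i, j)) * a ^ i * b ^ j)"
    if x: "x \<in> I" for x
  proof -
    obtain i j where x: "x = (i, j)" "i \<le> N" "j \<le> N" using x by (auto simp: I_def)
    have "i + j + (2 * N - i - j) = 2 * N" using x by simp
    then have "pev constK t D ^ i * pev constK t D ^ j * pev constK t D ^ (2 * N - i - j) = pev constK t D ^ (2 * N)"
      by (metis power_add)
    moreover have "pev constK t (smult (c x) (F x)) = constK (c x) * pev constK t (F x)"
      by (simp add: pev_def)
    ultimately show ?thesis
      by (simp add: x F_def A B power_mult_distrib mult_ac)
  qed
  have "0 = pev constK t (\<Sum>x\<in>I. smult (c x) (F x))" using c(2) by simp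
  also have "\<dots> = pev constK t D ^ (2 * N) * (\<Sum>x\<in>I. case x of (i, j) \<Rightarrow> constK (c (i, j)) * a ^ i * b ^ j)"
    by (simp add: ev.hom_sum sum_distrib_left summand)
  finally have "(\<Sum>x\<in>I. case x of (i, j) \<Rightarrow> constK (c (i, j)) * a ^ i * b ^ j) = 0" using D by simp
  then have "(\<Sum>i\<le>N. \<Sum>j\<le>N. constK (c (i, j)) * a ^ i * b ^ j) = 0"
    by (simp add: I_def sum.cartesian_product)
  moreover have "\<exists>i\<le>N. \<exists>j\<le>N. c (i, j) \<noteq> 0" using c(1) by (auto simp: I_def)
  ultimately show thesis using that[of N "\<lambda>i j. c (i, j)"] by blast
qed

lemma trdeg_gen_le_1: "trdeg_K (gen constK t) \<le> 1"
  unfolding trdeg_K_def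
proof (rule Sup_least)
  fix y assume "y \<in> {enat (card S) |S. finite S \<and> S \<subseteq> gen constK t \<and> alg_indep_K S}"
  then obtain S where S: "y = enat (card S)" "finite S" "S \<subseteq> gen constK t" "alg_indep_K S" by blast
  show "y \<le> 1"
  proof (rule ccontr)
    assume "\<not> y \<le> 1"
    then have "card S > 1" by (simp add: S(1) one_enat_def)
    then obtain a b where ab: "a \<in> S" "b \<in> S" "a \<noteq> b"
      by (metis card_le_Suc0_iff_eq S(2) One_nat_def not_less)
    obtain N c where c: "\<exists>i\<le>N. \<exists>j\<le>N. c i j \<noteq> 0" "(\<Sum>i\<le>N. \<Sum>j\<le>N. constK (c i j) * a ^ i * b ^ j) = 0"
      using gen_dependent[of a t b] ab S(3) by blast
    define mon where "mon i j = single a i + single b j" for i j :: nat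
    define p where "p = (\<Sum>i\<le>N. \<Sum>j\<le>N. single (mon i j) (c i j))"
    have mon: "mon i j = mon i' j' \<longleftrightarrow> i = i' \<and> j = j'" for i j i' j'
    proof
      assume "mon i j = mon i' j'"
      from arg_cong[OF this, of "\<lambda>m. lookup m a"] arg_cong[OF this, of "\<lambda>m. lookup m b"]
      show "i = i' \<and> j = j'" using ab(3) by (simp add: mon_def lookup_add lookup_single)
    qed auto
    have eval: "monom_eval id (mon i j) = a ^ i * b ^ j" for i j
      by (simp add: mon_def monom_eval_add)
    interpret mp: rhom "mpeval constK id :: _ \<Rightarrow> 'a ratfun" by (rule rhom.rhom_mpeval[OF rhom_constK])
    have "mpeval constK id p = 0"
      using c(2) by (simp add: p_def mp.hom_sum constK.mpeval_single eval mult.assoc)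
    moreover have "pvars p \<subseteq> S"
    proof -
      have "keys (mon i j) \<subseteq> {a, b}" for i j
        unfolding mon_def using Poly_Mapping.keys_add[of "single a i" "single b j"]
        by (auto split: if_splits)
      moreover have "\<exists>i j. m = mon i j" if "m \<in> keys p" for m
      proof (rule ccontr)
        assume *: "\<not> ?thesis"
        then have "mon i j \<noteq> m" for i j by blast
        then have "lookup p m = 0"
          by (simp add: p_def lookup_sum lookup_single when_def)
        with that show False by (simp add: in_keys_iff)
      qed
      ultimately show ?thesis using ab unfolding pvars_def by blast
    qed
    ultimately have "p = 0" using S(4) by (auto simp: alg_indep_K_def)
    obtain i j where ij: "i \<le> N" "j \<le> N" "c i j \<noteq> 0" using c(1) by blast
    have "lookup p (mon i j) = (\<Sum>i'\<le>N. \<Sum>j'\<le>N. if i' = i \<and> j' = j then c i j else 0)"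
      unfolding p_def by (auto simp: lookup_sum lookup_single when_def mon intro!: sum.cong)
    also have "\<dots> = (\<Sum>i'\<le>N. if i' = i then \<Sum>j'\<le>N. if j' = j then c i j else 0 else 0)"
      by (intro sum.cong) auto
    also have "\<dots> = c i j" using ij by simp
    finally show False using \<open>p = 0\<close> ij by simp
  qed
qed

section \<open>The subfields K(V) of the rational functions\<close>

lemma pvars_add: "pvars (p + q) \<subseteq> pvars p \<union> pvars q"
  using Poly_Mapping.keys_add[of p q] by (auto simp: pvars_def)

lemma pvars_mult: "pvars (p * q) \<subseteq> pvars p \<union> pvars (q :: ('v \<Rightarrow>\<^sub>0 nat) \<Rightarrow>\<^sub>0 'a::comm_ring_1)"
proof
  fix v assume "v \<in> pvars (p * q)"
  then obtain m where m: "m \<in> keys (p * q)" "v \<in> keys m" by (auto simp: pvars_def)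
  from m(1) Poly_Mapping.keys_mult[of p q] obtain a b where
    "m = a + b" "a \<in> keys p" "b \<in> keys q" by blast
  with m(2) Poly_Mapping.keys_add[of a b] show "v \<in> pvars p \<union> pvars q" by (auto simp: pvars_def)
qed

lemma pvars_uminus: "pvars (- p) = pvars (p :: ('v \<Rightarrow>\<^sub>0 nat) \<Rightarrow>\<^sub>0 'a::comm_ring_1)"
  by (simp add: pvars_def in_keys_iff)

lemma subfield_over_KV: "subfield_over constK (KV N)"
proof -
  have "constK c \<in> KV N" for c :: 'a
    unfolding KV_def constK_def
    by (intro CollectI exI[of _ "single 0 c"] exI[of _ 1])
      (auto simp: pvars_def)
  moreover have "x + y \<in> KV N \<and> x * y \<in> KV N \<and> - x \<in> KV N \<and> (x \<noteq> 0 \<longrightarrow> inverse x \<in> KV N)"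
    if x: "x \<in> KV N" and y: "y \<in> KV N" for x y :: "'a ratfun"
  proof -
    obtain a b where ab: "x = Fract a b" "b \<noteq> 0" "pvars a \<subseteq> N" "pvars b \<subseteq> N" using x by (auto simp: KV_def)
    obtain c d where cd: "y = Fract c d" "d \<noteq> 0" "pvars c \<subseteq> N" "pvars d \<subseteq> N" using y by (auto simp: KV_def)
    have "pvars (b * d) \<subseteq> N" "pvars (a * c) \<subseteq> N" "pvars (a * d + c * b) \<subseteq> N"
      using pvars_mult[of b d] pvars_mult[of a c] pvars_mult[of a d] pvars_mult[of c b] pvars_add[of "a * d" "c * b"] ab cd
      by blast+
    then have "x + y \<in> KV N" "x * y \<in> KV N"
      unfolding KV_def using ab cd by (auto intro!: exI)
    moreover have "- x \<in> KV N" unfolding KV_def using ab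
      by (intro CollectI exI[of _ "- a"] exI[of _ b]) (simp add: pvars_uminus)
    moreover have "inverse x \<in> KV N" if "x \<noteq> 0" unfolding KV_def using ab that
      by (intro CollectI exI[of _ b] exI[of _ a]) (auto simp: Zero_fract_def eq_fract)
    ultimately show ?thesis by blast
  qed
  ultimately show ?thesis unfolding subfield_over_def by blast
qed

lemma Xvar_in_KV: "v \<in> N \<Longrightarrow> Xvar v \<in> KV N"
  unfolding KV_def Xvar_def
  by (intro CollectI exI[of _ "single (single v 1) 1"] exI[of _ 1])
    (auto simp: pvars_def)

section \<open>The action of the dihedral group\<close>

lemma dih_mult_encoded:
  assumes "i < n" "a < 2" "j < n" "b < 2"
  shows "dih_mult n (i + n * a) (j + n * b) = ((i + (if a = 0 then j else n - j)) mod n) + n * ((a + b) mod 2)"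
  using assms by (simp add: dih_mult_def Let_def)

lemma encode_cases:
  assumes "g < 2 * n"
  obtains i a where "g = i + n * a" "i < n" "a < (2::nat)"
proof
  show "g = g mod n + n * (g div n)" by simp
  show "g mod n < n" using assms by (cases n) auto
  show "g div n < 2" using assms by (simp add: less_mult_imp_div_less)
qed

text \<open>Passes from truncated subtraction to the integers, where associativity of the dihedral
  product is ring arithmetic.\<close>

lemma int_reflect_mod: "x \<le> n \<Longrightarrow> int ((i + (n - x)) mod n) = (int i - int x) mod int n"
  by (simp add: zmod_int of_nat_diff) (metis add.commute add_diff_eq diff_add_eq mod_add_self2)

locale dih =
  fixes n :: nat
  assumes n: "n > 0"
begin

text \<open>The rotation exponent of r^i s^a r^j s^b: moving s past r^j reverses the sign of
  \<open>j\<close>.\<close>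

definition add :: "nat \<Rightarrow> nat \<Rightarrow> nat \<Rightarrow> nat" where
  "add a i j = (i + (if a = 0 then j else n - j)) mod n"

lemma add_less: "add a i j < n"
  using n by (simp add: add_def)

lemma int_add: "j < n \<Longrightarrow> int (add a i j) = (if a = 0 then (int i + int j) mod int n else (int i - int j) mod int n)"
  using int_reflect_mod[of j n i] by (simp add: add_def zmod_int of_nat_diff add_diff_eq)

lemma mult_encode:
  "i < n \<Longrightarrow> a < 2 \<Longrightarrow> j < n \<Longrightarrow> b < 2 \<Longrightarrow> dih_mult n (i + n * a) (j + n * b) = add a i j + n * ((a + b) mod 2)"
  by (simp add: dih_mult_encoded add_def)

lemma encode_less: "i < n \<Longrightarrow> a < 2 \<Longrightarrow> i + n * a < 2 * n"
  by (cases a) (auto simp: less_Suc_eq numeral_2_eq_2)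

lemma mult_less: "g < 2 * n \<Longrightarrow> h < 2 * n \<Longrightarrow> dih_mult n g h < 2 * n"
  by (elim encode_cases) (simp add: mult_encode encode_less add_less)

lemma mult_assoc:
  assumes "g < 2 * n" "h < 2 * n" "k < 2 * n"
  shows "dih_mult n (dih_mult n g h) k = dih_mult n g (dih_mult n h k)"
proof -
  obtain i a where g: "g = i + n * a" "i < n" "a < 2" using assms(1) by (rule encode_cases)
  obtain j b where h: "h = j + n * b" "j < n" "b < 2" using assms(2) by (rule encode_cases)
  obtain l c where k: "k = l + n * c" "l < n" "c < 2" using assms(3) by (rule encode_cases)
  have "int (add ((a + b) mod 2) (add a i j) l) = int (add a i (add b j l))"
  proof -
    have "a = 0 \<or> a = 1" "b = 0 \<or> b = 1" using g h by auto
    then show ?thesis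
      using g h k by (elim disjE) (simp_all add: int_add add_less mod_simps algebra_simps)
  qed
  then have "add ((a + b) mod 2) (add a i j) l = add a i (add b j l)" by (simp only: of_nat_eq_iff)
  then show ?thesis
    using g h k by (simp add: mult_encode add_less mod_simps add_ac)
qed

lemma mult_0_left: "g < 2 * n \<Longrightarrow> dih_mult n 0 g = g"
  using mult_encode[of 0 0] n by (elim encode_cases) (simp add: add_def)

lemma left_inverse:
  assumes "g < 2 * n"
  obtains h where "h < 2 * n" "dih_mult n h g = 0"
proof -
  obtain i a where g: "g = i + n * a" "i < n" "a < 2" using assms by (rule encode_cases)
  then consider "a = 0" | "a = 1" by linarith
  then show thesis
  proof cases
    case 1
    have "dih_mult n ((n - i) mod n + n * 0) (i + n * a) = add 0 ((n - i) mod n) i + n * ((0 + a) mod 2)"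
      using g n by (intro mult_encode) auto
    also have "add 0 ((n - i) mod n) i = 0" using g by (simp add: add_def mod_simps)
    finally show thesis using that[of "(n - i) mod n"] n g 1 by (simp add: less_le_trans[of _ n])
  next
    case 2
    have "dih_mult n (i + n * 1) (i + n * a) = add 1 i i + n * ((1 + a) mod 2)"
      using g n 2 by (intro mult_encode) auto
    also have "add 1 i i = 0" using g by (simp add: add_def)
    finally show thesis using that[of "i + n * 1"] encode_less[of i 1] g 2 by simp
  qed
qed

lemma mult_rotation: "i < n \<Longrightarrow> j < n \<Longrightarrow> b < 2 \<Longrightarrow> dih_mult n i (j + n * b) = (i + j) mod n + n * b"
  using mult_encode[of i 0 j b] by (simp add: add_def)

lemma mult_reflection: "j < n \<Longrightarrow> b < 2 \<Longrightarrow> dih_mult n n (j + n * b) = (n - j) mod n + n * (1 - b)"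
  using mult_encode[of 0 1 j b] n by (simp add: add_def mod_2_eq_odd less_2_cases_iff) auto

text \<open>Extended by the identity outside the group, so that \<open>g\<close> permutes all
  variable indices and acts on all of \<open>'k ratfun\<close>, not only on K(V).\<close>

definition trans :: "nat \<Rightarrow> nat \<Rightarrow> nat" where
  "trans g v = (if v < 2 * n then dih_mult n g v else v)"

lemma trans_trans: "g < 2 * n \<Longrightarrow> h < 2 * n \<Longrightarrow> trans g (trans h v) = trans (dih_mult n g h) v"
  by (simp add: trans_def mult_less mult_assoc)

lemma trans_0: "trans 0 = id"
  by (auto simp: trans_def mult_0_left)

end

section \<open>Invertible substitutions of the variables\<close>

definition sub :: "(nat \<Rightarrow> (nat \<Rightarrow>\<^sub>0 nat) \<Rightarrow>\<^sub>0 'k::field) \<Rightarrow> ((nat \<Rightarrow>\<^sub>0 nat) \<Rightarrow>\<^sub>0 'k) \<Rightarrow> ((nat \<Rightarrow>\<^sub>0 nat) \<Rightarrow>\<^sub>0 'k)" where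
  "sub = mpeval (single 0)"

definition pX :: "nat \<Rightarrow> (nat \<Rightarrow>\<^sub>0 nat) \<Rightarrow>\<^sub>0 'k::field" where
  "pX v = single (single v 1) 1"

lemma Xvar_pX: "Xvar v = Fract (pX v) 1"
  by (simp add: Xvar_def pX_def)

lemma field_hom_comp: "field_hom f \<Longrightarrow> field_hom g \<Longrightarrow> field_hom (\<lambda>x. g (f x))"
  by (simp add: field_hom_def rhom_def)

interpretation single0: rhom "single 0 :: 'k::field \<Rightarrow> (nat \<Rightarrow>\<^sub>0 nat) \<Rightarrow>\<^sub>0 'k"
  by (rule rhom_single)

interpretation sub: rhom "sub L"
  unfolding sub_def by (rule single0.rhom_mpeval)

lemma sub_pX [simp]: "sub L (pX v) = L v"
  by (simp add: sub_def pX_def)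

lemma sub_single_0 [simp]: "sub L (single 0 c) = single 0 c"
  by (simp add: sub_def)

lemma sub_sub: "sub L (sub M p) = sub (\<lambda>v. sub L (M v)) p"
proof -
  have "sub L (mpeval (single 0) M p) = mpeval (single 0) (\<lambda>v. sub L (M v)) p"
    by (simp add: sub.hom_mpeval[OF rhom_single])
  then show ?thesis by (simp add: sub_def)
qed

lemma sub_id: "sub pX p = p"
  unfolding sub_def pX_def[abs_def] by (rule mpeval_id)

definition Sub :: "(nat \<Rightarrow> (nat \<Rightarrow>\<^sub>0 nat) \<Rightarrow>\<^sub>0 'k::field) \<Rightarrow> 'k ratfun \<Rightarrow> 'k ratfun" where
  "Sub L = fext (\<lambda>p. Fract (sub L p) 1)"

text \<open>A left inverse makes the substitution injective, hence extendable to fractions.\<close>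

locale invertible_sub =
  fixes L L' :: "nat \<Rightarrow> (nat \<Rightarrow>\<^sub>0 nat) \<Rightarrow>\<^sub>0 'k::field"
  assumes inv: "sub L' (L v) = pX v"
begin

lemma sub_inverse: "sub L' (sub L p) = p"
  by (simp add: sub_sub inv sub_id)

lemma inj_rhom_Fract_sub: "inj_rhom (\<lambda>p. Fract (sub L p) 1)"
proof (intro inj_rhom.intro inj_rhom_axioms.intro)
  show "rhom (\<lambda>p. Fract (sub L p) 1)" by (rule rhom_comp[OF sub.rhom_axioms rhom_Fract])
  fix p assume "Fract (sub L p) 1 = 0"
  then have "sub L p = 0" by (simp add: Zero_fract_def Fract_inj)
  then show "p = 0" using sub_inverse[of p] by simp
qed

sublocale h: inj_rhom "\<lambda>p. Fract (sub L p) 1"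
  by (rule inj_rhom_Fract_sub)

lemma Sub_Fract: "b \<noteq> 0 \<Longrightarrow> Sub L (Fract a b) = Fract (sub L a) (sub L b)"
  unfolding Sub_def by (simp add: h.fext_Fract)

lemma field_hom_Sub: "field_hom (Sub L)"
  unfolding Sub_def by (rule h.fext.field_hom_axioms)

lemma Sub_constK: "Sub L (constK c) = constK c"
  by (simp add: constK_def Sub_Fract)

lemma Sub_Xvar: "Sub L (Xvar v) = Fract (L v) 1"
  by (simp add: Xvar_pX Sub_Fract)

end

lemma Sub_Sub:
  assumes "invertible_sub L L'" "invertible_sub M M'" "invertible_sub N N'" "\<And>v. sub L (M v) = N v"
  shows "Sub L (Sub M q) = Sub N q"
proof -
  interpret L: invertible_sub L L' by fact
  interpret M: invertible_sub M M' by fact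
  interpret N: invertible_sub N N' by fact
  show ?thesis
  proof (rule ratfun_hom_eqI[of "\<lambda>q. Sub L (Sub M q)" "Sub N"])
    show "field_hom (\<lambda>q. Sub L (Sub M q))"
      using M.field_hom_Sub L.field_hom_Sub by (rule field_hom_comp)
  qed (simp_all add: L.Sub_constK M.Sub_constK N.Sub_constK M.Sub_Xvar N.Sub_Xvar L.Sub_Fract assms(4) N.field_hom_Sub)
qed

context dih
begin

definition act :: "nat \<Rightarrow> 'k::field ratfun \<Rightarrow> 'k ratfun" where
  "act g = Sub (\<lambda>v. pX (trans g v))"

lemma trans_inverse:
  assumes "g < 2 * n"
  obtains h where "h < 2 * n" "\<And>v. trans h (trans g v) = v" "dih_mult n h g = 0"
  using left_inverse[OF assms] by (metis assms trans_trans trans_0 id_apply)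

lemma invertible_act:
  assumes "g < 2 * n"
  obtains M where "invertible_sub (\<lambda>v. pX (trans g v)) M"
proof -
  obtain h where "\<And>v. trans h (trans g v) = v" using trans_inverse[OF assms] by blast
  then have "invertible_sub (\<lambda>v. pX (trans g v)) (\<lambda>v. pX (trans h v) :: (nat \<Rightarrow>\<^sub>0 nat) \<Rightarrow>\<^sub>0 'k::field)"
    by unfold_locales simp
  with that show thesis .
qed

lemma field_hom_act: "g < 2 * n \<Longrightarrow> field_hom (act g)"
  unfolding act_def by (elim invertible_act) (rule invertible_sub.field_hom_Sub)

lemma act_constK: "g < 2 * n \<Longrightarrow> act g (constK c) = constK c"
  unfolding act_def by (elim invertible_act) (rule invertible_sub.Sub_constK)

lemma act_Xvar: "g < 2 * n \<Longrightarrow> act g (Xvar v) = Xvar (trans g v)"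
  unfolding act_def by (elim invertible_act) (drule invertible_sub.Sub_Xvar, simp add: Xvar_pX)

lemma act_0: "act 0 q = q"
proof -
  have "field_hom (\<lambda>q. q)" by unfold_locales auto
  from ratfun_hom_eqI[OF field_hom_act[of 0] this, of q] n show ?thesis
    by (simp add: act_constK act_Xvar trans_0)
qed

lemma act_act:
  assumes "g < 2 * n" "h < 2 * n"
  shows "act g (act h q) = act (dih_mult n g h) q"
proof (rule ratfun_hom_eqI[of "\<lambda>q. act g (act h q)"])
  show "field_hom (\<lambda>q. act g (act h q))"
    using field_hom_act[OF assms(2)] field_hom_act[OF assms(1)] by (rule field_hom_comp)
qed (use assms in \<open>simp_all add: field_hom_act mult_less act_constK act_Xvar trans_trans\<close>)

lemma act_inverse:
  assumes "g < 2 * n"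
  obtains h where "h < 2 * n" "\<And>q. act h (act g q) = q"
  using trans_inverse[OF assms] by (metis act_act act_0 assms)

text \<open>The description in \<open>gact\<close> ranges over all representations of
  \<open>q\<close> as a fraction; they give one value because each computes the homomorphism
  \<open>act g\<close>.\<close>

lemma gact_eq_act:
  assumes "g < 2 * n" "q \<in> KV {0..<2 * n}"
  shows "gact (dihedral n) g q = act g (q :: 'k::field ratfun)"
proof -
  interpret h: field_hom "act g" by (rule field_hom_act[OF assms(1)])
  have ev: "mpeval constK (\<lambda>v. Xvar (monoid.mult (dihedral n) g v)) p = act g (Fract p 1)"
    if "pvars p \<subseteq> carrier (dihedral n)" for p :: "(nat \<Rightarrow>\<^sub>0 nat) \<Rightarrow>\<^sub>0 'k"
  proof -
    have "act g (Fract p 1) = mpeval constK (\<lambda>v. Xvar (trans g v)) p"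
      using assms(1) by (simp add: Fract_one_conv_mpeval h.hom_mpeval rhom_constK act_constK act_Xvar)
    also have "\<dots> = mpeval constK (\<lambda>v. Xvar (monoid.mult (dihedral n) g v)) p"
      using that by (intro mpeval_cong) (auto simp: dihedral_def trans_def)
    finally show ?thesis ..
  qed
  have frac: "mpeval constK (\<lambda>v. Xvar (monoid.mult (dihedral n) g v)) a / mpeval constK (\<lambda>v. Xvar (monoid.mult (dihedral n) g v)) b = act g (Fract a b)"
    if "pvars a \<subseteq> carrier (dihedral n)" "pvars b \<subseteq> carrier (dihedral n)" for a b :: "(nat \<Rightarrow>\<^sub>0 nat) \<Rightarrow>\<^sub>0 'k"
    using that by (simp add: ev) (simp flip: h.hom_divide)
  obtain a b where ab: "q = Fract a b" "b \<noteq> 0" "pvars a \<subseteq> carrier (dihedral n)" "pvars b \<subseteq> carrier (dihedral n)"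
    using assms(2) by (auto simp: KV_def dihedral_def)
  show ?thesis
    unfolding gact_def
    by (rule the_equality) (use ab frac in metis, auto simp: frac)
qed

end

section \<open>Moebius transformations of finite order and Lucas sequences\<close>

fun lucas :: "'k::comm_ring_1 \<Rightarrow> 'k \<Rightarrow> nat \<Rightarrow> 'k" where
  "lucas T D 0 = 0"
| "lucas T D (Suc 0) = 1"
| "lucas T D (Suc (Suc k)) = T * lucas T D (Suc k) - D * lucas T D k"

text \<open>If \<open>r\<close> acts on \<open>t\<close> by a matrix \<open>R\<close> with trace \<open>T\<close> and determinant \<open>D\<close>, then
  \<open>R^k = u k R - D u (k - 1) I\<close> by Cayley--Hamilton, where \<open>u\<close> is the Lucas sequence.\<close>
lemma moebius_iterate:
  fixes r :: "'l::field \<Rightarrow> 'l" and \<kappa> :: "'k::field \<Rightarrow> 'l"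
  assumes "field_hom \<kappa>" "field_hom r" "\<And>c. r (\<kappa> c) = \<kappa> c"
    and "\<kappa> c * t + \<kappa> d \<noteq> 0" "r t * (\<kappa> c * t + \<kappa> d) = \<kappa> a * t + \<kappa> b"
  defines "T \<equiv> a + d" and "D \<equiv> a * d - b * c"
  shows "(r ^^ Suc k) t * (\<kappa> (lucas T D (Suc k)) * (\<kappa> c * t + \<kappa> d) - \<kappa> (D * lucas T D k)) =
         \<kappa> (lucas T D (Suc k)) * (\<kappa> a * t + \<kappa> b) - \<kappa> (D * lucas T D k) * t"
proof (induction k)
  case 0
  interpret field_hom \<kappa> by fact
  show ?case using assms(5) by simp
next
  case (Suc k)
  interpret \<kappa>: field_hom \<kappa> by fact
  interpret r: field_hom r by fact
  define u v where "u = \<kappa> (lucas T D (Suc k))" and "v = \<kappa> (D * lucas T D k)"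
  define h where "h = (r ^^ Suc (Suc k)) t"
  have u': "\<kappa> (lucas T D (Suc (Suc k))) = \<kappa> T * u - v" "\<kappa> (D * lucas T D (Suc k)) = \<kappa> D * u"
    by (simp_all add: u_def v_def)
  have "r (u * (\<kappa> c * t + \<kappa> d) - v) = u * (\<kappa> c * r t + \<kappa> d) - v"
    and "r (u * (\<kappa> a * t + \<kappa> b) - v * t) = u * (\<kappa> a * r t + \<kappa> b) - v * r t"
    by (simp_all add: u_def v_def assms(3) flip: \<kappa>.hom_mult)
  moreover have "(r ^^ Suc k) t * (u * (\<kappa> c * t + \<kappa> d) - v) = u * (\<kappa> a * t + \<kappa> b) - v * t"
    using Suc.IH by (simp only: u_def v_def)
  ultimately have *: "h * (u * (\<kappa> c * r t + \<kappa> d) - v) = u * (\<kappa> a * r t + \<kappa> b) - v * r t"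
    unfolding h_def funpow.simps(2) [of "Suc k"] o_def by (metis r.hom_mult)
  \<comment> \<open>Multiplying by the denominator of \<open>r t\<close> turns the claim into the
    matrix identity R^2 = T R - D I.\<close>
  define q where "q = \<kappa> c * t + \<kappa> d"
  have q: "r t * q = \<kappa> a * t + \<kappa> b" using assms(5) by (simp add: q_def)
  have den: "(u * (\<kappa> c * r t + \<kappa> d) - v) * q = (\<kappa> T * u - v) * (\<kappa> c * t + \<kappa> d) - \<kappa> D * u"
  proof -
    have "(u * (\<kappa> c * r t + \<kappa> d) - v) * q = u * (\<kappa> c * (r t * q) + \<kappa> d * q) - v * q" by (simp add: algebra_simps)
    also have "\<dots> = (\<kappa> T * u - v) * (\<kappa> c * t + \<kappa> d) - \<kappa> D * u"
      unfolding q by (simp add: q_def T_def D_def algebra_simps)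
    finally show ?thesis .
  qed
  have num: "(u * (\<kappa> a * r t + \<kappa> b) - v * r t) * q = (\<kappa> T * u - v) * (\<kappa> a * t + \<kappa> b) - \<kappa> D * u * t"
  proof -
    have "(u * (\<kappa> a * r t + \<kappa> b) - v * r t) * q = u * (\<kappa> a * (r t * q) + \<kappa> b * q) - v * (r t * q)" by (simp add: algebra_simps)
    also have "\<dots> = (\<kappa> T * u - v) * (\<kappa> a * t + \<kappa> b) - \<kappa> D * u * t"
      unfolding q by (simp add: q_def T_def D_def algebra_simps)
    finally show ?thesis .
  qed
  have "h * ((u * (\<kappa> c * r t + \<kappa> d) - v) * q) = (u * (\<kappa> a * r t + \<kappa> b) - v * r t) * q"
    using * by (simp add: mult.assoc[symmetric])
  then show ?case unfolding u' h_def[symmetric] den num .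
qed

lemma transc_quadratic:
  assumes "rhom \<kappa>" "transc \<kappa> t" "\<kappa> a + t * (\<kappa> b + t * \<kappa> c) = 0"
  shows "a = 0 \<and> b = 0 \<and> c = 0"
proof -
  have "pev \<kappa> t [:a, b, c:] = 0" using assms(1,3) by simp
  with assms(2) have "[:a, b, c:] = 0" unfolding transc_def by blast
  then show ?thesis by simp
qed

lemma transc_linear:
  assumes "rhom \<kappa>" "transc \<kappa> t" "\<kappa> a + t * \<kappa> b = 0"
  shows "a = 0 \<and> b = 0"
  using transc_quadratic[OF assms(1,2), of a b 0] assms by (simp add: rhom.hom_zero)

text \<open>The power is a combination of the nonscalar matrix R and the identity, so it is scalar
  exactly when the coefficient of R vanishes. The remaining scalar is then nonzero, because the
  determinant is nonzero and two consecutive Lucas values cannot both vanish.\<close>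

lemma moebius_power_fixes_iff:
  fixes r :: "'l::field \<Rightarrow> 'l" and \<kappa> :: "'k::field \<Rightarrow> 'l"
  assumes "field_hom \<kappa>" "field_hom r" "\<And>c. r (\<kappa> c) = \<kappa> c"
    and "\<kappa> c * t + \<kappa> d \<noteq> 0" "r t * (\<kappa> c * t + \<kappa> d) = \<kappa> a * t + \<kappa> b"
    and "transc \<kappa> t" "\<not> (c = 0 \<and> d = a \<and> b = 0)" "a * d - b * c \<noteq> 0"
  shows "(r ^^ Suc k) t = t \<longleftrightarrow> lucas (a + d) (a * d - b * c) (Suc k) = 0"
proof -
  interpret \<kappa>: field_hom \<kappa> by fact
  define T D where "T = a + d" and "D = a * d - b * c"
  have it: "(r ^^ Suc k) t * (\<kappa> (lucas T D (Suc k)) * (\<kappa> c * t + \<kappa> d) - \<kappa> (D * lucas T D k)) =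
         \<kappa> (lucas T D (Suc k)) * (\<kappa> a * t + \<kappa> b) - \<kappa> (D * lucas T D k) * t"
    unfolding T_def D_def by (rule moebius_iterate[OF assms(1-5)])
  have D: "D \<noteq> 0" using assms(8) by (simp add: D_def)
  have "(r ^^ Suc k) t = t \<longleftrightarrow> lucas T D (Suc k) = 0"
  proof
    assume "(r ^^ Suc k) t = t"
    from it[unfolded this] have eq: "\<kappa> (lucas T D (Suc k)) * (\<kappa> (- b) + t * (\<kappa> (d - a) + t * \<kappa> c)) = 0"
      by (simp add: algebra_simps)
    show "lucas T D (Suc k) = 0"
    proof (rule ccontr)
      assume "lucas T D (Suc k) \<noteq> 0"
      with eq have "\<kappa> (- b) + t * (\<kappa> (d - a) + t * \<kappa> c) = 0" by simp
      from transc_quadratic[OF \<kappa>.rhom_axioms assms(6) this] assms(7) show False by simp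
    qed
  next
    assume 0: "lucas T D (Suc k) = 0"
    have "lucas T D k \<noteq> 0"
    proof
      assume "lucas T D k = 0"
      with 0 show False
      proof (induction k)
        case (Suc k)
        then have "D * lucas T D k = 0" by simp
        with D Suc show False by simp
      qed simp
    qed
    with it 0 D show "(r ^^ Suc k) t = t" by simp
  qed
  then show ?thesis by (simp only: T_def D_def)
qed

lemma moebius_order_imp_lucas:
  fixes r :: "'l::field \<Rightarrow> 'l" and \<kappa> :: "'k::field \<Rightarrow> 'l"
  assumes "field_hom \<kappa>" "field_hom r" "\<And>c. r (\<kappa> c) = \<kappa> c"
    and "\<kappa> c * t + \<kappa> d \<noteq> 0" "r t * (\<kappa> c * t + \<kappa> d) = \<kappa> a * t + \<kappa> b"
    and "transc \<kappa> t" "n \<ge> 2" "(r ^^ n) t = t" "\<And>k. 0 < k \<Longrightarrow> k < n \<Longrightarrow> (r ^^ k) t \<noteq> t"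
  defines "T \<equiv> a + d" and "D \<equiv> a * d - b * c"
  shows "D \<noteq> 0 \<and> lucas T D n = 0 \<and> (\<forall>k. 0 < k \<and> k < n \<longrightarrow> lucas T D k \<noteq> 0)"
proof -
  interpret \<kappa>: field_hom \<kappa> by fact
  interpret r: field_hom r by fact
  have not_scalar: "\<not> (c = 0 \<and> d = a \<and> b = 0)"
  proof
    assume "c = 0 \<and> d = a \<and> b = 0"
    with assms(4,5) have "r t = t" by simp
    with assms(9)[of 1] assms(7) show False by simp
  qed
  have no_const: "r t \<noteq> \<kappa> e" for e
  proof
    assume rt: "r t = \<kappa> e"
    then have "r (t - \<kappa> e) = 0" by (simp add: assms(3))
    then have "t = \<kappa> e" by (simp only: r.hom_eq_0_iff) simp
    then have "\<kappa> (- e) + t * \<kappa> 1 = 0" by simp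
    from transc_linear[OF \<kappa>.rhom_axioms assms(6) this] show False by simp
  qed
  \<comment> \<open>A singular matrix would make \<open>r t\<close> constant, which is impossible
    for an injective map fixing K and a transcendental \<open>t\<close>.\<close>
  have D: "D \<noteq> 0"
  proof
    assume "D = 0"
    then have D0: "a * d = b * c" by (simp add: D_def)
    show False
    proof (cases "c = 0")
      case True
      with assms(4) have "d \<noteq> 0" by auto
      with D0 True have "a = 0" by simp
      with True assms(5) \<open>d \<noteq> 0\<close> have "r t = \<kappa> (b / d)" by (simp add: field_simps)
      with no_const show False by blast
    next
      case False
      have "\<kappa> c * (\<kappa> a * t + \<kappa> b) = \<kappa> a * (\<kappa> c * t + \<kappa> d)"
        using arg_cong[OF D0, of \<kappa>] by (simp add: algebra_simps)
      then have "\<kappa> c * r t * (\<kappa> c * t + \<kappa> d) = \<kappa> a * (\<kappa> c * t + \<kappa> d)"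
        using assms(5) by (simp add: mult.assoc)
      then have "\<kappa> c * r t = \<kappa> a" using assms(4) by simp
      with False have "r t = \<kappa> (a / c)" by (simp add: field_simps)
      with no_const show False by blast
    qed
  qed
  have step: "(r ^^ Suc k) t = t \<longleftrightarrow> lucas T D (Suc k) = 0" for k
    unfolding T_def D_def
    by (rule moebius_power_fixes_iff[OF assms(1-6) not_scalar D[unfolded D_def]])
  show ?thesis
  proof (intro conjI allI impI)
    show "D \<noteq> 0" by (rule D)
    show "lucas T D n = 0" using step[of "n - 1"] assms(7,8) by simp
    fix k assume "0 < k \<and> k < n"
    then show "lucas T D k \<noteq> 0" using step[of "k - 1"] assms(9)[of k] by simp
  qed
qed

section \<open>Eigenvalues and the zeros of the Lucas sequence\<close>

lemma quadratic_roots: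
  fixes T D :: "'k::field"
  obtains x y where "x + y = to_ac T" "x * y = to_ac D"
proof -
  have "\<exists>x. poly [:to_ac D, - to_ac T, 1:] x = 0"
    by (rule alg_closed_imp_poly_has_root) simp
  then obtain x where "poly [:to_ac D, - to_ac T, 1:] x = 0" by blast
  then have "x * (to_ac T - x) = to_ac D" by (simp add: algebra_simps)
  then show thesis by (intro that[of x "to_ac T - x"]) simp
qed

text \<open>Binet's formula, kept free of division.\<close>

lemma lucas_roots:
  assumes "x + y = to_ac T" "x * y = to_ac D"
  shows "to_ac (lucas T D k) * (x - y) = x ^ k - y ^ k"
proof (induction k rule: induct_nat_012)
  case (ge2 k)
  have "to_ac (lucas T D (Suc (Suc k))) * (x - y) =
      (x + y) * (to_ac (lucas T D (Suc k)) * (x - y)) - (x * y) * (to_ac (lucas T D k) * (x - y))"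
    by (simp add: assms algebra_simps)
  also have "\<dots> = x ^ Suc (Suc k) - y ^ Suc (Suc k)"
    unfolding ge2 by (simp add: algebra_simps)
  finally show ?case .
qed auto

text \<open>Equal eigenvalues, where Binet's formula says nothing: the k-th value is k x^(k-1),
  multiplied here by \<open>x\<close> to avoid the exponent k - 1.\<close>

lemma lucas_double_root:
  assumes "x + x = to_ac T" "x * x = to_ac D"
  shows "to_ac (lucas T D k) * x = of_nat k * x ^ k"
proof (induction k rule: induct_nat_012)
  case (ge2 k)
  have "to_ac (lucas T D (Suc (Suc k))) * x =
      (x + x) * (to_ac (lucas T D (Suc k)) * x) - (x * x) * (to_ac (lucas T D k) * x)"
    by (simp add: assms algebra_simps)
  also have "\<dots> = of_nat (Suc (Suc k)) * x ^ Suc (Suc k)"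
    unfolding ge2 by (simp add: algebra_simps)
  finally show ?case .
qed auto

locale lucas_period =
  fixes T D :: "'k::field" and n :: nat
  assumes n: "n \<ge> 2" and D: "D \<noteq> 0" and period: "lucas T D n = 0"
    and minimal: "\<And>k. 0 < k \<Longrightarrow> k < n \<Longrightarrow> lucas T D k \<noteq> 0"
begin

lemma double_root_period:
  assumes "x + x = to_ac T" "x * x = to_ac D"
  shows "lucas T D k = 0 \<longleftrightarrow> CHAR('k) dvd k"
proof -
  have x: "x \<noteq> 0" using assms(2) D by auto
  have "lucas T D k = 0 \<longleftrightarrow> to_ac (lucas T D k) * x = 0" using x by simp
  also have "\<dots> \<longleftrightarrow> of_nat k * x ^ k = 0" using lucas_double_root[OF assms, of k] by simp
  also have "\<dots> \<longleftrightarrow> CHAR('k) dvd k"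
    using x of_nat_eq_0_iff_char_dvd[of k, where 'a = "'k alg_closure"] by simp
  finally show ?thesis .
qed

lemma distinct_roots_period:
  assumes "x + y = to_ac T" "x * y = to_ac D" "x \<noteq> y"
  shows "lucas T D k = 0 \<longleftrightarrow> (x / y) ^ k = 1"
proof -
  have y: "y \<noteq> 0" using assms(2) D by auto
  have "lucas T D k = 0 \<longleftrightarrow> to_ac (lucas T D k) * (x - y) = 0" using assms(3) by simp
  also have "\<dots> \<longleftrightarrow> x ^ k = y ^ k" using lucas_roots[OF assms(1,2), of k] by simp
  also have "\<dots> \<longleftrightarrow> (x / y) ^ k = 1" using y by (simp add: power_divide)
  finally show ?thesis .
qed

text \<open>\<zeta> is the quotient of the eigenvalues. They differ, since for equal ones the
  characteristic divides the index of every zero. The sum \<zeta> + 1/\<zeta> equals T^2/D - 2 and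
  so lies in K.\<close>

lemma zeta_sum_in:
  assumes "\<not> CHAR('k) dvd n"
  shows "zeta_sum_in TYPE('k) n"
proof -
  obtain x y where xy: "x + y = to_ac T" "x * y = to_ac D" by (rule quadratic_roots)
  have nz: "x \<noteq> 0" "y \<noteq> 0" using xy(2) D by auto
  have neq: "x \<noteq> y" using double_root_period[of x n] xy assms period by auto
  define z where "z = x / y"
  note per = distinct_roots_period[OF xy neq, folded z_def]
  have "primitive_root_of_unity n z"
    unfolding primitive_root_of_unity_def using per period minimal by blast
  moreover have "z + inverse z = to_ac (T ^ 2 / D - 2)"
  proof -
    have *: "z * (x * y) = x * x" "inverse z * (x * y) = y * y" using nz by (simp_all add: z_def)
    have "(z + inverse z) * (x * y) = (x + y) ^ 2 - 2 * (x * y)"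
      unfolding distrib_right * by (simp add: power2_eq_square algebra_simps)
    then have "z + inverse z = ((x + y) ^ 2 - 2 * (x * y)) / (x * y)"
      using nz by (simp add: nonzero_eq_divide_eq)
    also have "\<dots> = (x + y) ^ 2 / (x * y) - 2" using nz by (simp add: diff_divide_distrib)
    finally show ?thesis by (simp add: xy)
  qed
  ultimately show ?thesis unfolding zeta_sum_in_def by blast
qed

text \<open>If the eigenvalues differ, their quotient has n-th power 1, and injectivity of Frobenius
  gives the same for the exponent n/p, against minimality. So they coincide, and then the first zero
  is at p.\<close>

lemma eq_char:
  assumes "CHAR('k) > 0" "CHAR('k) dvd n"
  shows "n = CHAR('k)"
proof -
  define p where "p = CHAR('k)"
  have prime: "prime p" using prime_CHAR_semidom[OF assms(1)] by (simp add: p_def)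
  obtain x y where xy: "x + y = to_ac T" "x * y = to_ac D" by (rule quadratic_roots)
  have "x = y"
  proof (rule ccontr)
    assume neq: "x \<noteq> y"
    define z where "z = x / y"
    note per = distinct_roots_period[OF xy neq, folded z_def]
    from assms(2) obtain m where m: "n = p * m" unfolding p_def by (rule dvdE)
    have "m > 0" using n m by (cases m) simp_all
    with prime_gt_1_nat[OF prime] have "m < n" by (simp add: m)
    define w where "w = z ^ m - 1"
    have "(w + 1) ^ p = w ^ p + 1 ^ p"
      using prime by (intro freshmans_dream) (simp_all add: p_def)
    moreover have "(w + 1) ^ p = 1"
      using per[of n] period by (simp add: w_def m mult.commute flip: power_mult)
    ultimately have "w ^ p = 0" by simp
    then have "z ^ m = 1" by (simp add: w_def)
    with per[of m] minimal[OF \<open>m > 0\<close> \<open>m < n\<close>] show False by simp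
  qed
  with double_root_period[of x p] xy have "lucas T D p = 0" by (simp add: p_def)
  then have "\<not> p < n" using minimal[of p] prime_gt_0_nat[OF prime] by blast
  moreover have "p \<le> n" using assms(2) n by (simp add: p_def dvd_imp_le)
  ultimately show ?thesis by (simp add: p_def)
qed

end

text \<open>Take eigenvalues \<zeta> and 1/\<zeta>. The k-th value vanishes iff \<zeta>^(2k) = 1,
  which for odd \<open>n\<close> means that \<open>n\<close> divides \<open>k\<close>. The value at
  \<open>n - 1\<close> follows from \<zeta>^(n-1) = 1/\<zeta>.\<close>

lemma lucas_of_zeta_sum:
  assumes "zeta_sum_in TYPE('k::field) n" "odd n" "n \<ge> 2"
  obtains T :: "'k::field" where "lucas T 1 n = 0" "lucas T 1 (n - 1) = - 1" "\<And>k. 0 < k \<Longrightarrow> k < n \<Longrightarrow> lucas T 1 k \<noteq> 0"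
proof -
  from assms(1) obtain z :: "'k alg_closure" and T :: 'k where z: "z ^ n = 1" "\<And>k. 0 < k \<Longrightarrow> k < n \<Longrightarrow> z ^ k \<noteq> 1"
    and T: "z + inverse z = to_ac T" by (auto simp: zeta_sum_in_def primitive_root_of_unity_def)
  have "z \<noteq> 0" using z(1) assms(3) by (auto simp: power_0_left)
  then have D: "z * inverse z = to_ac 1" by simp
  have order: "z ^ k = 1 \<longleftrightarrow> n dvd k" for k
  proof
    assume "z ^ k = 1"
    have "z ^ k = (z ^ n) ^ (k div n) * z ^ (k mod n)" by (simp flip: power_mult power_add)
    with \<open>z ^ k = 1\<close> have "z ^ (k mod n) = 1" by (simp add: z(1))
    with z(2)[of "k mod n"] assms(3) have "k mod n = 0" by fastforce
    then show "n dvd k" by auto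
  qed (auto simp: power_mult z(1))
  have diff: "z ^ k = inverse z ^ k \<longleftrightarrow> n dvd k" for k
  proof -
    have "z ^ k = inverse z ^ k \<longleftrightarrow> z ^ (k * 2) = 1"
      using \<open>z \<noteq> 0\<close> by (simp add: power_mult power2_eq_square power_inverse field_simps)
    also have "\<dots> \<longleftrightarrow> n dvd k"
      using assms(2) by (simp add: order coprime_dvd_mult_left_iff)
    finally show ?thesis .
  qed
  have neq: "z - inverse z \<noteq> 0" using diff[of 1] assms(3) by auto
  note roots = lucas_roots[OF T D]
  have zero: "lucas T 1 k = 0 \<longleftrightarrow> n dvd k" for k
    using roots[of k] diff[of k] neq by (metis mult_eq_0_iff right_minus_eq to_ac_eq_0_iff')
  have "inverse z ^ n = 1" using z(1) by (simp add: power_inverse)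
  then have "z ^ (n - 1) = inverse z" "inverse z ^ (n - 1) = z"
    using z(1) \<open>z \<noteq> 0\<close> assms(3) by (simp_all add: power_diff inverse_eq_divide)
  with roots[of "n - 1"] have "to_ac (lucas T 1 (n - 1)) * (z - inverse z) = - 1 * (z - inverse z)" by simp
  then have "to_ac (lucas T 1 (n - 1)) = to_ac (- 1)" by (simp only: mult_right_cancel[OF neq] to_ac_minus to_ac_1)
  then have "lucas T 1 (n - 1) = - 1" by (simp only: to_ac_eq_iff)
  then show thesis using that[of T] zero by (metis dvd_refl dvd_imp_le not_le)
qed

text \<open>Trace 2 and determinant 1 belong to a nontrivial unipotent matrix, which has order p in
  characteristic p; this provides the case n = p.\<close>

lemma lucas_2_1: "lucas 2 1 k = (of_nat k :: 'k::comm_ring_1)"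
  by (induction k rule: induct_nat_012) (auto simp: algebra_simps)

section \<open>Necessity\<close>

lemma gen_mono: "field_hom \<kappa> \<Longrightarrow> t \<in> gen \<kappa> u \<Longrightarrow> gen \<kappa> t \<subseteq> gen \<kappa> u"
  using subfld.gen_subset[of \<kappa> "gen \<kappa> u" t] subfield_over_gen[of \<kappa> u]
  by (auto simp: subfld_def subfld_axioms_def)

lemma hom_gen:
  assumes "field_hom \<kappa>" "field_hom h" "\<And>c. h (\<kappa> c) = \<kappa> c" "x \<in> gen \<kappa> t"
  shows "h x \<in> gen \<kappa> (h t)"
proof -
  interpret \<kappa>: field_hom \<kappa> by fact
  interpret h: field_hom h by fact
  have pev: "h (pev \<kappa> t A) = pev \<kappa> (h t) A" for A
    by (simp add: h.hom_pev \<kappa>.rhom_axioms assms(3))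
  obtain A B where AB: "x = pev \<kappa> t A / pev \<kappa> t B" "pev \<kappa> t B \<noteq> 0" using assms(4) by (auto simp: gen_def)
  show ?thesis
  proof (rule genI)
    show "h x = pev \<kappa> (h t) A / pev \<kappa> (h t) B" by (simp add: AB(1) pev)
    show "pev \<kappa> (h t) B \<noteq> 0" using AB(2) by (simp flip: pev)
  qed
qed

lemma gen_diff_const:
  assumes "field_hom \<kappa>"
  shows "gen \<kappa> (t - \<kappa> c) = gen \<kappa> t"
proof -
  have sub: "subfld \<kappa> (gen \<kappa> u)" for u
    using assms subfield_over_gen[OF assms] by (auto simp: subfld_def subfld_axioms_def)
  have self: "u \<in> gen \<kappa> u" for u using assms by (auto intro: gen_self simp: field_hom_def)
  have "t - \<kappa> c \<in> gen \<kappa> t"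
    by (intro subfld.diff_in[OF sub] self subfld.const_in[OF sub])
  moreover have "(t - \<kappa> c) + \<kappa> c \<in> gen \<kappa> (t - \<kappa> c)"
    by (intro subfld.add_in[OF sub] self subfld.const_in[OF sub])
  then have "t \<in> gen \<kappa> (t - \<kappa> c)" by simp
  ultimately show ?thesis using assms by (intro equalityI gen_mono)
qed

lemma gen_inverse:
  assumes "field_hom \<kappa>"
  shows "gen \<kappa> (inverse t) = gen \<kappa> t"
proof -
  have sub: "subfld \<kappa> (gen \<kappa> u)" for u
    using assms subfield_over_gen[OF assms] by (auto simp: subfld_def subfld_axioms_def)
  have self: "u \<in> gen \<kappa> u" for u using assms by (auto intro: gen_self simp: field_hom_def)
  have "inverse u \<in> gen \<kappa> u" for u by (intro subfld.inverse_in[OF sub] self)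
  from this[of t] this[of "inverse t"] show ?thesis using assms by (intro equalityI gen_mono) simp_all
qed

context dih
begin

text \<open>Stability and faithfulness of K(t), expressed on the generator alone; containment in
  K(V) is a separate condition.\<close>

definition faithful_generator :: "'k::field ratfun \<Rightarrow> bool" where
  "faithful_generator t \<longleftrightarrow> t \<notin> range constK \<and>
     (\<forall>g<2 * n. act g t \<in> gen constK t \<and> (0 < g \<longrightarrow> act g t \<noteq> t))"

text \<open>Allows \<open>t\<close> to be replaced by t - c or 1/t when its residue at a place is to
  be moved to 0.\<close>

lemma faithful_generator_cong:
  assumes "gen constK t = gen constK u" "faithful_generator t"
  shows "faithful_generator u"
proof -
  have self: "x \<in> gen constK x" for x :: "'a ratfun" by (rule gen_self[OF rhom_constK])
  have stays: "act g x = x" if "x \<in> gen constK y" "act g y = y" "g < 2 * n" for x y :: "'a ratfun" and g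
  proof -
    interpret h: field_hom "act g" by (rule field_hom_act) fact
    from that show ?thesis by (auto simp: gen_def h.hom_pev rhom_constK act_constK)
  qed
  have maps: "act g x \<in> gen constK t" if "x \<in> gen constK t" "g < 2 * n" for x g
  proof -
    have "act g x \<in> gen constK (act g t)"
      using hom_gen[OF field_hom_constK field_hom_act act_constK] that by blast
    also have "gen constK (act g t) \<subseteq> gen constK t"
      using assms(2) that(2) by (intro gen_mono field_hom_constK) (auto simp: faithful_generator_def)
    finally show ?thesis .
  qed
  have "u \<notin> range constK"
  proof
    assume "u \<in> range constK"
    then have "gen constK u \<subseteq> range constK"
      by (intro subfld.gen_subset) (auto simp: subfld_def subfld_axioms_def field_hom_constK subfield_over_def 
          simp flip: constK.hom_add constK.hom_mult constK.hom_uminus constK.hom_inverse)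
    with self[of t] assms show False by (auto simp: faithful_generator_def)
  qed
  moreover have "act g u \<in> gen constK u" if "g < 2 * n" for g
    using maps[of u g] self[of u] that assms(1) by simp
  moreover have "act g u \<noteq> u" if "g < 2 * n" "0 < g" for g
    using stays[of t u g] self[of t] that assms by (auto simp: faithful_generator_def)
  ultimately show ?thesis by (simp add: faithful_generator_def)
qed

text \<open>The inverse element sends \<open>t\<close> into K(t); applying \<open>g\<close> gives
  \<open>t\<close> in K(g t). So each of \<open>t\<close> and its image generates the other.\<close>

lemma generator_moebius:
  assumes "faithful_generator (t :: 'k::field ratfun)" "g < 2 * n"
  obtains a b c d where "constK c * t + constK d \<noteq> 0" "act g t * (constK c * t + constK d) = constK a * t + constK b"
proof -
  obtain h where h: "h < 2 * n" "\<And>q :: 'k ratfun. act h (act g q) = q" using act_inverse[OF assms(2)] by blast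
  \<comment> \<open>Only left inverses are at hand; the inverse of the inverse shows that
    \<open>h\<close> inverts \<open>g\<close> on the other side too.\<close>
  obtain h' where h': "h' < 2 * n" "\<And>q :: 'k ratfun. act h' (act h q) = q" using act_inverse[OF h(1)] by blast
  have gh: "act g (act h q) = q" for q :: "'k ratfun"
    using h(2)[of "act h q"] h'(2) by metis
  have "act h t \<in> gen constK t" using assms(1) h(1) by (simp add: faithful_generator_def)
  then have "act g (act h t) \<in> gen constK (act g t)"
    using hom_gen[OF field_hom_constK field_hom_act act_constK] assms(2) by blast
  then have "t \<in> gen constK (act g t)" by (simp add: gh)
  moreover have "act g t \<in> gen constK t" "transc constK t"
    using assms by (auto simp: faithful_generator_def transc_constK)
  ultimately show thesis using moebius_of_generator[OF field_hom_constK] that by metis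
qed

lemma faithful_subfield_generator:
  assumes "n \<ge> 2" "faithful_G_subfield (dihedral n) (E :: 'k::field ratfun set)" "trdeg_K E \<le> 1"
  obtains t :: "'k::field ratfun" where "t \<in> E" "faithful_generator t"
proof -
  have carrier: "carrier (dihedral n) = {0..<2 * n}" "monoid.one (dihedral n) = 0"
    by (simp_all add: dihedral_def)
  have E: "E \<subseteq> KV {0..<2 * n}" "is_K_subfield E"
    and stable: "\<And>g x. g < 2 * n \<Longrightarrow> x \<in> E \<Longrightarrow> gact (dihedral n) g x \<in> E"
    and trivial: "\<And>g. g < 2 * n \<Longrightarrow> \<forall>x\<in>E. gact (dihedral n) g x = x \<Longrightarrow> g = 0"
    using assms(2) unfolding faithful_G_subfield_def carrier by auto
  have closed: "act g x \<in> E" if "g < 2 * n" "x \<in> E" for g x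
    using stable[OF that] by (simp only: gact_eq_act[OF that(1) subsetD[OF E(1) that(2)]])
  have faithful: "g = 0" if "g < 2 * n" "\<And>x. x \<in> E \<Longrightarrow> act g x = x" for g
  proof -
    have "\<forall>x\<in>E. gact (dihedral n) g x = x" using gact_eq_act[OF that(1) subsetD[OF E(1)]] that(2) by simp
    then show ?thesis by (rule trivial[OF that(1)])
  qed
  have "\<not> E \<subseteq> range constK"
  proof
    assume "E \<subseteq> range constK"
    then have "act 1 x = x" if "x \<in> E" for x using that assms(1) act_constK[of 1] by auto
    with faithful[of 1] assms(1) show False by simp
  qed
  then obtain t where t: "t \<in> E" "t \<notin> range constK" "E = gen constK t"
    using trdeg_1_imp_generator[OF E(2) _ assms(3)] by blast
  have "act g t \<noteq> t" if "g < 2 * n" "0 < g" for g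
  proof
    assume fix_t: "act g t = t"
    interpret h: field_hom "act g" by (rule field_hom_act) fact
    have "act g x = x" if "x \<in> E" for x
      using that \<open>g < 2 * n\<close> fix_t unfolding t(3) by (auto simp: gen_def h.hom_pev rhom_constK act_constK)
    with faithful[OF that(1)] that(2) show False by simp
  qed
  then have "faithful_generator t"
    using t(2) closed t(1) unfolding faithful_generator_def t(3)[symmetric] by blast
  with t(1) show thesis by (rule that)
qed

lemma rotation_power:
  assumes "n \<ge> 2"
  shows "(act 1 ^^ k) q = act (k mod n) q"
proof (induction k)
  case 0
  show ?case by (simp add: act_0)
next
  case (Suc k)
  have k: "k mod n < n" using n by simp
  have "dih_mult n 1 (k mod n + n * 0) = (1 + k mod n) mod n + n * 0"
    using assms k by (intro mult_rotation) auto
  then have "act 1 (act (k mod n) q) = act (Suc k mod n) q"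
    using act_act[of 1 "k mod n" q] assms k by (simp add: mod_Suc_eq)
  then show ?case by (simp add: Suc del: One_nat_def)
qed

lemma lucas_period_of_generator:
  assumes "n \<ge> 2" "faithful_generator (t :: 'k::field ratfun)"
  obtains T D :: "'k::field" where "lucas_period T D n"
proof -
  have 1: "1 < 2 * n" using assms by simp
  obtain a b c d where m: "constK c * t + constK d \<noteq> 0" "act 1 t * (constK c * t + constK d) = constK a * t + constK b"
    by (rule generator_moebius[OF assms(2) 1])
  have "transc constK t" using assms(2) by (simp add: faithful_generator_def transc_constK)
  moreover have "(act 1 ^^ n) t = t" using rotation_power[OF assms(1), of n t] by (simp add: act_0)
  moreover have "(act 1 ^^ k) t \<noteq> t" if "0 < k" "k < n" for k
    using rotation_power[OF assms(1), of k t] that assms(2) by (simp add: faithful_generator_def)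
  ultimately have "a * d - b * c \<noteq> 0 \<and> lucas (a + d) (a * d - b * c) n = 0 \<and>
      (\<forall>k. 0 < k \<and> k < n \<longrightarrow> lucas (a + d) (a * d - b * c) k \<noteq> 0)"
    by (intro moebius_order_imp_lucas[OF field_hom_constK field_hom_act[OF 1] act_constK[OF 1] m] assms(1)) auto
  then have "lucas_period (a + d) (a * d - b * c) n"
    using assms(1) by (auto simp: lucas_period_def)
  then show thesis by (rule that)
qed

end

text \<open>An involution with multiplier 1 at the fixed point \<open>u = 0\<close> is trivial in characteristic not 2, and one of
  \<open>\<sigma>\<close>, \<open>\<tau>\<close>, \<open>\<sigma>\<tau>\<close> has multiplier 1.\<close>
lemma (in place) no_klein_four:
  fixes \<kappa> :: "'f \<Rightarrow> 'l"
  assumes "field_hom \<kappa>" and \<kappa>: "\<And>c. R (\<kappa> c) c" and "(2::'f) \<noteq> 0"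
    and "field_hom \<sigma>" "field_hom \<tau>" "\<And>c. \<sigma> (\<kappa> c) = \<kappa> c" "\<And>c. \<tau> (\<kappa> c) = \<kappa> c"
    and inv: "\<sigma> (\<sigma> u) = u" "\<tau> (\<tau> u) = u" "\<sigma> (\<tau> (\<sigma> (\<tau> u))) = u"
    and u: "R u 0" "u \<noteq> 0"
    and sign: "\<exists>\<eta>. (\<eta> = 1 \<or> \<eta> = -1) \<and> R (\<sigma> u / u) \<eta>" "\<exists>\<eta>. (\<eta> = 1 \<or> \<eta> = -1) \<and> R (\<tau> u / u) \<eta>"
    and moebius: "\<kappa> c1 * u + \<kappa> d1 \<noteq> 0" "\<sigma> u * (\<kappa> c1 * u + \<kappa> d1) = \<kappa> a1 * u + \<kappa> b1"
      "\<kappa> c2 * u + \<kappa> d2 \<noteq> 0" "\<tau> u * (\<kappa> c2 * u + \<kappa> d2) = \<kappa> a2 * u + \<kappa> b2"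
  shows "\<sigma> u = u \<or> \<tau> u = u \<or> \<sigma> (\<tau> u) = u"
proof -
  interpret \<kappa>: field_hom \<kappa> by fact
  have two: "(2::'l) \<noteq> 0"
  proof
    assume "(2::'l) = 0"
    moreover have "\<kappa> (1 + 1) = 1 + 1" by (simp only: \<kappa>.hom_add \<kappa>.hom_one)
    ultimately have "\<kappa> 2 = 0" by simp
    with assms(3) show False by (simp only: \<kappa>.hom_eq_0_iff)
  qed
  \<comment> \<open>The fixed point u = 0 forces \<open>b = 0\<close>, and the residue of
    \<open>h u / u\<close> is the multiplier a/d. Dividing by \<open>d\<close> leaves h u equal to u
    or -u over e u + 1.\<close>
  have norm: "\<exists>e. h u * (\<kappa> e * u + 1) = u \<or> h u * (\<kappa> e * u + 1) = - u"
    if h: "field_hom h" "\<exists>\<eta>. (\<eta> = 1 \<or> \<eta> = -1) \<and> R (h u / u) \<eta>" 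
      and m: "\<kappa> c * u + \<kappa> d \<noteq> 0" "h u * (\<kappa> c * u + \<kappa> d) = \<kappa> a * u + \<kappa> b" for h a b c d
  proof -
    interpret h: field_hom h by fact
    obtain \<eta> where \<eta>: "\<eta> = 1 \<or> \<eta> = -1" "R (h u / u) \<eta>" using h(2) by blast
    have den: "R (\<kappa> c * u + \<kappa> d) d" using add[OF mult[OF \<kappa>[of c] u(1)] \<kappa>[of d]] by simp
    have "R (h u) 0" using mult[OF \<eta>(2) u(1)] u(2) by simp
    from mult[OF this den] have "R (\<kappa> a * u + \<kappa> b) 0" by (simp add: m(2))
    moreover have "R (\<kappa> a * u + \<kappa> b) b" using add[OF mult[OF \<kappa>[of a] u(1)] \<kappa>[of b]] by simp
    ultimately have b: "b = 0" using unique by blast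
    have "h u / u * (\<kappa> c * u + \<kappa> d) = \<kappa> a" using m(2) u(2) b by simp
    with mult[OF \<eta>(2) den] \<kappa>[of a] unique have a: "a = \<eta> * d" by metis
    have d: "d \<noteq> 0"
    proof
      assume "d = 0"
      with a b m(2) have "h u * (\<kappa> c * u + \<kappa> d) = 0" by simp
      with m(1) u(2) show False by simp
    qed
    have "h u * (\<kappa> (c / d) * u + 1) = h u * (\<kappa> c * u + \<kappa> d) / \<kappa> d" using d by (simp add: field_simps)
    also have "\<dots> = \<kappa> \<eta> * u" using d by (simp add: m(2) a b)
    finally have eq: "h u * (\<kappa> (c / d) * u + 1) = \<kappa> \<eta> * u" .
    have "\<kappa> \<eta> * u = u \<or> \<kappa> \<eta> * u = - u" using \<eta>(1) by auto
    then show ?thesis unfolding eq[symmetric] by (rule exI)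
  qed
  \<comment> \<open>Applying \<open>h\<close> to the relation exchanges \<open>u\<close> and
    \<open>h u\<close>; the difference of the two relations is 2 (h u - u) = 0.\<close>
  have trivial: "h u = u" if "h u * (\<kappa> e * u + 1) = u" "field_hom h" "h (\<kappa> e) = \<kappa> e" "h (h u) = u" for h e
  proof -
    interpret h: field_hom h by fact
    have "h (h u * (\<kappa> e * u + 1)) = h u" using that(1) by simp
    then have "u * (\<kappa> e * h u + 1) = h u" using that(3,4) by simp
    with that(1) have "h u + \<kappa> e * u * h u = u" "u + \<kappa> e * u * h u = h u" by (simp_all add: algebra_simps)
    then have "\<kappa> e * u * h u = u - h u" "\<kappa> e * u * h u = h u - u"
      by (metis add_diff_cancel_left')+
    then have "(h u - u) + (h u - u) = (h u - u) + (u - h u)" by simp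
    then have "2 * (h u - u) = 0" by (simp only: mult_2) simp
    then have "h u - u = 0" using two by (simp only: mult_eq_0_iff simp_thms)
    then show ?thesis by simp
  qed
  obtain e1 where e1: "\<sigma> u * (\<kappa> e1 * u + 1) = u \<or> \<sigma> u * (\<kappa> e1 * u + 1) = - u"
    using norm[OF assms(4) sign(1) moebius(1,2)] by blast
  obtain e2 where e2: "\<tau> u * (\<kappa> e2 * u + 1) = u \<or> \<tau> u * (\<kappa> e2 * u + 1) = - u"
    using norm[OF assms(5) sign(2) moebius(3,4)] by blast
  show ?thesis
  proof (cases "\<sigma> u * (\<kappa> e1 * u + 1) = u \<or> \<tau> u * (\<kappa> e2 * u + 1) = u")
    case True
    then show ?thesis using trivial[of \<sigma> e1] trivial[of \<tau> e2] assms(4-7) inv by blast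
  next
    case False
    \<comment> \<open>Both multipliers are -1, so the composite has multiplier 1 and the criterion
      above applies to it.\<close>
    with e1 e2 have 1: "\<sigma> u * (\<kappa> e1 * u + 1) = - u" and 2: "\<tau> u * (\<kappa> e2 * u + 1) = - u" by auto
    interpret \<sigma>: field_hom \<sigma> by fact
    have "\<sigma> (\<tau> u * (\<kappa> e2 * u + 1)) = - \<sigma> u" by (simp add: 2)
    then have "\<sigma> (\<tau> u) * (\<kappa> e2 * \<sigma> u + 1) = - \<sigma> u" by (simp add: assms(6))
    then have "\<sigma> (\<tau> u) * (\<kappa> e2 * (\<sigma> u * (\<kappa> e1 * u + 1)) + (\<kappa> e1 * u + 1)) = - (\<sigma> u * (\<kappa> e1 * u + 1))"
      by (metis (no_types, lifting) distrib_right mult.assoc mult.left_neutral mult_minus_left)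
    then have "\<sigma> (\<tau> u) * (\<kappa> (e1 - e2) * u + 1) = u" unfolding 1 by (simp add: algebra_simps)
    moreover have "field_hom (\<lambda>x. \<sigma> (\<tau> x))" using assms(5,4) by (rule field_hom_comp)
    ultimately have "\<sigma> (\<tau> u) = u"
      using assms(6,7) inv(3) by (intro trivial[of "\<lambda>x. \<sigma> (\<tau> x)" "e1 - e2"]) (simp_all del: \<kappa>.hom_diff)
    then show ?thesis by simp
  qed
qed

text \<open>A diagonal substitution keeps the monomials and multiplies each coefficient by a sign,
  so \<open>u\<close> and its image have the same lowest monomials in numerator and
  denominator.\<close>

lemma low_place_diagonal:
  fixes \<epsilon> :: "nat \<Rightarrow> 'k::field"
  assumes \<epsilon>: "\<And>v. \<epsilon> v = 1 \<or> \<epsilon> v = - 1" and "u \<noteq> 0"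
  defines "L \<equiv> \<lambda>v. single 0 (\<epsilon> v) * pX v"
  shows "\<exists>\<eta>. (\<eta> = 1 \<or> \<eta> = - 1) \<and> low_place (Sub L u / u) \<eta>"
proof -
  let ?l = "lookup" and ?K = "keys"
  have sq: "\<epsilon> v * \<epsilon> v = 1" for v using \<epsilon>[of v] by auto
  interpret invertible_sub L L
  proof
    show "sub L (L v) = pX v" for v
      by (simp add: L_def mult.assoc[symmetric] mult_single sq)
  qed
  define e where "e m = monom_eval \<epsilon> m" for m
  have e: "e m = 1 \<or> e m = - 1" for m
  proof -
    have "(\<Prod>v\<in>A. \<epsilon> v ^ ?l m v) = 1 \<or> (\<Prod>v\<in>A. \<epsilon> v ^ ?l m v) = - 1" for A
    proof (induction A rule: infinite_finite_induct)
      case (insert v A)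
      have "\<epsilon> v ^ ?l m v = 1 \<or> \<epsilon> v ^ ?l m v = - 1"
        using \<epsilon>[of v] by (cases "even (?l m v)") auto
      with insert show ?case by auto
    qed auto
    then show ?thesis by (simp add: e_def monom_eval_def)
  qed
  have mono: "monom_eval L m = single m (e m)" for m
  proof -
    let ?s = "\<lambda>v. single 0 (\<epsilon> v) :: (nat \<Rightarrow>\<^sub>0 nat) \<Rightarrow>\<^sub>0 'k"
    have "monom_eval L m = monom_eval ?s m * monom_eval pX m"
      by (simp add: monom_eval_def L_def power_mult_distrib prod.distrib)
    also have "monom_eval ?s m = single 0 (e m)"
      by (simp add: monom_eval_def e_def single0.hom_prod)
    also have "monom_eval pX m = single m 1"
      unfolding pX_def[abs_def] by (rule single_monom_conv[symmetric])
    finally show ?thesis by (simp add: mult_single)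
  qed
  have lookup: "?l (sub L a) m = e m * ?l a m" for a m
    by (induction a rule: mpoly_induct)
      (auto simp: sub_def single0.mpeval_single mono mult_single lookup_add lookup_single when_def algebra_simps)
  obtain a b where u: "u = Fract a b" "b \<noteq> 0" by (cases u)
  have "a \<noteq> 0" using assms(2) u by (auto simp: Zero_fract_def eq_fract)
  then obtain m where m: "?l a m \<noteq> 0" "\<forall>k\<in>?K a. m \<le> k" by (rule least_key)
  obtain m' where m': "?l b m' \<noteq> 0" "\<forall>k\<in>?K b. m' \<le> k" using u(2) by (rule least_key)
  have keys: "\<forall>k\<in>?K (sub L a). m \<le> k" "\<forall>k\<in>?K (sub L b). m' \<le> k"
    using m(2) m'(2) by (auto simp: in_keys_iff lookup)
  have quot: "Sub L u / u = Fract (sub L a * b) (sub L b * a)"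
    using u by (simp add: Sub_Fract)
  have 1: "?l (sub L a * b) (m + m') = e m * ?l a m * ?l b m'"
    using lookup_mult_least[OF keys(1) m'(2)] by (simp add: lookup)
  have 2: "?l (sub L b * a) (m + m') = e m' * ?l b m' * ?l a m"
    using lookup_mult_least[OF keys(2) m(2)] by (simp add: lookup add.commute)
  have "low_place (Sub L u / u) (e m / e m')"
    unfolding low_place_def
  proof (intro exI conjI)
    show "Sub L u / u = Fract (sub L a * b) (sub L b * a)" by (rule quot)
    show "?l (sub L b * a) (m + m') \<noteq> 0" using e[of m'] m m' by (auto simp: 2)
    show "\<forall>k\<in>?K (sub L a * b). m + m' \<le> k" by (rule keys_mult_least[OF keys(1) m'(2)])
    show "\<forall>k\<in>?K (sub L b * a). m + m' \<le> k"
      using keys_mult_least[OF keys(2) m(2)] by (simp add: add.commute)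
    show "e m / e m' = ?l (sub L a * b) (m + m') / ?l (sub L b * a) (m + m')"
      using m m' e[of m'] by (auto simp: 1 2)
  qed
  moreover have "e m / e m' = 1 \<or> e m / e m' = - 1" using e[of m] e[of m'] by auto
  ultimately show ?thesis by blast
qed

text \<open>Two commuting involutions of the variables are diagonalised by the character table of the Klein four-group;
  \<open>e1\<close>, \<open>e2\<close> label the elements of each free orbit.\<close>
locale klein_variables =
  fixes \<sigma> \<tau> :: "nat \<Rightarrow> nat" and V :: "nat set" and e1 e2 :: "nat \<Rightarrow> bool" and ty :: "'k::field itself"
  assumes two: "(2::'k) \<noteq> 0"
    and fixed: "v \<notin> V \<Longrightarrow> \<sigma> v = v" "v \<notin> V \<Longrightarrow> \<tau> v = v"
    and maps: "v \<in> V \<Longrightarrow> \<sigma> v \<in> V" "v \<in> V \<Longrightarrow> \<tau> v \<in> V"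
    and inv: "\<sigma> (\<sigma> v) = v" "\<tau> (\<tau> v) = v" "\<tau> (\<sigma> v) = \<sigma> (\<tau> v)"
    and label: "v \<in> V \<Longrightarrow> e1 (\<sigma> v) \<longleftrightarrow> \<not> e1 v" "v \<in> V \<Longrightarrow> e2 (\<sigma> v) \<longleftrightarrow> e2 v"
      "v \<in> V \<Longrightarrow> e1 (\<tau> v) \<longleftrightarrow> e1 v" "v \<in> V \<Longrightarrow> e2 (\<tau> v) \<longleftrightarrow> \<not> e2 v"
begin

text \<open>The value of the character labelled by \<open>v\<close> at the group element labelled by
  \<open>w\<close>.\<close>

definition s :: "nat \<Rightarrow> nat \<Rightarrow> (nat \<Rightarrow>\<^sub>0 nat) \<Rightarrow>\<^sub>0 'k" where
  "s v w = (if e1 v \<and> e1 w then - 1 else 1) * (if e2 v \<and> e2 w then - 1 else 1)"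

text \<open>The symmetric character table of the four-group has square 4, so the factor 1/2 makes
  this change of variables its own inverse.\<close>

definition Y :: "nat \<Rightarrow> (nat \<Rightarrow>\<^sub>0 nat) \<Rightarrow>\<^sub>0 'k" where
  "Y v = (if v \<in> V then single 0 (1 / 2) *
     (s v v * pX v + s v (\<sigma> v) * pX (\<sigma> v) + s v (\<tau> v) * pX (\<tau> v) + s v (\<sigma> (\<tau> v)) * pX (\<sigma> (\<tau> v))) else pX v)"

definition d\<sigma> :: "nat \<Rightarrow> 'k" where
  "d\<sigma> v = (if v \<in> V \<and> e1 v then - 1 else 1)"

definition d\<tau> :: "nat \<Rightarrow> 'k" where
  "d\<tau> v = (if v \<in> V \<and> e2 v then - 1 else 1)"

lemma \<tau>\<sigma>: "\<sigma> (\<tau> (\<sigma> v)) = \<tau> v" "\<tau> (\<sigma> (\<tau> v)) = \<sigma> v"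
  by (metis inv)+

lemma half: "single 0 (1 / 2) * (single 0 (1 / 2) * (4 * x)) = (x :: (nat \<Rightarrow>\<^sub>0 nat) \<Rightarrow>\<^sub>0 'k)"
proof -
  have "(4::'k) = 2 * 2" by simp
  then have "(1 / 2) * ((1 / 2) * 4) = (1 / 2) * (((1 / 2) * 2) * (2::'k))" by (simp only: mult.assoc)
  also have "\<dots> = 1" using two by simp
  finally have "(1 / 2) * ((1 / 2) * 4) = (1::'k)" .
  moreover have "single 0 (1 / 2) * (single 0 (1 / 2) * (4 * x)) =
     single 0 ((1 / 2) * ((1 / 2) * 4)) * x"
    by (simp only: single0.hom_mult single_numeral mult.assoc)
  ultimately show ?thesis by simp
qed

sublocale Y: invertible_sub Y Y
proof
  fix v
  show "sub Y (Y v) = pX v"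
  proof (cases "v \<in> V")
    case True
    have sub_s: "sub Y (s x y) = s x y" for x y by (simp add: s_def)
    have mem: "\<sigma> v \<in> V" "\<tau> v \<in> V" "\<sigma> (\<tau> v) \<in> V" using True maps by auto
    have lab: "e1 (\<sigma> v) \<longleftrightarrow> \<not> e1 v" "e2 (\<sigma> v) \<longleftrightarrow> e2 v" "e1 (\<tau> v) \<longleftrightarrow> e1 v" "e2 (\<tau> v) \<longleftrightarrow> \<not> e2 v"
      "e1 (\<sigma> (\<tau> v)) \<longleftrightarrow> \<not> e1 v" "e2 (\<sigma> (\<tau> v)) \<longleftrightarrow> \<not> e2 v"
      using label True mem by auto
    let ?c = "single 0 (1 / 2) :: (nat \<Rightarrow>\<^sub>0 nat) \<Rightarrow>\<^sub>0 'k"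
    define B where "B w = s w v * pX v + s w (\<sigma> v) * pX (\<sigma> v) + s w (\<tau> v) * pX (\<tau> v) +
      s w (\<sigma> (\<tau> v)) * pX (\<sigma> (\<tau> v))" for w
    have Y: "Y v = ?c * B v" "Y (\<sigma> v) = ?c * B (\<sigma> v)" "Y (\<tau> v) = ?c * B (\<tau> v)"
      "Y (\<sigma> (\<tau> v)) = ?c * B (\<sigma> (\<tau> v))"
      using True mem by (simp_all add: Y_def B_def inv \<tau>\<sigma> add_ac)
    have "s v v * B v + s v (\<sigma> v) * B (\<sigma> v) + s v (\<tau> v) * B (\<tau> v) + s v (\<sigma> (\<tau> v)) * B (\<sigma> (\<tau> v)) = 4 * pX v"
      unfolding s_def B_def lab by (cases "e1 v"; cases "e2 v") simp_all
    moreover have "sub Y (Y v) = ?c * (s v v * Y v + s v (\<sigma> v) * Y (\<sigma> v) + s v (\<tau> v) * Y (\<tau> v) +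
        s v (\<sigma> (\<tau> v)) * Y (\<sigma> (\<tau> v)))"
      using True by (simp add: Y_def[of v] sub_s)
    moreover have "\<dots> = ?c * (?c * (s v v * B v + s v (\<sigma> v) * B (\<sigma> v) + s v (\<tau> v) * B (\<tau> v) +
        s v (\<sigma> (\<tau> v)) * B (\<sigma> (\<tau> v))))"
      unfolding Y by (simp add: algebra_simps)
    ultimately have "sub Y (Y v) = ?c * (?c * (4 * pX v))" by (simp only:)
    then show ?thesis by (simp only: half)
  next
    case False
    then show ?thesis by (simp add: Y_def)
  qed
qed

text \<open>Replacing \<open>v\<close> by \<sigma> v multiplies its character by the sign given by
  \<open>e1\<close>, so in the new variables \<sigma> is diagonal.\<close>

lemma Y_\<sigma>: "Y (\<sigma> v) = sub (\<lambda>v. single 0 (d\<sigma> v) * pX v) (Y v)"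
proof (cases "v \<in> V")
  case True
  have mem: "\<sigma> v \<in> V" "\<tau> v \<in> V" "\<sigma> (\<tau> v) \<in> V" using True maps by auto
  have lab: "e1 (\<sigma> v) \<longleftrightarrow> \<not> e1 v" "e2 (\<sigma> v) \<longleftrightarrow> e2 v" "e1 (\<tau> v) \<longleftrightarrow> e1 v" "e2 (\<tau> v) \<longleftrightarrow> \<not> e2 v"
    "e1 (\<sigma> (\<tau> v)) \<longleftrightarrow> \<not> e1 v" "e2 (\<sigma> (\<tau> v)) \<longleftrightarrow> \<not> e2 v"
    using label True mem by auto
  show ?thesis
    unfolding Y_def using True mem
    by (cases "e1 v"; cases "e2 v") (simp_all add: s_def lab d\<sigma>_def inv \<tau>\<sigma> single_uminus)
qed (simp add: Y_def fixed d\<sigma>_def)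

lemma Y_\<tau>: "Y (\<tau> v) = sub (\<lambda>v. single 0 (d\<tau> v) * pX v) (Y v)"
proof (cases "v \<in> V")
  case True
  have mem: "\<sigma> v \<in> V" "\<tau> v \<in> V" "\<sigma> (\<tau> v) \<in> V" using True maps by auto
  have lab: "e1 (\<sigma> v) \<longleftrightarrow> \<not> e1 v" "e2 (\<sigma> v) \<longleftrightarrow> e2 v" "e1 (\<tau> v) \<longleftrightarrow> e1 v" "e2 (\<tau> v) \<longleftrightarrow> \<not> e2 v"
    "e1 (\<sigma> (\<tau> v)) \<longleftrightarrow> \<not> e1 v" "e2 (\<sigma> (\<tau> v)) \<longleftrightarrow> \<not> e2 v"
    using label True mem by auto
  show ?thesis
    unfolding Y_def using True mem
    by (cases "e1 v"; cases "e2 v") (simp_all add: s_def lab d\<tau>_def inv \<tau>\<sigma> single_uminus)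
qed (simp add: Y_def fixed d\<tau>_def)

lemma place_Y: "place (\<lambda>u. low_place (Sub Y u))"
  by (rule place_comp[OF place_low_place Y.field_hom_Sub])

text \<open>\<open>Y\<close> conjugates the permutation \<rho> into a diagonal substitution, so the
  multiplier can be read off from leading terms.\<close>

lemma sign_aux:
  assumes "\<And>v. Y (\<rho> v) = sub (\<lambda>v. single 0 (d v) * pX v) (Y v)"
    and "\<And>v. d v = 1 \<or> d v = - 1" and "\<And>v. \<rho> (\<rho> v) = v" and "u \<noteq> 0"
  shows "\<exists>\<eta>. (\<eta> = 1 \<or> \<eta> = - 1) \<and> low_place (Sub Y (Sub (\<lambda>v. pX (\<rho> v)) u / u)) \<eta>"
proof -
  let ?L = "\<lambda>v. single 0 (d v) * pX v"
  have sq: "d v * d v = 1" for v using assms(2)[of v] by auto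
  have L: "invertible_sub ?L ?L"
    by unfold_locales (simp add: mult.assoc[symmetric] mult_single sq)
  have P: "invertible_sub (\<lambda>v. pX (\<rho> v) :: (nat \<Rightarrow>\<^sub>0 nat) \<Rightarrow>\<^sub>0 'k) (\<lambda>v. pX (\<rho> v))"
    by unfold_locales (simp add: assms(3))
  have N: "invertible_sub (\<lambda>v. Y (\<rho> v)) (\<lambda>v. sub (\<lambda>v. pX (\<rho> v)) (Y v))"
    by unfold_locales (simp add: sub_sub[symmetric] Y.inv assms(3))
  interpret Yh: field_hom "Sub Y" by (rule Y.field_hom_Sub)
  have "Sub Y (Sub (\<lambda>v. pX (\<rho> v)) u) = Sub (\<lambda>v. Y (\<rho> v)) u"
    by (rule Sub_Sub[OF Y.invertible_sub_axioms P N]) simp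
  also have "\<dots> = Sub ?L (Sub Y u)"
    by (rule Sub_Sub[OF L Y.invertible_sub_axioms N, symmetric]) (simp add: assms(1))
  finally have "Sub Y (Sub (\<lambda>v. pX (\<rho> v)) u / u) = Sub ?L (Sub Y u) / Sub Y u" by simp
  then show ?thesis using low_place_diagonal[of d "Sub Y u"] assms(2,4) by simp
qed

lemma sign:
  assumes "u \<noteq> 0"
  shows "\<exists>\<eta>. (\<eta> = 1 \<or> \<eta> = - 1) \<and> low_place (Sub Y (Sub (\<lambda>v. pX (\<sigma> v)) u / u)) \<eta>"
    "\<exists>\<eta>. (\<eta> = 1 \<or> \<eta> = - 1) \<and> low_place (Sub Y (Sub (\<lambda>v. pX (\<tau> v)) u / u)) \<eta>"
  using sign_aux[OF Y_\<sigma> _ inv(1) assms] sign_aux[OF Y_\<tau> _ inv(2) assms] by (auto simp: d\<sigma>_def d\<tau>_def)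

end

context dih
begin

lemma no_generator_even:
  fixes t :: "'k::field ratfun"
  assumes "n \<ge> 2" "even n" "(2::'k) \<noteq> 0" "faithful_generator t"
  shows False
proof -
  define m where "m = n div 2"
  have m: "n = m + m" "0 < m" "m < n" using assms(1,2) by (auto simp: m_def elim: evenE)
  have rot: "dih_mult n m (j + n * b) = (m + j) mod n + n * b" if "j < n" "b < 2" for j b
    using mult_rotation[of m j b] that m by simp
  have mm: "dih_mult n m m = 0" using rot[of m 0] m by simp
  have nn: "dih_mult n n n = 0" using mult_reflection[of 0 1] n by simp
  have nm: "dih_mult n n m = m + n" using mult_reflection[of m 0] m by simp
  have mn: "dih_mult n m n = m + n" using rot[of 0 1] m by simp
  have lt: "m < 2 * n" "n < 2 * n" "m + n < 2 * n" using m by auto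
  \<comment> \<open>The four-group is generated by r^m and s. Among rotations the first label marks
    the indices from \<open>m\<close> on, which r^m exchanges with the others; among reflections it
    marks the image of this half under j -> n - j, so that left multiplication by s preserves the
    label.\<close>
  let ?e1 = "\<lambda>v. if v < n then m \<le> v else 0 < v - n \<and> v - n \<le> m"
  let ?e2 = "\<lambda>v. n \<le> v"
  have label: "(?e1 (trans m v) \<longleftrightarrow> \<not> ?e1 v) \<and> (?e2 (trans m v) \<longleftrightarrow> ?e2 v) \<and>
      (?e1 (trans n v) \<longleftrightarrow> ?e1 v) \<and> (?e2 (trans n v) \<longleftrightarrow> \<not> ?e2 v)" if v: "v < 2 * n" for v
  proof -
    obtain j b where jb: "v = j + n * b" "j < n" "b < 2" using v by (rule encode_cases)
    have \<sigma>: "trans m v = (if j < m then m + j else j - m) + n * b"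
    proof -
      have "(m + j) mod n = (if j < m then m + j else j - m)" using jb(2) m by (auto simp: mod_if)
      moreover have "trans m v = dih_mult n m v" using v by (simp add: trans_def)
      ultimately show ?thesis unfolding jb(1) by (simp only: rot[OF jb(2,3)])
    qed
    have \<tau>: "trans n v = (if j = 0 then 0 else n - j) + n * (1 - b)"
    proof -
      have "(n - j) mod n = (if j = 0 then 0 else n - j)" using jb(2) by simp
      moreover have "trans n v = dih_mult n n v" using v by (simp add: trans_def)
      ultimately show ?thesis unfolding jb(1) by (simp only: mult_reflection[OF jb(2,3)])
    qed
    from jb(3) consider "b = 0" | "b = 1" by linarith
    then show ?thesis unfolding \<sigma> \<tau> unfolding jb(1) using jb(2) m by cases auto
  qed
  have trans_less: "trans g v < 2 * n" if "v < 2 * n" "g < 2 * n" for g v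
    using that by (simp add: trans_def mult_less)
  interpret klein_variables "trans m" "trans n" "{0..<2 * n}" ?e1 ?e2 "TYPE('k)"
  proof
    fix v
    show "trans m (trans m v) = v" "trans n (trans n v) = v" "trans n (trans m v) = trans m (trans n v)"
      using lt by (simp_all add: trans_trans mm nn nm mn trans_0)
    show "v \<notin> {0..<2 * n} \<Longrightarrow> trans m v = v" "v \<notin> {0..<2 * n} \<Longrightarrow> trans n v = v"
      by (simp_all add: trans_def)
  qed (use assms(3) label trans_less lt in auto)
  interpret place "\<lambda>u. low_place (Sub Y u)" by (rule place_Y)
  have const: "low_place (Sub Y (constK c)) c" for c
    by (simp add: Y.Sub_constK low_place_constK)
  \<comment> \<open>The residue of \<open>t\<close> is an element of K or infinite; a change of
    generator moves it to 0.\<close>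
  have "\<exists>u. gen constK u = gen constK t \<and> low_place (Sub Y u) 0"
  proof (cases "\<exists>c. low_place (Sub Y t) c")
    case True
    then obtain c where "low_place (Sub Y t) c" by blast
    from add[OF this const[of "- c"]] have "low_place (Sub Y (t - constK c)) 0" by simp
    then show ?thesis using gen_diff_const[OF field_hom_constK] by blast
  next
    case False
    then have "low_place (Sub Y (inverse t)) 0" by (intro total) blast
    then show ?thesis using gen_inverse[OF field_hom_constK] by blast
  qed
  then obtain u where u: "gen constK u = gen constK t" "low_place (Sub Y u) 0" by blast
  have fu: "faithful_generator u" by (rule faithful_generator_cong[OF u(1)[symmetric] assms(4)])
  have "u \<noteq> 0" using fu unfolding faithful_generator_def by (metis constK.hom_zero rangeI)
  obtain a1 b1 c1 d1 where 1: "constK c1 * u + constK d1 \<noteq> 0" "act m u * (constK c1 * u + constK d1) = constK a1 * u + constK b1"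
    by (rule generator_moebius[OF fu lt(1)])
  obtain a2 b2 c2 d2 where 2: "constK c2 * u + constK d2 \<noteq> 0" "act n u * (constK c2 * u + constK d2) = constK a2 * u + constK b2"
    by (rule generator_moebius[OF fu lt(2)])
  have inv: "act m (act m x) = x" "act n (act n x) = x" "act n (act m x) = act m (act n x)" for x :: "'k ratfun"
    using lt by (simp_all add: act_act mm nn nm mn act_0)
  have "act m u = u \<or> act n u = u \<or> act m (act n u) = u"
  proof (rule no_klein_four[of constK "act m" "act n" u, OF field_hom_constK const assms(3) field_hom_act[OF lt(1)] field_hom_act[OF lt(2)]])
    show "act m (act n (act m (act n u))) = u" by (simp add: inv)
  qed (use sign[OF \<open>u \<noteq> 0\<close>] lt 1 2 inv u \<open>u \<noteq> 0\<close> in \<open>simp_all add: act_constK act_def[symmetric]\<close>)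
  moreover have "act m (act n u) = act (m + n) u" using lt by (simp add: act_act mn)
  moreover have "act g u \<noteq> u" if "0 < g" "g < 2 * n" for g
    using fu that by (simp add: faithful_generator_def)
  ultimately show False using lt m(2) n by simp
qed

text \<open>For an element of order 2 the second Lucas value, which is the trace, vanishes.\<close>

lemma involution_trace:
  fixes t :: "'k::field ratfun"
  assumes "faithful_generator t" "0 < g" "g < 2 * n" "dih_mult n g g = 0"
    and "constK c * t + constK d \<noteq> 0" "act g t * (constK c * t + constK d) = constK a * t + constK b"
  shows "a + d = 0 \<and> a * d - b * c \<noteq> 0"
proof -
  have "(act g ^^ 2) t = t" using assms(3,4) by (simp add: numeral_2_eq_2 act_act act_0)
  moreover have "(act g ^^ k) t \<noteq> t" if "0 < k" "k < 2" for k
    using that assms(1-3) by (cases "k = 1") (auto simp: faithful_generator_def)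
  ultimately have "a * d - b * c \<noteq> 0 \<and> lucas (a + d) (a * d - b * c) 2 = 0 \<and>
      (\<forall>k. 0 < k \<and> k < 2 \<longrightarrow> lucas (a + d) (a * d - b * c) k \<noteq> 0)"
    using assms(1,3)
    by (intro moebius_order_imp_lucas[OF field_hom_constK field_hom_act act_constK assms(5,6)])
      (auto simp: transc_constK faithful_generator_def)
  then show ?thesis by (simp add: numeral_2_eq_2)
qed

text \<open>Over the field with two elements, the product of two distinct commuting involutions would have trace 1.\<close>
lemma no_generator_two:
  fixes t :: "'k::field ratfun"
  assumes "n = 2" "(2::'k) = 0" "\<And>x::'k. x = 0 \<or> x = 1" "faithful_generator t"
  shows False
proof -
  have mult: "dih_mult n 1 1 = 0" "dih_mult n 2 2 = 0" "dih_mult n 3 3 = 0" "dih_mult n 1 2 = 3"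
    by (simp_all add: assms(1) dih_mult_def Let_def)
  have lt: "1 < 2 * n" "2 < 2 * n" "3 < 2 * n" using assms(1) by auto
  have tr: "transc constK t" using assms(4) by (simp add: faithful_generator_def transc_constK)
  obtain a b c d where 1: "constK c * t + constK d \<noteq> 0" "act 1 t * (constK c * t + constK d) = constK a * t + constK b"
    by (rule generator_moebius[OF assms(4) lt(1)])
  obtain a' b' c' d' where 2: "constK c' * t + constK d' \<noteq> 0" "act 2 t * (constK c' * t + constK d') = constK a' * t + constK b'"
    by (rule generator_moebius[OF assms(4) lt(2)])
  have tr1: "a + d = 0 \<and> a * d - b * c \<noteq> 0" using involution_trace[OF assms(4) _ lt(1) mult(1) 1] by simp
  have tr2: "a' + d' = 0 \<and> a' * d' - b' * c' \<noteq> 0" using involution_trace[OF assms(4) _ lt(2) mult(2) 2] by simp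
  interpret r: field_hom "act 1" by (rule field_hom_act[OF lt(1)])
  define q where "q = constK c * t + constK d"
  have q: "q \<noteq> 0" "act 1 t * q = constK a * t + constK b" using 1 by (simp_all add: q_def)
  have q': "(constK x * act 1 t + constK y) * q = constK (x * a + y * c) * t + constK (x * b + y * d)" for x y
  proof -
    have "(constK x * act 1 t + constK y) * q = constK x * (act 1 t * q) + constK y * q" by (simp add: algebra_simps)
    then show ?thesis unfolding q(2) by (simp add: q_def algebra_simps)
  qed
  have r3: "act 3 t = act 1 (act 2 t)" using act_act[OF lt(1,2), of t] mult(4) by simp
  have rc: "act 1 (constK x * t + constK y) = constK x * act 1 t + constK y" for x y
    by (simp add: act_constK[OF lt(1)] del: One_nat_def)
  have "act 1 (constK c' * t + constK d') \<noteq> 0" using 2(1) by (simp del: r.hom_add One_nat_def)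
  then have "(constK c' * act 1 t + constK d') * q \<noteq> 0" using q(1) by (simp only: rc mult_eq_0_iff simp_thms)
  then have den: "constK (c' * a + d' * c) * t + constK (c' * b + d' * d) \<noteq> 0" unfolding q' .
  have "act 1 (act 2 t * (constK c' * t + constK d')) = act 1 (constK a' * t + constK b')" by (simp only: 2)
  then have "act 3 t * (constK c' * act 1 t + constK d') = constK a' * act 1 t + constK b'" by (simp only: r.hom_mult rc r3)
  then have "act 3 t * ((constK c' * act 1 t + constK d') * q) = (constK a' * act 1 t + constK b') * q"
    by (simp add: mult.assoc[symmetric])
  then have "act 3 t * (constK (c' * a + d' * c) * t + constK (c' * b + d' * d)) =
      constK (a' * a + b' * c) * t + constK (a' * b + b' * d)" by (simp only: q')
  from involution_trace[OF assms(4) _ lt(3) mult(3) den this]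
  have tr3: "(a' * a + b' * c) + (c' * b + d' * d) = 0" by simp
  have neg: "- x = x" for x :: 'k using assms(2) by (metis add.inverse_unique mult_2 mult_zero_left)
  have d: "d = a" "d' = a'" using tr1 tr2 neg by (metis add_eq_0_iff)+
  have scalar: "\<not> (b = 0 \<and> c = 0)" 
  proof
    assume bc: "b = 0 \<and> c = 0"
    with 1 d have "act 1 t = t" by simp
    with assms(4) lt show False by (auto simp: faithful_generator_def)
  qed
  have scalar': "\<not> (b' = 0 \<and> c' = 0)" 
  proof
    assume bc: "b' = 0 \<and> c' = 0"
    with 2 d have "act 2 t = t" by simp
    with assms(4) lt show False by (auto simp: faithful_generator_def)
  qed
  \<comment> \<open>Over two elements there are only three nonscalar invertible matrices of trace 0,
    and the product of two different ones has order 3 and trace 1. So the vanishing trace of the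
    product forces equality, by a check of all entries.\<close>
  have "(1::'k) + 1 = 0" using assms(2) by simp
  with tr1 tr2 tr3 scalar scalar' d have "a' = a \<and> b' = b \<and> c' = c"
    using assms(3)[of a] assms(3)[of b] assms(3)[of c] assms(3)[of a'] assms(3)[of b'] assms(3)[of c'] by auto
  with 1 2 d have "act 2 t = act 1 t" by (metis mult_right_cancel)
  then have "act 1 (act 2 t) = t" using act_act[OF lt(1,1)] mult(1) act_0 by metis
  with r3 assms(4) lt(3) show False by (auto simp: faithful_generator_def)
qed

end

section \<open>Sufficiency\<close>

lemma linear_form_eq_0:
  fixes \<phi> :: "nat \<Rightarrow> 'k::field"
  assumes "finite A" "(\<Sum>v\<in>A. constK (\<phi> v) * Xvar v) = 0" "v \<in> A"
  shows "\<phi> v = 0"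
proof -
  let ?p = "\<Sum>v\<in>A. single (single v 1) (\<phi> v) :: (nat \<Rightarrow>\<^sub>0 nat) \<Rightarrow>\<^sub>0 'k"
  have "Fract ?p 1 = (\<Sum>v\<in>A. constK (\<phi> v) * Xvar v)"
    by (simp add: rhom.hom_sum[OF rhom_Fract] constK_def Xvar_def mult_single)
  with assms(2) have "?p = 0" by (simp add: Zero_fract_def Fract_inj)
  then have "lookup ?p (single v 1) = 0" by simp
  moreover have "single w (1::nat) = single v 1 \<longleftrightarrow> w = v" for w
    by (metis lookup_single_eq lookup_single_not_eq one_neq_zero)
  ultimately show ?thesis
    using assms(1,3) by (simp add: lookup_sum lookup_single when_def del: One_nat_def)
qed

context dih
begin

definition lf :: "(nat \<Rightarrow> 'k::field) \<Rightarrow> 'k ratfun" where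
  "lf \<phi> = (\<Sum>v<2 * n. constK (\<phi> v) * Xvar v)"

lemma lf_eq_0: "lf \<phi> = 0 \<Longrightarrow> v < 2 * n \<Longrightarrow> \<phi> v = 0"
  unfolding lf_def using linear_form_eq_0[of "{..<2 * n}" \<phi> v] by simp

lemma lf_add: "lf (\<lambda>v. \<phi> v + \<psi> v) = lf \<phi> + lf \<psi>"
  by (simp add: lf_def sum.distrib algebra_simps)

lemma lf_scale: "lf (\<lambda>v. c * \<phi> v) = constK c * lf \<phi>"
  by (simp add: lf_def sum_distrib_left mult.assoc)

lemma lf_in_KV: "lf (\<phi> :: nat \<Rightarrow> 'k::field) \<in> KV {0..<2 * n}"
proof -
  interpret subfld constK "KV {0..<2 * n} :: 'k ratfun set"
    by unfold_locales (rule subfield_over_KV)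
  have "(\<Sum>v\<in>A. constK (\<phi> v) * Xvar v) \<in> KV {0..<2 * n}" if "A \<subseteq> {..<2 * n}" for A
    using that
  proof (induction A rule: infinite_finite_induct)
    case (insert v A)
    then have "constK (\<phi> v) * Xvar v \<in> KV {0..<2 * n}" by (intro mult_in const_in Xvar_in_KV) auto
    with insert show ?case by (simp add: add_in)
  qed auto
  then show ?thesis by (simp add: lf_def)
qed

lemma bij_betw_trans:
  assumes "g < 2 * n" shows "bij_betw (trans g) {..<2 * n} {..<2 * n}"
proof -
  obtain h where h: "h < 2 * n" "\<And>v. trans h (trans g v) = v" using trans_inverse[OF assms] by blast
  have "inj_on (trans g) {..<2 * n}" by (rule inj_on_inverseI[of _ "trans h"]) (rule h)
  moreover have "trans g ` {..<2 * n} \<subseteq> {..<2 * n}" using assms by (auto simp: trans_def mult_less)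
  ultimately show ?thesis by (simp add: bij_betw_def endo_inj_surj)
qed

text \<open>\<open>g\<close> moves the coefficient at \<open>v\<close> to the variable
  \<open>trans g v\<close>; the hypothesis in this direction avoids the inverse of
  \<open>g\<close>.\<close>

lemma act_lf:
  assumes "g < 2 * n" "\<And>v. v < 2 * n \<Longrightarrow> \<psi> (trans g v) = \<phi> v"
  shows "act g (lf \<phi>) = lf \<psi>"
proof -
  interpret h: field_hom "act g" by (rule field_hom_act) fact
  have "act g (lf \<phi>) = (\<Sum>v<2 * n. constK (\<psi> (trans g v)) * Xvar (trans g v))"
    unfolding lf_def h.hom_sum using assms by (intro sum.cong) (auto simp: act_constK act_Xvar)
  also have "\<dots> = lf \<psi>" unfolding lf_def by (rule sum.reindex_bij_betw[OF bij_betw_trans[OF assms(1)]])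
  finally show ?thesis .
qed

lemma act_in_gen_mult:
  assumes "g < 2 * n" "h < 2 * n" "act g t \<in> gen constK t" "act h t \<in> gen constK t"
  shows "act (dih_mult n g h) t \<in> gen constK t"
proof -
  have "act g (act h t) \<in> gen constK (act g t)"
    by (rule hom_gen[OF field_hom_constK field_hom_act[OF assms(1)] act_constK[OF assms(1)] assms(4)])
  also have "\<dots> \<subseteq> gen constK t" by (rule gen_mono[OF field_hom_constK assms(3)])
  finally show ?thesis by (simp add: act_act assms)
qed

lemma act_in_gen:
  assumes "n \<ge> 2" "act 1 t \<in> gen constK t" "act n t \<in> gen constK t" "g < 2 * n"
  shows "act g t \<in> gen constK t"
proof -
  have rot: "act i t \<in> gen constK t" if "i < n" for i
    using that
  proof (induction i)
    case 0
    show ?case by (simp add: act_0 gen_self rhom_constK)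
  next
    case (Suc i)
    have "dih_mult n 1 i = Suc i" using mult_rotation[of 1 i 0] assms(1) Suc.prems by simp
    with act_in_gen_mult[of 1 i t] Suc assms(1,2) show ?case by simp
  qed
  obtain j b where g: "g = j + n * b" "j < n" "b < 2" using assms(4) by (rule encode_cases)
  then consider "b = 0" | "b = 1" by linarith
  then show ?thesis
  proof cases
    case 1
    with rot g show ?thesis by simp
  next
    case 2
    have "dih_mult n j n = j + n" using mult_rotation[of j 0 1] g(2) by simp
    with act_in_gen_mult[of j n t] rot[OF g(2)] assms g 2 show ?thesis by simp
  qed
qed

text \<open>Transcendence degree at least 1 is automatic, as the nontrivial group acts trivially on
  constants. Conversely, if no faithful subfield had degree at most 1, the infimum of these extended
  naturals would be at least 2.\<close>

lemma ess_dim_eq_1_iff: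
  assumes "n \<ge> 2"
  shows "ess_dim TYPE('k::field) (dihedral n) = 1 \<longleftrightarrow>
    (\<exists>t :: 'k ratfun. t \<in> KV {0..<2 * n} \<and> faithful_generator t)"
proof
  have carrier: "carrier (dihedral n) = {0..<2 * n}" "monoid.one (dihedral n) = 0"
    by (simp_all add: dihedral_def)
  assume ed: "ess_dim TYPE('k) (dihedral n) = 1"
  have "\<exists>E :: 'k ratfun set. faithful_G_subfield (dihedral n) E \<and> trdeg_K E \<le> 1"
  proof (rule ccontr)
    assume "\<not> ?thesis"
    then have "eSuc 1 \<le> trdeg_K E" if "faithful_G_subfield (dihedral n) E" for E :: "'k ratfun set"
      using that by (intro ileI1) (auto simp: not_le)
    then have "eSuc 1 \<le> ess_dim TYPE('k) (dihedral n)"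
      unfolding ess_dim_def by (intro INF_greatest) simp
    with ed show False by (simp add: one_eSuc)
  qed
  then obtain E :: "'k ratfun set" where E: "faithful_G_subfield (dihedral n) E" "trdeg_K E \<le> 1" by blast
  then obtain t where "t \<in> E" "faithful_generator t" by (rule faithful_subfield_generator[OF assms])
  moreover have "E \<subseteq> KV {0..<2 * n}" using E(1) by (simp add: faithful_G_subfield_def carrier)
  ultimately show "\<exists>t :: 'k ratfun. t \<in> KV {0..<2 * n} \<and> faithful_generator t" by blast
next
  have carrier: "carrier (dihedral n) = {0..<2 * n}" "monoid.one (dihedral n) = 0"
    by (simp_all add: dihedral_def)
  assume "\<exists>t :: 'k ratfun. t \<in> KV {0..<2 * n} \<and> faithful_generator t"
  then obtain t :: "'k ratfun" where t: "t \<in> KV {0..<2 * n}" "faithful_generator t" by blast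
  define E where "E = gen constK t"
  have tE: "t \<in> E" unfolding E_def by (rule gen_self[OF rhom_constK])
  have EK: "E \<subseteq> KV {0..<2 * n}"
  proof -
    interpret subfld constK "KV {0..<2 * n} :: 'k ratfun set"
      by unfold_locales (rule subfield_over_KV)
    show ?thesis unfolding E_def by (rule gen_subset[OF t(1)])
  qed
  have stable: "act g x \<in> E" if "g < 2 * n" "x \<in> E" for g x
  proof -
    have "act g x \<in> gen constK (act g t)"
      using that by (intro hom_gen[OF field_hom_constK field_hom_act act_constK]) (auto simp: E_def)
    also have "\<dots> \<subseteq> gen constK t"
      using t(2) that(1) by (intro gen_mono[OF field_hom_constK]) (simp add: faithful_generator_def)
    finally show ?thesis by (simp add: E_def)
  qed
  have E: "faithful_G_subfield (dihedral n) E"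
    unfolding faithful_G_subfield_def carrier
  proof (intro conjI ballI impI)
    show "E \<subseteq> KV {0..<2 * n}" by (rule EK)
    show "is_K_subfield E" unfolding is_K_subfield_conv E_def by (rule subfield_over_gen[OF field_hom_constK])
    fix g assume g: "g \<in> {0..<2 * n}"
    show "gact (dihedral n) g x \<in> E" if "x \<in> E" for x
      using gact_eq_act[of g x] stable[of g x] g that EK by auto
    assume "\<forall>x\<in>E. gact (dihedral n) g x = x"
    with tE have "act g t = t" using gact_eq_act[of g t] g t(1) by auto
    with t(2) g show "g = 0" by (auto simp: faithful_generator_def)
  qed
  have "ess_dim TYPE('k) (dihedral n) \<le> trdeg_K E"
    unfolding ess_dim_def using E by (intro INF_lower) simp
  also have "\<dots> \<le> 1" unfolding E_def by (rule trdeg_gen_le_1)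
  finally have "ess_dim TYPE('k) (dihedral n) \<le> 1" .
  moreover have "1 \<le> ess_dim TYPE('k) (dihedral n)"
    unfolding ess_dim_def
  proof (rule INF_greatest)
    fix F :: "'k ratfun set" assume "F \<in> {E. faithful_G_subfield (dihedral n) E}"
    then have F: "F \<subseteq> KV {0..<2 * n}" "\<And>g. g < 2 * n \<Longrightarrow> \<forall>x\<in>F. gact (dihedral n) g x = x \<Longrightarrow> g = 0"
      by (auto simp: faithful_G_subfield_def carrier)
    show "1 \<le> trdeg_K F"
    proof (rule trdeg_K_ge_1, rule notI)
      assume const: "F \<subseteq> range constK"
      have "gact (dihedral n) 1 x = x" if "x \<in> F" for x
      proof -
        obtain c where "x = constK c" using const \<open>x \<in> F\<close> by blast
        then show ?thesis using gact_eq_act[of 1 x] act_constK[of 1 c] \<open>x \<in> F\<close> F(1) assms by auto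
      qed
      with F(2)[of 1] assms show False by simp
    qed
  qed
  ultimately show "ess_dim TYPE('k) (dihedral n) = 1" by (rule antisym)
qed

text \<open>The vertices of the n-gon give the permutation representation with basis \<open>x v + x (v + n)\<close>, and the Lucas
  sequence spans in it the two-dimensional representation with rotation of trace \<open>T\<close> and determinant 1.\<close>
lemma generator_of_lucas:
  fixes T :: "'k::field"
  assumes n3: "n \<ge> 3" "odd n" and u0: "lucas T 1 n = 0" "lucas T 1 (n - 1) = - 1"
    and nz: "\<And>k. 0 < k \<Longrightarrow> k < n \<Longrightarrow> lucas T 1 k \<noteq> 0"
  shows "\<exists>t :: 'k ratfun. t \<in> KV {0..<2 * n} \<and> faithful_generator t"
proof -
  define a where "a = lucas T 1"
  have rec: "a (Suc (Suc k)) = T * a (Suc k) - a k" for k by (simp add: a_def)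
  have a01: "a 0 = 0" "a 1 = 1" and an: "a n = 0" "a (n - 1) = - 1" using u0 by (simp_all add: a_def)
  \<comment> \<open>Determinant 1 makes the recursion reversible, so the values at the two ends
    force the antisymmetry on which the reflection acts by -1.\<close>
  have anti: "k \<le> n \<Longrightarrow> a (n - k) = - a k" for k
  proof (induction k rule: induct_nat_012)
    case (ge2 k)
    define j where "j = n - Suc (Suc k)"
    have j: "n - Suc k = Suc j" "n - k = Suc (Suc j)" using ge2.prems by (auto simp: j_def)
    have "a (n - k) = - a k" "a (n - Suc k) = - a (Suc k)" using ge2 by simp_all
    then have "a (Suc (Suc j)) = - a k" "a (Suc j) = - a (Suc k)" by (simp_all only: j)
    moreover have "a j = T * a (Suc j) - a (Suc (Suc j))" by (simp add: rec)
    ultimately have "a j = - (T * a (Suc k) - a k)" by simp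
    then show ?case unfolding rec by (simp add: j_def)
  qed (use a01 an in auto)
  \<comment> \<open>The values at \<open>n\<close> and \<open>n - 1\<close> make the sequence close
    up around the n-gon: the recursion holds for indices modulo \<open>n\<close>.\<close>
  have shift: "a ((i + (n - 1)) mod n) = T * a i - a (Suc i mod n)" if i: "i < n" for i
  proof -
    consider "i = 0" | "0 < i" "Suc i < n" | "Suc i = n" using i by linarith
    then show ?thesis
    proof cases
      case 1
      then show ?thesis using n3 a01 an by simp
    next
      case 2
      then obtain j where j: "i = Suc j" by (cases i) auto
      have "(i + (n - 1)) mod n = j" using 2 j by (simp add: mod_if)
      then show ?thesis using 2 by (simp add: j rec)
    next
      case 3
      then obtain j where j: "i = Suc j" using n3 by (cases i) auto
      have "(i + (n - 1)) mod n = j" using 3 j by (simp add: mod_if)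
      moreover have "a n = T * a i - a j" unfolding 3[symmetric] j by (rule rec)
      ultimately show ?thesis using 3 an a01 by simp
    qed
  qed
  define \<phi> where "\<phi> v = a (v mod n)" for v
  define \<psi> where "\<psi> v = a ((v mod n + (n - 1)) mod n)" for v
  define u1 u2 where "u1 = lf \<phi>" and "u2 = lf \<psi>"
  have lt: "1 < 2 * n" "n < 2 * n" "n - 1 < 2 * n" using n3 by auto
  have tr1: "trans 1 v mod n = Suc (v mod n) mod n" and trn: "trans n v mod n = (n - v mod n) mod n" if v: "v < 2 * n" for v
  proof -
    obtain j b where jb: "v = j + n * b" "j < n" "b < 2" using v by (rule encode_cases)
    have "dih_mult n 1 v = (1 + j) mod n + n * b" unfolding jb(1) using jb n3 by (intro mult_rotation) auto
    moreover have "dih_mult n n v = (n - j) mod n + n * (1 - b)" unfolding jb(1) using jb by (intro mult_reflection) auto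
    ultimately show "trans 1 v mod n = Suc (v mod n) mod n" "trans n v mod n = (n - v mod n) mod n"
      using v jb(1,2) by (simp_all add: trans_def)
  qed
  have vn: "v mod n < n" for v using n by simp
  have mod_back: "(Suc i mod n + (n - 1)) mod n = i mod n" for i
  proof -
    have "(Suc i mod n + (n - 1)) mod n = (Suc i + (n - 1)) mod n" by (rule mod_add_left_eq)
    also have "Suc i + (n - 1) = i + n" using n by simp
    finally show ?thesis by simp
  qed
  have r1: "act 1 u1 = u2" unfolding u1_def u2_def
  proof (rule act_lf[OF lt(1)])
    fix v assume v: "v < 2 * n"
    show "\<psi> (trans 1 v) = \<phi> v" unfolding \<psi>_def \<phi>_def tr1[OF v] by (simp only: mod_back mod_mod_trivial)
  qed
  have r2: "act 1 u2 = constK T * u2 - u1"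
  proof -
    have "act 1 u2 = lf (\<lambda>v. T * \<psi> v + (- 1) * \<phi> v)" unfolding u2_def
    proof (rule act_lf[OF lt(1)])
      fix v assume v: "v < 2 * n"
      show "T * \<psi> (trans 1 v) + (- 1) * \<phi> (trans 1 v) = \<psi> v"
        unfolding \<psi>_def \<phi>_def tr1[OF v] by (simp only: mod_back mod_mod_trivial shift[OF vn]) simp
    qed
    then show ?thesis by (simp only: lf_add lf_scale) (simp add: u1_def u2_def)
  qed
  have s1: "act n u1 = - u1"
  proof -
    have "act n u1 = lf (\<lambda>v. (- 1) * \<phi> v)" unfolding u1_def
    proof (rule act_lf[OF lt(2)])
      fix v assume v: "v < 2 * n"
      show "(- 1) * \<phi> (trans n v) = \<phi> v"
        unfolding \<phi>_def trn[OF v] using anti[of "v mod n"] vn[of v] a01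
        by (cases "v mod n = 0") auto
    qed
    then show ?thesis by (simp only: lf_scale) (simp add: u1_def)
  qed
  interpret r: field_hom "act 1" by (rule field_hom_act[OF lt(1)])
  interpret s: field_hom "act n" by (rule field_hom_act[OF lt(2)])
  interpret r': field_hom "act (n - 1)" by (rule field_hom_act[OF lt(3)])
  \<comment> \<open>From s r = r^(-1) s, s u1 = -u1 and r^(-1) u1 = T u1 - u2.\<close>
  have s2: "act n u2 = u2 - constK T * u1"
  proof -
    have "dih_mult n n 1 = dih_mult n (n - 1) n"
      using mult_reflection[of 1 0] mult_rotation[of "n - 1" 0 1] n3 by simp
    then have "act n u2 = act (n - 1) (act n u1)"
      unfolding r1[symmetric] by (simp only: act_act[OF lt(2,1)] act_act[OF lt(3,2)])
    also have "\<dots> = - act (n - 1) u1" unfolding s1 by (rule r'.hom_uminus)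
    also have "act (n - 1) u1 = act (n - 1) (act 1 (constK T * u1 - u2))"
      by (simp only: r.hom_diff r.hom_mult act_constK[OF lt(1)] r1 r2) simp
    also have "\<dots> = constK T * u1 - u2"
    proof -
      have "dih_mult n (n - 1) 1 = 0" using mult_rotation[of "n - 1" 1 0] n3 by simp
      then show ?thesis by (simp only: act_act[OF lt(3,1)] act_0)
    qed
    finally show ?thesis by simp
  qed
  \<comment> \<open>At the vertices 0 and 1 the coefficient vectors of \<open>u1\<close> and
    \<open>u2\<close> are (0, 1) and (-1, 0).\<close>
  have indep: "c = 0 \<and> d = 0" if "constK c * u1 + constK d * u2 = 0" for c d
  proof -
    have "lf (\<lambda>v. c * \<phi> v + d * \<psi> v) = 0" using that by (simp add: lf_add lf_scale u1_def u2_def)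
    from lf_eq_0[OF this, of 0] lf_eq_0[OF this, of 1] show ?thesis
      using n3 a01 an by (simp add: \<phi>_def \<psi>_def)
  qed
  have nonzero: "constK c * u1 + constK d * u2 \<noteq> 0" if "c \<noteq> 0 \<or> d \<noteq> 0" for c d
    using indep that by blast
  have u2: "u2 \<noteq> 0" using nonzero[of 0 1] by simp
  define t where "t = u1 / u2"
  have t_KV: "t \<in> KV {0..<2 * n}"
  proof -
    interpret subfld constK "KV {0..<2 * n} :: 'k ratfun set"
      by unfold_locales (rule subfield_over_KV)
    show ?thesis unfolding t_def u1_def u2_def by (intro divide_in lf_in_KV)
  qed
  have t_const: "t \<notin> range constK"
  proof
    assume "t \<in> range constK"
    then obtain c where "t = constK c" by blast
    then have "constK 1 * u1 + constK (- c) * u2 = 0" using u2 by (simp add: t_def field_simps)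
    with indep show False by (metis one_neq_zero)
  qed
  have den: "constK (- 1) * t + constK T \<noteq> 0"
  proof
    assume "constK (- 1) * t + constK T = 0"
    then have "t = constK T" by simp
    with t_const show False by blast
  qed
  \<comment> \<open>\<open>t\<close> goes to 1 / (T - t), given by a matrix of trace
    \<open>T\<close> and determinant 1.\<close>
  have rt: "act 1 t * (constK (- 1) * t + constK T) = constK 0 * t + constK 1"
  proof -
    define d where "d = constK (- 1) * t + constK T"
    have "constK T * u2 - u1 = d * u2" using u2 by (simp add: d_def t_def field_simps)
    then have "act 1 t = u2 / (d * u2)" unfolding t_def r.hom_divide r1 r2 by simp
    moreover have "d \<noteq> 0" using den by (simp only: d_def not_False_eq_True)
    ultimately have "act 1 t * d = 1" using u2 by (simp del: One_nat_def)
    then show ?thesis unfolding d_def by simp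
  qed
  have tr: "transc constK t" by (rule transc_constK[OF t_const])
  have rot: "act k t \<noteq> t" if k: "0 < k" "k < n" for k
  proof
    assume fix_t: "act k t = t"
    obtain j where j: "k = Suc j" using k by (cases k) auto
    have "(act 1 ^^ k) t = t" using rotation_power[of k t] k fix_t n3 by simp
    moreover have "(act 1 ^^ Suc j) t = t \<longleftrightarrow> lucas (0 + T) (0 * T - 1 * - 1) (Suc j) = 0"
      by (rule moebius_power_fixes_iff[OF field_hom_constK field_hom_act[OF lt(1)] act_constK[OF lt(1)] den rt tr]) auto
    ultimately have "lucas T 1 k = 0" by (simp add: j)
    with nz[OF k] show False by simp
  qed
  interpret E: subfld constK "gen constK t"
    by unfold_locales (rule subfield_over_gen[OF field_hom_constK])
  have tE: "t \<in> gen constK t" by (rule gen_self[OF rhom_constK])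
  have "act 1 t = 1 / (constK (- 1) * t + constK T)"
    using rt den by (simp add: nonzero_eq_divide_eq del: One_nat_def)
  also have "\<dots> \<in> gen constK t" using tE by (intro E.divide_in E.add_in E.mult_in E.one_in E.const_in)
  finally have g1: "act 1 t \<in> gen constK t" .
  have u1: "u1 = t * u2" using u2 by (simp add: t_def)
  have "act n t = - u1 / (u2 - constK T * u1)" unfolding t_def by (simp only: s.hom_divide s1 s2)
  also have "\<dots> = - (t * u2) / ((1 - constK T * t) * u2)" unfolding u1 by (simp add: algebra_simps)
  also have "\<dots> = - t / (1 - constK T * t)" using u2 by simp
  also have "\<dots> \<in> gen constK t"
    using tE by (intro E.divide_in E.uminus_in E.diff_in E.mult_in E.one_in E.const_in)
  finally have gn: "act n t \<in> gen constK t" .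
  have gens: "act g t \<in> gen constK t" if "g < 2 * n" for g
    using act_in_gen[OF _ g1 gn that] n3 by simp
  have "act g t \<noteq> t" if g: "g < 2 * n" "0 < g" for g
  proof (cases "g < n")
    case True
    with rot g show ?thesis by blast
  next
    case False
    then obtain j where j: "g = j + n * 1" "j < n" using g by (intro that[of "g - n"]) auto
    show ?thesis
    proof
      assume fix_t: "act g t = t"
      interpret g: field_hom "act g" by (rule field_hom_act[OF g(1)])
      \<comment> \<open>A reflection fixing \<open>t\<close> fixes all of K(t), hence also r t. With
        g r = r^(-1) g this makes r^2 fix \<open>t\<close>, impossible for \<open>n\<close> at least
        3.\<close>
      have "act g x = x" if "x \<in> gen constK t" for x
        using that fix_t by (auto simp: gen_def g.hom_pev rhom_constK act_constK[OF g(1)])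
      then have "act g (act 1 t) = act 1 t" using g1 by blast
      moreover have "dih_mult n g 1 = dih_mult n (n - 1) g"
        using mult_encode[of j 1 1 0] mult_rotation[of "n - 1" j 1] j n3 by (simp add: add_def add.commute)
      then have "act g (act 1 t) = act (n - 1) (act g t)"
        by (simp only: act_act[OF g(1) lt(1)] act_act[OF lt(3) g(1)])
      ultimately have "act (n - 1) t = act 1 t" by (simp only: fix_t)
      then have "act 1 (act (n - 1) t) = act 1 (act 1 t)" by (rule arg_cong)
      moreover have "dih_mult n 1 (n - 1) = 0" "dih_mult n 1 1 = 2"
        using mult_rotation[of 1 "n - 1" 0] mult_rotation[of 1 1 0] n3 by simp_all
      ultimately have "act 2 t = t" by (simp only: act_act[OF lt(1,3)] act_act[OF lt(1,1)] act_0)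
      with rot[of 2] n3 show False by simp
    qed
  qed
  with t_KV t_const gens show ?thesis unfolding faithful_generator_def by blast
qed

text \<open>In characteristic 2 the four-group embeds into the additive group of K as {0, 1, w, 1 +
  w}. The coefficients of \<open>u1\<close> are this embedding and \<open>u2\<close> is the
  invariant sum of the variables, so the group translates u1/u2.\<close>

lemma generator_two:
  fixes w :: "'k::field"
  assumes n2: "n = 2" and two: "(2::'k) = 0" and w: "w \<noteq> 0" "w \<noteq> 1"
  shows "\<exists>t :: 'k ratfun. t \<in> KV {0..<2 * n} \<and> faithful_generator t"
proof -
  define \<phi> :: "nat \<Rightarrow> 'k" where "\<phi> v = [0, 1, w, 1 + w] ! v" for v
  define u1 u2 where "u1 = lf \<phi>" and "u2 = lf (\<lambda>_. 1 :: 'k)"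
  have dbl: "x + x = 0" for x :: 'k using two by (metis mult_2 mult_zero_left)
  have dbl': "x + (x + y) = y" for x y :: 'k by (simp add: dbl flip: add.assoc)
  have lt: "1 < 2 * n" "n < 2 * n" "3 < 2 * n" using n2 by auto
  have mult: "dih_mult n g v = [[0, 1, 2, 3], [1, 0, 3, 2], [2, 3, 0, 1], [3, 2, 1, 0]] ! g ! v"
    if "g < 4" "v < 4" for g v
  proof -
    have "g \<in> {0, 1, 2, 3}" "v \<in> {0, 1, 2, 3}" using that by auto
    then show ?thesis by (auto simp: n2 dih_mult_def Let_def)
  qed
  have tr: "trans g v = [[0, 1, 2, 3], [1, 0, 3, 2], [2, 3, 0, 1], [3, 2, 1, 0]] ! g ! v"
    if "g < 4" "v < 4" for g v
  proof -
    have "v < 2 * n" using that n2 by simp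
    then have "trans g v = dih_mult n g v" by (simp add: trans_def)
    with mult[OF that] show ?thesis by simp
  qed
  have trn: "trans n v = [2, 3, 0, 1] ! v" if "v < 4" for v
    using tr[of n v] that n2 by simp
  have r1: "act 1 u1 = u1 + u2" and s1: "act n u1 = u1 + constK w * u2"
  proof -
    have "act 1 u1 = lf (\<lambda>v. \<phi> v + 1)" unfolding u1_def
    proof (rule act_lf[OF lt(1)])
      fix v assume "v < 2 * n"
      then have "v \<in> {0, 1, 2, 3}" using n2 by auto
      then show "\<phi> (trans 1 v) + 1 = \<phi> v"
        using tr[of 1 v] by (auto simp: \<phi>_def dbl add_ac dbl')
    qed
    then show "act 1 u1 = u1 + u2" by (simp add: lf_add u1_def u2_def)
    have "act n u1 = lf (\<lambda>v. \<phi> v + w * 1)" unfolding u1_def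
    proof (rule act_lf[OF lt(2)])
      fix v assume "v < 2 * n"
      then have "v \<in> {0, 1, 2, 3}" using n2 by auto
      then show "\<phi> (trans n v) + w * 1 = \<phi> v"
        using trn[of v] by (auto simp: \<phi>_def dbl add_ac dbl')
    qed
    then show "act n u1 = u1 + constK w * u2" by (simp only: lf_add lf_scale u1_def u2_def)
  qed
  have inv2: "act g u2 = u2" if "g < 2 * n" for g
    unfolding u2_def by (rule act_lf[OF that]) simp
  have u2: "u2 \<noteq> 0" unfolding u2_def using lf_eq_0[of "\<lambda>_. 1 :: 'k" 0] n by auto
  define t where "t = u1 / u2"
  have t_KV: "t \<in> KV {0..<2 * n}"
  proof -
    interpret subfld constK "KV {0..<2 * n} :: 'k ratfun set"
      by unfold_locales (rule subfield_over_KV)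
    show ?thesis unfolding t_def u1_def u2_def by (intro divide_in lf_in_KV)
  qed
  have t_const: "t \<notin> range constK"
  proof
    assume "t \<in> range constK"
    then obtain c where "t = constK c" by blast
    then have "u1 + constK (- c) * u2 = 0" using u2 by (simp add: t_def field_simps)
    then have "lf (\<lambda>v. \<phi> v + (- c) * 1) = 0" by (simp only: lf_add lf_scale u1_def u2_def)
    from lf_eq_0[OF this, of 0] lf_eq_0[OF this, of 1] show False
      using n2 by (simp add: \<phi>_def)
  qed
  interpret r: field_hom "act 1" by (rule field_hom_act[OF lt(1)])
  interpret s: field_hom "act n" by (rule field_hom_act[OF lt(2)])
  have rt: "act 1 t = t + constK 1"
    unfolding t_def r.hom_divide r1 inv2[OF lt(1)] using u2 by (simp add: field_simps)
  have st: "act n t = t + constK w"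
    unfolding t_def s.hom_divide s1 inv2[OF lt(2)] using u2 by (simp add: field_simps)
  have "dih_mult n 1 n = 3" using mult[of 1 2] n2 by simp
  then have rst: "act 3 t = t + constK (1 + w)"
    using act_act[OF lt(1,2), of t] by (simp only: st r.hom_add act_constK[OF lt(1)] rt) (simp add: add_ac)
  have "1 + w \<noteq> 0" using w(2) dbl' by (metis add.right_neutral)
  have cases: "g = 0 \<or> g = 1 \<or> g = n \<or> g = 3" if "g < 2 * n" for g using that n2 by auto
  have "act g t \<in> gen constK t \<and> (0 < g \<longrightarrow> act g t \<noteq> t)" if "g < 2 * n" for g
  proof -
    interpret E: subfld constK "gen constK t"
      by unfold_locales (rule subfield_over_gen[OF field_hom_constK])
    have tE: "t \<in> gen constK t" by (rule gen_self[OF rhom_constK])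
    have "g = 0 \<or> (\<exists>c. c \<noteq> 0 \<and> act g t = t + constK c)"
      using cases[OF that] rt st rst w \<open>1 + w \<noteq> 0\<close> by (metis one_neq_zero)
    with tE show ?thesis by (auto simp: act_0 intro!: E.add_in)
  qed
  with t_KV t_const show ?thesis unfolding faithful_generator_def by blast
qed

end

section \<open>Assembly of the three cases\<close>

theorem theorem1p4:
  fixes n :: nat
  assumes "n \<ge> 2"
  shows "(CHAR('k::field) = 0 \<longrightarrow>
            (ess_dim TYPE('k) (dihedral n) = 1 \<longleftrightarrow> odd n \<and> zeta_sum_in TYPE('k) n))
       \<and> (\<forall>p. CHAR('k) = p \<and> p > 0 \<and> p \<noteq> 2 \<longrightarrow>
            (ess_dim TYPE('k) (dihedral n) = 1 \<longleftrightarrow>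
               odd n \<and> (\<not> p dvd n \<longrightarrow> zeta_sum_in TYPE('k) n) \<and> (p dvd n \<longrightarrow> n = p)))
       \<and> (CHAR('k) = 2 \<longrightarrow>
            (ess_dim TYPE('k) (dihedral n) = 1 \<longleftrightarrow>
               (odd n \<longrightarrow> zeta_sum_in TYPE('k) n) \<and>
               (even n \<longrightarrow> (infinite (UNIV :: 'k set) \<or> card (UNIV :: 'k set) \<ge> 4) \<and> n = 2)))"
proof -
  interpret dih n using assms by unfold_locales simp
  define P where "P \<longleftrightarrow> (\<exists>t :: 'k ratfun. t \<in> KV {0..<2 * n} \<and> faithful_generator t)"
  have ed: "ess_dim TYPE('k) (dihedral n) = 1 \<longleftrightarrow> P"
    unfolding P_def by (rule ess_dim_eq_1_iff[OF assms])
  have two: "(2::'k) = 0 \<longleftrightarrow> CHAR('k) = 2"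
  proof -
    have "(2::'k) = 0 \<longleftrightarrow> CHAR('k) dvd 2" using of_nat_eq_0_iff_char_dvd[of 2, where 'a = 'k] by simp
    also have "\<dots> \<longleftrightarrow> CHAR('k) = 1 \<or> CHAR('k) = 2" using two_is_prime_nat by (metis prime_nat_iff dvd_refl one_dvd)
    also have "\<dots> \<longleftrightarrow> CHAR('k) = 2" using of_nat_CHAR[where 'a = 'k] by auto
    finally show ?thesis .
  qed
  have even: "CHAR('k) = 2" if P "even n"
    using no_generator_even[OF assms that(2)] that(1) two by (auto simp: P_def)
  have zeta: "zeta_sum_in TYPE('k) n" if P "\<not> CHAR('k) dvd n"
  proof -
    obtain t :: "'k ratfun" where "faithful_generator t" using \<open>P\<close> by (auto simp: P_def)
    then obtain T D :: 'k where "lucas_period T D n" by (rule lucas_period_of_generator[OF assms])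
    then show ?thesis using that(2) by (rule lucas_period.zeta_sum_in)
  qed
  have char: "n = CHAR('k)" if P "CHAR('k) > 0" "CHAR('k) dvd n"
  proof -
    obtain t :: "'k ratfun" where "faithful_generator t" using \<open>P\<close> by (auto simp: P_def)
    then obtain T D :: 'k where "lucas_period T D n" by (rule lucas_period_of_generator[OF assms])
    then show ?thesis using that(2,3) by (rule lucas_period.eq_char)
  qed
  have n3: "n \<ge> 3" if "odd n" using assms that by (cases "n = 2") auto
  have P_zeta: P if "odd n" "zeta_sum_in TYPE('k) n"
    using lucas_of_zeta_sum[OF that(2,1) assms] generator_of_lucas[OF n3[OF that(1)] that(1)]
    unfolding P_def by metis
  have P_char: P if "odd n" "n = CHAR('k)"
    unfolding P_def
  proof (rule generator_of_lucas[OF n3[OF that(1)] that(1), of 2])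
    have zero: "(of_nat k :: 'k) = 0 \<longleftrightarrow> n dvd k" for k by (simp add: of_nat_eq_0_iff_char_dvd that(2))
    show "lucas (2::'k) 1 n = 0" by (simp add: lucas_2_1 zero)
    show "lucas (2::'k) 1 (n - 1) = - 1" using zero[of n] assms by (simp add: lucas_2_1 of_nat_diff)
    show "lucas (2::'k) 1 k \<noteq> 0" if "0 < k" "k < n" for k
      using that by (simp add: lucas_2_1 zero nat_dvd_not_less)
  qed
  have P_two: "P \<longleftrightarrow> (infinite (UNIV :: 'k set) \<or> card (UNIV :: 'k set) \<ge> 4)" if n2: "n = 2" and c2: "CHAR('k) = 2"
  proof
    assume P
    then obtain w :: 'k where w: "w \<noteq> 0" "w \<noteq> 1"
      using no_generator_two[OF n2] c2 two unfolding P_def by metis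
    \<comment> \<open>A third element of K forces a fourth, which is the source of the bound
      4.\<close>
    have "1 + w \<noteq> 0" using w(2) two c2 by (metis add_left_imp_eq one_add_one)
    then have "card {0, 1, w, 1 + w} = 4" using w by auto
    then show "infinite (UNIV :: 'k set) \<or> card (UNIV :: 'k set) \<ge> 4"
      using card_mono[of "UNIV :: 'k set" "{0, 1, w, 1 + w}"] by auto
  next
    assume *: "infinite (UNIV :: 'k set) \<or> card (UNIV :: 'k set) \<ge> 4"
    have "\<exists>w::'k. w \<noteq> 0 \<and> w \<noteq> 1"
    proof (rule ccontr)
      assume "\<not> ?thesis"
      then have U: "(UNIV :: 'k set) = {0, 1}" by auto
      have "card {0, 1 :: 'k} = 2" by simp
      with * show False unfolding U by simp
    qed
    then show P using generator_two[OF n2] c2 two unfolding P_def by blast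
  qed
  show ?thesis
    unfolding ed
  proof (intro conjI allI impI)
    assume "CHAR('k) = 0"
    then show "P \<longleftrightarrow> odd n \<and> zeta_sum_in TYPE('k) n"
      using even zeta P_zeta assms by auto
  next
    fix p assume p: "CHAR('k) = p \<and> 0 < p \<and> p \<noteq> 2"
    then show "P \<longleftrightarrow> odd n \<and> (\<not> p dvd n \<longrightarrow> zeta_sum_in TYPE('k) n) \<and> (p dvd n \<longrightarrow> n = p)"
      using even zeta char P_zeta P_char by blast
  next
    assume 2: "CHAR('k) = 2"
    have "zeta_sum_in TYPE('k) n" if P "odd n" using zeta[OF that(1)] that(2) 2 by simp
    moreover have "n = 2" if P "even n" using char[OF that(1)] that(2) 2 by simp
    ultimately show "P \<longleftrightarrow> (odd n \<longrightarrow> zeta_sum_in TYPE('k) n) \<and>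
        (even n \<longrightarrow> (infinite (UNIV :: 'k set) \<or> card (UNIV :: 'k set) \<ge> 4) \<and> n = 2)"
      using P_zeta P_two 2 by blast
  qed
qed

end
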